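(* Assume $F^1,\dots,F^k$ and $a$ are $C^2$ and let $\beta>0$. For every $u_0\in\mathcal{U}$, the Cauchy problem $\partial_tU_t=-\mathcal{G}^\beta[U_t]$, $U_0=u_0$, admits a unique, globally defined, continuously differentiable solution $U:[0,+\infty)\to\mathcal{U}$.
   Context: $F:\mathbb{R}^n\to\mathbb{R}^{n\times k}$ is globally Lipschitz with columns $F^1,\dots,F^k$; $x_0\in\mathbb{R}^n$ fixed; $\mathcal{U}=L^2([0,1],\mathbb{R}^k)$; $x_u$ solves $\dot x_u=F(x_u)u$, $x_u(0)=x_0$. $a:\mathbb{R}^n\to[0,\infty)$. For $\beta>0$, $\mathcal{F}^\beta:\mathcal{U}\to[0,\infty)$, $\mathcal{F}^\beta(u)=\frac12\|u\|_{L^2}^2+\beta a(x_u(1))$, and $\mathcal{G}^\beta:\mathcal{U}\to\mathcal{U}$ is the Riesz representative of its differential: $\langle\mathcal{G}^\beta[u],v\rangle_{L^2}=d_u\mathcal{F}^\beta(v)$ for all $u,v\in\mathcal{U}$. Derivatives of curves $t\mapsto U_t\in\mathcal{U}$ are strong (norm) derivatives. *)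

theory Defs
  imports "HOL-Analysis.Analysis"
begin

text \<open>Elements of U = L^2([0,1],R^k) are represented by functions real => real^'k;
only their values on [0,1] matter, and equality in U is equality a.e., i.e.
L2 distance zero.\<close>

definition L2 :: "(real \<Rightarrow> real^'k) \<Rightarrow> bool" where
  "L2 u \<longleftrightarrow> set_borel_measurable lborel {0..1} u \<and>
            set_integrable lborel {0..1} (\<lambda>t. (norm (u t))\<^sup>2)"

definition L2inner :: "(real \<Rightarrow> real^'k) \<Rightarrow> (real \<Rightarrow> real^'k) \<Rightarrow> real" where
  "L2inner u v = (LINT t:{0..1}|lborel. u t \<bullet> v t)"

definition L2norm :: "(real \<Rightarrow> real^'k) \<Rightarrow> real" where
  "L2norm u = sqrt (LINT t:{0..1}|lborel. (norm (u t))\<^sup>2)"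

definition C2 :: "('a::euclidean_space \<Rightarrow> 'b::euclidean_space) \<Rightarrow> bool" where
  "C2 f \<longleftrightarrow> (\<exists>f' f''. (\<forall>x. (f has_derivative blinfun_apply (f' x)) (at x)) \<and>
                      (\<forall>x. (f' has_derivative blinfun_apply (f'' x)) (at x)) \<and>
                      continuous_on UNIV f'')"

text \<open>Endpoint x_u(1) of the (Caratheodory) solution of x' = F(x) u, x(0) = x0 on [0,1].\<close>

definition endpoint :: "(real^'n \<Rightarrow> real^'k^'n) \<Rightarrow> real^'n \<Rightarrow> (real \<Rightarrow> real^'k) \<Rightarrow> real^'n" where
  "endpoint F x0 u = (THE y. \<exists>x. continuous_on {0..1} x \<and>
       (\<forall>t\<in>{0..1}. x t = x0 + (LINT s:{0..t}|lborel. F (x s) *v u s)) \<and> x 1 = y)"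

definition Fbeta :: "(real^'n \<Rightarrow> real^'k^'n) \<Rightarrow> real^'n \<Rightarrow> (real^'n \<Rightarrow> real) \<Rightarrow> real
                      \<Rightarrow> (real \<Rightarrow> real^'k) \<Rightarrow> real" where
  "Fbeta F x0 a \<beta> u = 1/2 * (L2norm u)\<^sup>2 + \<beta> * a (endpoint F x0 u)"

definition is_L2_gradient :: "((real \<Rightarrow> real^'k) \<Rightarrow> real) \<Rightarrow> ((real \<Rightarrow> real^'k) \<Rightarrow> (real \<Rightarrow> real^'k)) \<Rightarrow> bool" where
  "is_L2_gradient \<Phi> G \<longleftrightarrow> (\<forall>u. L2 u \<longrightarrow> L2 (G u) \<and>
      (\<forall>\<epsilon>>0. \<exists>\<delta>>0. \<forall>h. L2 h \<and> L2norm h < \<delta> \<longrightarrow>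
          \<bar>\<Phi> (\<lambda>t. u t + h t) - \<Phi> u - L2inner (G u) h\<bar> \<le> \<epsilon> * L2norm h))"

definition is_C1_flow_solution :: "((real \<Rightarrow> real^'k) \<Rightarrow> (real \<Rightarrow> real^'k)) \<Rightarrow> (real \<Rightarrow> real^'k)
                                  \<Rightarrow> (real \<Rightarrow> real \<Rightarrow> real^'k) \<Rightarrow> bool" where
  "is_C1_flow_solution G u0 U \<longleftrightarrow>
     (\<forall>t\<ge>0. L2 (U t)) \<and>
     L2norm (\<lambda>r. U 0 r - u0 r) = 0 \<and>
     (\<forall>t\<ge>0. ((\<lambda>s. L2norm (\<lambda>r. (U s r - U t r) /\<^sub>R (s - t) + G (U t) r)) \<longlongrightarrow> 0)
               (at t within {0..})) \<and>
     (\<forall>t\<ge>0. ((\<lambda>s. L2norm (\<lambda>r. G (U s) r - G (U t) r)) \<longlongrightarrow> 0) (at t within {0..}))"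

end

(* F^beta is an energy: it decreases along the flow and dominates |u|^2/2, so the flow stays in a
   fixed L2 ball, where the gradient field is Lipschitz. Cutting the field off outside that ball turns
   the problem into a globally Lipschitz one, and the energy estimate shows that the cutoff is never
   felt.

   The gradient is u + beta F(x_u)^T l_u with l_u the adjoint state (a backward linear Volterra
   equation with terminal value grad a(x_u(1))). The second term is a continuous function of time,
   and its sup norm depends on u in a Lipschitz way on L2 balls. Hence U_t = c(t) u_0 + w(t) with
   w(t) in C[0,1], and the flow can be solved in the Banach space R x C[0,1]: the completeness of L2
   is not needed.

   Volterra equations with an L2 kernel are treated with an exponentially weighted sup norm: for a
   steep weight, Cauchy-Schwarz makes the integral operator a contraction, which yields existence
   and the Gronwall bounds at once. *)
theory Submission
  imports Defs
begin

section \<open>Gradient flows in an inner product space\<close>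

text \<open>The differential of the endpoint cost is found without solving the linearised state
  equation. The true increment of the state is paired with the adjoint state and integrated by
  parts; by Taylor's formula, what remains beside the pairing with the gradient is quadratic in the
  perturbation of the control. C2 regularity enters as Lipschitz continuity of the first derivatives
  on balls: it makes that remainder quadratic and the gradient field Lipschitz on balls. The
  constants obtained grow with the radius, hence the cutoff.

  The constants of the Volterra bounds depend on the kernel through its L2 norm alone, so one
  constant serves a whole ball of controls; boundedness, Lipschitz dependence and uniqueness are
  instances of one estimate.

  The statement speaks of functions, and a gradient \<open>G\<close> may return any representative.
  The analysis of the flow runs on a quotient type \<open>l2\<close>, an inner product space where
  gradients are unique, and the last proof translates back.\<close>

lemma integral_exp_Icc0:
  fixes K :: real
  assumes "K > 0" "0 \<le> s"
  shows "integral {0..s} (\<lambda>r. c * exp (K * r)) = c * (exp (K * s) - 1) / K"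
    and "(\<lambda>r. c * exp (K * r)) integrable_on {0..s}"
proof -
  have "((\<lambda>r. c * exp (K * r)) has_integral (c * exp (K * s) / K - c * exp (K * 0) / K)) {0..s}"
    by (rule fundamental_theorem_of_calculus)
      (use assms in \<open>auto intro!: derivative_eq_intros simp flip: has_real_derivative_iff_has_vector_derivative\<close>)
  then show "integral {0..s} (\<lambda>r. c * exp (K * r)) = c * (exp (K * s) - 1) / K"
    and "(\<lambda>r. c * exp (K * r)) integrable_on {0..s}"
    using \<open>K > 0\<close> by (auto simp: has_integral_iff diff_divide_distrib right_diff_distrib)
qed

lemma continuous_on_all_Icc:
  fixes g :: "real \<Rightarrow> 'a::metric_space"
  assumes "\<And>b. continuous_on {0..b} g"
  shows "continuous_on {0..} g"
  unfolding continuous_on_eq_continuous_within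
proof
  fix x :: real assume x: "x \<in> {0..}"
  have "continuous (at x within {0..x+1}) g"
    using assms[of "x+1"] x by (auto simp: continuous_on_eq_continuous_within)
  then show "continuous (at x within {0..}) g"
    by (subst at_within_nhd[where S="{..<x+1}" and U="{0..x+1}"]) (use x in auto)
qed

text \<open>Picard iteration for \<open>exp (- K * t) *\<^sub>R y t\<close> instead of
  \<open>y\<close>: the weight absorbs exponential growth, so a single contraction on bounded
  continuous functions covers the whole half line and no local solutions have to be glued.\<close>

lemma lipschitz_ode_global_solution:
  fixes f :: "'a::banach \<Rightarrow> 'a"
  assumes lip: "\<And>x y. norm (f x - f y) \<le> L * norm (x - y)" and L: "L \<ge> 0"
  obtains y where "y 0 = y0" "\<And>t. t \<ge> 0 \<Longrightarrow> (y has_vector_derivative f (y t)) (at t within {0..})"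
proof -
  \<comment> \<open>The weighted Picard map has Lipschitz constant \<open>L / K\<close>; this choice
    keeps it at most 1/2, and the summand 1 keeps \<open>K\<close> positive when \<open>L\<close> is
    0.\<close>
  define K where "K = 2 * L + 1"
  have K: "K > 0" "L / K \<le> 1/2" using L by (auto simp: K_def field_simps)
  have fc: "continuous_on S f" for S
    by (rule lipschitz_on_continuous_on[where L=L]) (rule lipschitz_onI, auto simp: dist_norm lip L)
  have g_cont: "continuous_on S (\<lambda>r. f (exp (K * r) *\<^sub>R apply_bcontfun Z r))" for S Z
    by (rule continuous_on_compose2[OF fc]) (auto intro!: continuous_intros)
  note g_int = integrable_continuous_real[OF g_cont]
  \<comment> \<open>The unknown \<open>Z\<close> stands for the weighted solution.
    \<open>max 0 t\<close> freezes the map at time 0 for negative times, because a bounded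
    continuous function must be given on the whole line.\<close>
  define T where "T Z t = exp (- K * max 0 t) *\<^sub>R
      (y0 + integral {0..max 0 t} (\<lambda>r. f (exp (K * r) *\<^sub>R apply_bcontfun Z r)))" for Z t
  have f_bd: "norm (f (exp (K * r) *\<^sub>R apply_bcontfun Z r)) \<le> (norm (f 0) + L * norm Z) * exp (K * r)"
    if "r \<ge> 0" for Z r
  proof -
    have "norm (f (exp (K * r) *\<^sub>R apply_bcontfun Z r)) \<le> norm (f 0) + L * norm (exp (K * r) *\<^sub>R apply_bcontfun Z r)"
      using lip[of "exp (K * r) *\<^sub>R apply_bcontfun Z r" 0] norm_triangle_ineq2[of "f (exp (K * r) *\<^sub>R apply_bcontfun Z r)" "f 0"] by simp
    also have "\<dots> \<le> norm (f 0) * exp (K * r) + L * (exp (K * r) * norm Z)"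
      using that K L norm_bounded[of Z r]
      by (intro add_mono mult_left_mono) (auto simp: mult_le_cancel_left1)
    finally show ?thesis by (simp add: algebra_simps)
  qed
  have bc: "T Z \<in> bcontfun" for Z
  proof (rule bcontfun_normI)
    have "continuous_on {0..b} (\<lambda>x. integral {0..x} (\<lambda>r. f (exp (K * r) *\<^sub>R apply_bcontfun Z r)))" for b
      by (rule indefinite_integral_continuous_1[OF g_int])
    then have "continuous_on {0..} (\<lambda>x. integral {0..x} (\<lambda>r. f (exp (K * r) *\<^sub>R apply_bcontfun Z r)))"
      by (rule continuous_on_all_Icc)
    then have "continuous_on UNIV (\<lambda>t. integral {0..max 0 t} (\<lambda>r. f (exp (K * r) *\<^sub>R apply_bcontfun Z r)))"
      by (rule continuous_on_compose2) (auto intro!: continuous_intros)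
    then show "continuous_on UNIV (T Z)"
      unfolding T_def by (intro continuous_intros)
    fix t :: real
    define s where "s = max 0 t"
    have s: "s \<ge> 0" by (simp add: s_def)
    have "norm (integral {0..s} (\<lambda>r. f (exp (K * r) *\<^sub>R apply_bcontfun Z r)))
        \<le> integral {0..s} (\<lambda>r. (norm (f 0) + L * norm Z) * exp (K * r))"
      by (rule integral_norm_bound_integral[OF g_int integral_exp_Icc0(2)[OF K(1) s]]) (use f_bd in auto)
    also have "\<dots> \<le> (norm (f 0) + L * norm Z) / K * exp (K * s)"
      using K L by (subst integral_exp_Icc0(1)[OF K(1) s]) (simp add: field_simps)
    finally have 1: "norm (integral {0..s} (\<lambda>r. f (exp (K * r) *\<^sub>R apply_bcontfun Z r)))
        \<le> (norm (f 0) + L * norm Z) / K * exp (K * s)" .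
    have "norm (T Z t) \<le> exp (- K * s) * (norm y0 + (norm (f 0) + L * norm Z) / K * exp (K * s))"
      unfolding T_def s_def[symmetric] norm_scaleR
      by (simp only: abs_exp_cancel) (intro mult_left_mono norm_triangle_le add_left_mono 1; simp)
    also have "\<dots> = exp (- K * s) * norm y0 + (norm (f 0) + L * norm Z) / K"
      by (simp add: algebra_simps flip: exp_add)
    also have "\<dots> \<le> 1 * norm y0 + (norm (f 0) + L * norm Z) / K"
      using K s by (intro add_mono mult_right_mono) auto
    finally show "norm (T Z t) \<le> 1 * norm y0 + (norm (f 0) + L * norm Z) / K" .
  qed
  have app: "apply_bcontfun (Bcontfun (T Z)) = T Z" for Z
    by (rule Bcontfun_inverse[OF bc])
  have contr: "dist (Bcontfun (T Z)) (Bcontfun (T Z')) \<le> 1/2 * dist Z Z'" for Z Z'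
  proof -
    have "norm (T Z t - T Z' t) \<le> 1/2 * norm (Z - Z')" for t
    proof -
      define s where "s = max 0 t"
      have s: "s \<ge> 0" by (simp add: s_def)
      have "norm (integral {0..s} (\<lambda>r. f (exp (K * r) *\<^sub>R apply_bcontfun Z r) - f (exp (K * r) *\<^sub>R apply_bcontfun Z' r)))
          \<le> integral {0..s} (\<lambda>r. (L * norm (Z - Z')) * exp (K * r))"
      proof (rule integral_norm_bound_integral[OF _ integral_exp_Icc0(2)[OF K(1) s]])
        fix r :: real
        have "norm (f (exp (K * r) *\<^sub>R apply_bcontfun Z r) - f (exp (K * r) *\<^sub>R apply_bcontfun Z' r))
           \<le> L * norm (exp (K * r) *\<^sub>R apply_bcontfun (Z - Z') r)"
          by (rule order_trans[OF lip]) (simp add: scaleR_diff_right)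
        also have "\<dots> \<le> L * (exp (K * r) * norm (Z - Z'))"
          using norm_bounded[of "Z - Z'" r] by (auto intro!: mult_left_mono L simp del: minus_bcontfun.rep_eq)
        finally show "norm (f (exp (K * r) *\<^sub>R apply_bcontfun Z r) - f (exp (K * r) *\<^sub>R apply_bcontfun Z' r))
             \<le> L * norm (Z - Z') * exp (K * r)" by (simp add: algebra_simps)
      qed (auto intro!: integrable_diff g_int)
      also have "\<dots> \<le> L / K * norm (Z - Z') * exp (K * s)"
        using K L by (subst integral_exp_Icc0(1)[OF K(1) s]) (simp add: field_simps)
      also have "\<dots> \<le> 1/2 * norm (Z - Z') * exp (K * s)"
        using K by (intro mult_right_mono) auto
      finally have 1: "norm (integral {0..s} (\<lambda>r. f (exp (K * r) *\<^sub>R apply_bcontfun Z r) - f (exp (K * r) *\<^sub>R apply_bcontfun Z' r)))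
        \<le> 1/2 * norm (Z - Z') * exp (K * s)" .
      have "T Z t - T Z' t = exp (- K * s) *\<^sub>R integral {0..s} (\<lambda>r. f (exp (K * r) *\<^sub>R apply_bcontfun Z r) - f (exp (K * r) *\<^sub>R apply_bcontfun Z' r))"
        unfolding T_def s_def[symmetric] by (subst integral_diff[OF g_int g_int]) (simp add: algebra_simps)
      also have "norm \<dots> \<le> exp (- K * s) * (1/2 * norm (Z - Z') * exp (K * s))"
        using 1 by (simp only: norm_scaleR) (auto intro!: mult_left_mono)
      also have "\<dots> = 1/2 * norm (Z - Z')" by (simp add: field_simps flip: exp_add)
      finally show ?thesis .
    qed
    then show ?thesis
      by (intro dist_bound) (auto simp: app dist_norm)
  qed
  obtain Z where Z: "Bcontfun (T Z) = Z"
    using banach_fix_type[of "1/2" "\<lambda>Z. Bcontfun (T Z)"] contr by auto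
  define y where "y t = y0 + integral {0..t} (\<lambda>r. f (exp (K * r) *\<^sub>R apply_bcontfun Z r))" for t
  have yZ: "exp (K * t) *\<^sub>R apply_bcontfun Z t = y t" if "t \<ge> 0" for t
  proof -
    have "apply_bcontfun Z t = T Z t" using app[of Z] Z by simp
    then show ?thesis using that unfolding T_def y_def by (simp add: max_absorb2 flip: exp_add)
  qed
  show thesis
  proof
    show "y 0 = y0" by (simp add: y_def)
    fix t :: real assume t: "t \<ge> 0"
    \<comment> \<open>The fundamental theorem needs a compact interval; the right end
      \<open>t+1\<close> leaves a neighbourhood of \<open>t\<close>, so the derivative within it is
      the derivative within the half line.\<close>
    have "(y has_vector_derivative f (exp (K * t) *\<^sub>R apply_bcontfun Z t)) (at t within {0..t+1})"
      unfolding y_def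
      using has_vector_derivative_add[OF has_vector_derivative_const integral_has_vector_derivative[OF g_cont, of t 0 "t+1" Z]] t by simp
    then have "(y has_vector_derivative f (y t)) (at t within {0..t+1})"
      using yZ[OF t] by simp
    then show "(y has_vector_derivative f (y t)) (at t within {0..})"
      by (subst (asm) at_within_nhd[where S="{..<t+1}" and U="{0..}"]) (use t in auto)
  qed
qed

text \<open>The radial factor is 1-Lipschitz, equals 1 up to radius \<open>R + 1\<close> and
  vanishes from \<open>R + 2\<close> on. For two points inside, the product rule gives
  \<open>M\<close> from the factor and \<open>C\<close> from \<open>H\<close>. If one point lies
  outside, its term is 0, and the change of the factor alone pays for the other.\<close>

lemma cutoff_lipschitz:
  fixes H :: "'x::real_normed_vector \<Rightarrow> 'b::real_normed_vector"
  assumes lip: "\<And>u v. norm u \<le> R + 2 \<Longrightarrow> norm v \<le> R + 2 \<Longrightarrow> norm (H u - H v) \<le> C * norm (u - v)"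
    and bd: "\<And>u. norm u \<le> R + 2 \<Longrightarrow> norm (H u) \<le> M" and C: "C \<ge> 0" "M \<ge> 0"
  defines "\<phi> \<equiv> \<lambda>u. max 0 (min 1 (R + 2 - norm u))"
  shows "norm (\<phi> u *\<^sub>R H u - \<phi> v *\<^sub>R H v) \<le> (M + C) * norm (u - v)"
proof -
  have \<phi>_lip: "\<bar>\<phi> u - \<phi> v\<bar> \<le> norm (u - v)" for u v
    using norm_triangle_ineq3[of u v] unfolding \<phi>_def by linarith
  have \<phi>_01: "0 \<le> \<phi> u" "\<phi> u \<le> 1" for u unfolding \<phi>_def by auto
  have \<phi>_0: "\<phi> u = 0" if "norm u > R + 2" for u using that unfolding \<phi>_def by auto
  have main: "norm (\<phi> u *\<^sub>R H u - \<phi> v *\<^sub>R H v) \<le> (M + C) * norm (u - v)" if u: "norm u \<le> R + 2" for u v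
  proof (cases "norm v \<le> R + 2")
    case True
    have "\<phi> u *\<^sub>R H u - \<phi> v *\<^sub>R H v = (\<phi> u - \<phi> v) *\<^sub>R H u + \<phi> v *\<^sub>R (H u - H v)"
      by (simp add: algebra_simps)
    also have "norm \<dots> \<le> \<bar>\<phi> u - \<phi> v\<bar> * norm (H u) + \<phi> v * norm (H u - H v)"
      by (rule order_trans[OF norm_triangle_ineq]) (simp add: \<phi>_01)
    also have "\<dots> \<le> norm (u - v) * M + 1 * (C * norm (u - v))"
      by (intro add_mono mult_mono \<phi>_lip bd u lip True \<phi>_01) auto
    finally show ?thesis by (simp add: algebra_simps)
  next
    case False
    then have "norm (\<phi> u *\<^sub>R H u - \<phi> v *\<^sub>R H v) = \<bar>\<phi> u - \<phi> v\<bar> * norm (H u)"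
      by (simp add: \<phi>_0)
    also have "\<dots> \<le> norm (u - v) * M"
      by (intro mult_mono \<phi>_lip bd u) auto
    also have "\<dots> \<le> (M + C) * norm (u - v)"
      using C by (simp add: algebra_simps)
    finally show ?thesis .
  qed
  show ?thesis
  proof (cases "norm u \<le> R + 2")
    case False
    show ?thesis
    proof (cases "norm v \<le> R + 2")
      case True
      from main[OF this, of u] show ?thesis by (simp add: norm_minus_commute)
    next
      case F: False
      with False show ?thesis using C by (simp add: \<phi>_0)
    qed
  qed (rule main)
qed

text \<open>The type \<open>'x\<close> need not be complete. Completeness is asked of
  \<open>'b\<close>, where the non-identity part \<open>H\<close> of the gradient takes its values,
  and the equation is solved in \<open>real \<times> 'b\<close>.\<close>

lemma gradient_flow_exists:
  fixes \<Phi> :: "'x::real_inner \<Rightarrow> real" and \<iota> :: "'b::banach \<Rightarrow> 'x"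
  assumes \<iota>: "bounded_linear \<iota>"
    and lip: "\<And>R. \<exists>C. \<forall>u v. norm u \<le> R \<and> norm v \<le> R \<longrightarrow> norm (H u - H v) \<le> C * norm (u - v)"
    and grad: "\<And>u. (\<Phi> has_derivative (\<lambda>h. (u + \<iota> (H u)) \<bullet> h)) (at u)"
    and coercive: "\<And>u. (norm u)\<^sup>2 / 2 \<le> \<Phi> u"
  obtains U where "U 0 = u0"
    "\<And>t. t \<ge> 0 \<Longrightarrow> (U has_vector_derivative - (U t + \<iota> (H (U t)))) (at t within {0..})"
proof -
  \<comment> \<open>By coercivity this ball contains the sublevel set of \<open>u0\<close>. The
    cutoff acts beyond \<open>R + 1\<close>, so a curve that keeps its energy below the initial one
    has a margin of 1.\<close>
  define R where "R = sqrt (2 * \<Phi> u0)"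
  have R_bd: "norm u \<le> R" if "\<Phi> u \<le> \<Phi> u0" for u
    unfolding R_def by (rule real_le_rsqrt) (use that coercive[of u] in linarith)
  have R0: "norm u0 \<le> R" by (rule R_bd) simp
  then have R1: "R \<ge> 0" using norm_ge_zero[of u0] by linarith
  obtain C' where C': "\<And>u v. norm u \<le> R + 2 \<Longrightarrow> norm v \<le> R + 2 \<Longrightarrow> norm (H u - H v) \<le> C' * norm (u - v)"
    using lip[of "R + 2"] by blast
  define C where "C = max 0 C'"
  have C: "C \<ge> 0" "\<And>u v. norm u \<le> R + 2 \<Longrightarrow> norm v \<le> R + 2 \<Longrightarrow> norm (H u - H v) \<le> C * norm (u - v)"
    by (auto simp: C_def intro!: order_trans[OF C'] mult_right_mono)
  define M where "M = norm (H 0) + C * (R + 2)"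
  have M: "M \<ge> 0" "norm (H u) \<le> M" if "norm u \<le> R + 2" for u
  proof -
    have "norm (H u) \<le> norm (H 0) + norm (H u - H 0)" by (metis norm_triangle_sub)
    also have "\<dots> \<le> norm (H 0) + C * norm (u - 0)"
      using that R1 by (intro add_left_mono C) auto
    also have "\<dots> \<le> M"
      using that C unfolding M_def by (auto intro!: mult_left_mono)
    finally show "norm (H u) \<le> M" .
    show "M \<ge> 0" using C R1 by (auto simp: M_def)
  qed
  define \<phi> where "\<phi> u = max 0 (min 1 (R + 2 - norm u))" for u :: 'x
  have cut: "norm (\<phi> u *\<^sub>R H u - \<phi> v *\<^sub>R H v) \<le> (M + C) * norm (u - v)" for u v
    unfolding \<phi>_def by (rule cutoff_lipschitz) (use C M(2) M(1)[of 0] R1 in auto)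
  interpret \<iota>: bounded_linear \<iota> by fact
  \<comment> \<open>Coordinates \<open>(c, w)\<close> stand for
    \<open>c *\<^sub>R u0 + \<iota> w\<close>. In them the truncated flow reads c' = -c, w' = -(w +
    \<phi> H), started at \<open>(1, 0)\<close>, and \<open>P\<close> carries it back to
    \<open>'x\<close>.\<close>
  define P where "P e = fst e *\<^sub>R u0 + \<iota> (snd e)" for e
  have P: "bounded_linear P"
    unfolding P_def
    by (intro bounded_linear_add bounded_linear_compose[OF \<iota>] bounded_linear_snd
        bounded_linear_compose[OF bounded_linear_scaleR_left] bounded_linear_fst)
  interpret P: bounded_linear P by fact
  obtain B where B: "\<And>e. norm (P e) \<le> norm e * B" "B \<ge> 0" using P.nonneg_bounded by blast
  define f where "f e = - (e + (0, \<phi> (P e) *\<^sub>R H (P e)))" for e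
  have f_lip: "norm (f e - f e') \<le> (1 + (M + C) * B) * norm (e - e')" for e e'
  proof -
    have "norm (f e - f e') = norm ((e - e') + (0, \<phi> (P e) *\<^sub>R H (P e) - \<phi> (P e') *\<^sub>R H (P e')))"
      unfolding f_def by (subst norm_minus_cancel[symmetric], rule arg_cong[where f=norm]) (simp add: prod_eq_iff)
    also have "\<dots> \<le> norm (e - e') + norm (\<phi> (P e) *\<^sub>R H (P e) - \<phi> (P e') *\<^sub>R H (P e'))"
      by (rule order_trans[OF norm_triangle_ineq]) (simp add: norm_Pair)
    also have "\<dots> \<le> norm (e - e') + (M + C) * (norm (e - e') * B)"
      by (intro add_left_mono order_trans[OF cut] mult_left_mono)
        (use B(1)[of "e - e'"] C M(1)[of 0] R1 in \<open>auto simp: P.diff\<close>)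
    finally show ?thesis by (simp add: algebra_simps)
  qed
  have "0 \<le> 1 + (M + C) * B" using B C M(1)[of 0] R1 by auto
  then obtain y where y: "y 0 = (1, 0)" "\<And>t. t \<ge> 0 \<Longrightarrow> (y has_vector_derivative f (y t)) (at t within {0..})"
    using lipschitz_ode_global_solution[of f, OF f_lip] by blast
  define U where "U t = P (y t)" for t
  have U0: "U 0 = u0" by (simp add: U_def y P_def)
  have U': "(U has_vector_derivative - (U t + \<phi> (U t) *\<^sub>R \<iota> (H (U t)))) (at t within {0..})" if "t \<ge> 0" for t
  proof -
    have "P (f (y t)) = - (U t + \<phi> (U t) *\<^sub>R \<iota> (H (U t)))"
      by (simp add: U_def f_def P_def \<iota>.scaleR \<iota>.diff \<iota>.neg algebra_simps)
    then show ?thesis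
      using P.has_vector_derivative[OF y(2)[OF that]] by (simp add: U_def[abs_def])
  qed
  have U_cont: "continuous_on {0..} U"
    using U' by (auto intro!: continuous_on_vector_derivative)
  have small: "norm (U t) \<le> R + 1" if t: "t \<ge> 0" for t
  proof (rule ccontr)
    assume *: "\<not> norm (U t) \<le> R + 1"
    \<comment> \<open>If the ball of radius \<open>R + 1\<close> were left, this closed set of times
      would have a least element \<open>s\<close>. Before \<open>s\<close> the cutoff equals 1, so
      the curve follows the true gradient up to the moment it reaches the sphere.\<close>
    define S where "S = {s \<in> {0..t}. R + 1 \<le> norm (U s)}"
    have "closed S"
      unfolding S_def
      by (intro continuous_closed_preimage_constant continuous_on_closed_Collect_le)
        (auto intro!: continuous_intros continuous_on_subset[OF U_cont])
    then have "compact S"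
      unfolding S_def by (intro compact_eq_bounded_closed[THEN iffD2]) (auto intro: bounded_subset[of "{0..t}"])
    moreover have "t \<in> S" using * t by (auto simp: S_def)
    ultimately obtain s where s: "s \<in> S" "\<And>r. r \<in> S \<Longrightarrow> s \<le> r"
      using compact_attains_inf[of S] by blast
    have s0: "0 \<le> s" "s \<le> t" "norm (U s) \<ge> R + 1" using s(1) by (auto simp: S_def)
    then have s_pos: "0 < s" using U0 R0 by (cases "s = 0") auto
    have before: "norm (U r) < R + 1" if "0 \<le> r" "r < s" for r
      using s(2)[of r] that s0 by (force simp: S_def)
    \<comment> \<open>Along the true flow the derivative of the energy is minus the squared norm of
      the gradient. Energy at \<open>s\<close> below the initial one forces norm at most
      \<open>R\<close>, against norm at least \<open>R + 1\<close>.\<close>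
    have "\<Phi> (U s) \<le> \<Phi> (U 0)"
    proof (rule DERIV_nonpos_imp_decreasing_open[where f="\<lambda>r. \<Phi> (U r)"])
      fix r assume r: "0 < r" "r < s"
      have at: "at r within {0..} = at r"
        by (rule at_within_interior) (use r in auto)
      have "\<phi> (U r) = 1" using before[of r] r by (auto simp: \<phi>_def)
      then have "(U has_vector_derivative - (U r + \<iota> (H (U r)))) (at r)"
        using U'[of r] r at by simp
      then have "((\<lambda>r. \<Phi> (U r)) has_derivative (\<lambda>h. (U r + \<iota> (H (U r))) \<bullet> (h *\<^sub>R (- (U r + \<iota> (H (U r))))))) (at r)"
        unfolding has_vector_derivative_def using has_derivative_compose[OF _ grad] by blast
      then have "((\<lambda>r. \<Phi> (U r)) has_real_derivative - (norm (U r + \<iota> (H (U r))))\<^sup>2) (at r)"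
        by (simp only: has_field_derivative_def power2_norm_eq_inner inner_scaleR_right inner_minus_right)
          (simp only: mult_commute_abs)
      then show "\<exists>D. ((\<lambda>r. \<Phi> (U r)) has_real_derivative D) (at r) \<and> D \<le> 0"
        by (auto intro!: exI[of _ "- (norm (U r + \<iota> (H (U r))))\<^sup>2"])
    next
      have "continuous_on UNIV \<Phi>"
        using has_derivative_continuous[OF grad] by (simp add: continuous_on_eq_continuous_within)
      then show "continuous_on {0..s} (\<lambda>r. \<Phi> (U r))"
        by (rule continuous_on_compose2) (auto intro: continuous_on_subset[OF U_cont])
    qed (use s_pos in auto)
    then have "norm (U s) \<le> R" by (intro R_bd) (simp add: U0)
    with s0 show False by simp
  qed
  show thesis
  proof
    show "U 0 = u0" by (rule U0)
    fix t :: real assume t: "t \<ge> 0"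
    have "\<phi> (U t) = 1" using small[OF t] by (auto simp: \<phi>_def)
    then show "(U has_vector_derivative - (U t + \<iota> (H (U t)))) (at t within {0..})"
      using U'[OF t] by simp
  qed
qed

text \<open>Up to time \<open>T\<close> both curves are compact, hence lie in one ball, where
  \<open>g\<close> has a Lipschitz constant \<open>C\<close>. Gronwall's inequality then takes the
  form that a weighted squared distance does not increase.\<close>

lemma flow_unique:
  fixes g :: "'x::real_inner \<Rightarrow> 'x"
  assumes lip: "\<And>R. \<exists>C. \<forall>u v. norm u \<le> R \<and> norm v \<le> R \<longrightarrow> norm (g u - g v) \<le> C * norm (u - v)"
    and U: "\<And>t. t \<ge> 0 \<Longrightarrow> (U has_vector_derivative - g (U t)) (at t within {0..})"
    and V: "\<And>t. t \<ge> 0 \<Longrightarrow> (V has_vector_derivative - g (V t)) (at t within {0..})"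
    and eq: "U 0 = V 0" and T: "T \<ge> 0"
  shows "U T = V T"
proof -
  have cont: "continuous_on {0..} U" "continuous_on {0..} V"
    using U V by (auto intro!: continuous_on_vector_derivative)
  have "compact (U ` {0..T})" "compact (V ` {0..T})"
    by (auto intro!: compact_continuous_image continuous_on_subset[OF cont(1)] continuous_on_subset[OF cont(2)])
  then obtain R1 R2 where "\<forall>t\<in>{0..T}. norm (U t) \<le> R1" "\<forall>t\<in>{0..T}. norm (V t) \<le> R2"
    using compact_imp_bounded[of "U ` {0..T}"] compact_imp_bounded[of "V ` {0..T}"]
    unfolding bounded_iff by blast
  then have bd: "norm (U t) \<le> max R1 R2" "norm (V t) \<le> max R1 R2" if "t \<in> {0..T}" for t
    using that by fastforce+
  obtain C where C: "\<And>u v. norm u \<le> max R1 R2 \<Longrightarrow> norm v \<le> max R1 R2 \<Longrightarrow> norm (g u - g v) \<le> C * norm (u - v)"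
    using lip[of "max R1 R2"] by blast
  \<comment> \<open>The squared distance grows at rate at most \<open>2 * C\<close>, which is
    exactly what the exponential factor compensates.\<close>
  define W where "W t = (U t - V t) \<bullet> (U t - V t) * exp (- (2 * C) * t)" for t
  have "W T \<le> W 0"
  proof (cases "T = 0")
    case False
    show ?thesis
    proof (rule DERIV_nonpos_imp_decreasing_open[where f=W])
      fix t assume t: "0 < t" "t < T"
      have at: "at t within {0..} = at t"
        by (rule at_within_interior) (use t in auto)
      let ?d = "U t - V t" and ?g = "g (U t) - g (V t)"
      have "(U has_derivative (\<lambda>h. h *\<^sub>R - g (U t))) (at t)" "(V has_derivative (\<lambda>h. h *\<^sub>R - g (V t))) (at t)"
        using U[of t] V[of t] t at by (auto simp: has_vector_derivative_def)
      then have "(W has_derivative (\<lambda>h. h * ((- 2 * (?d \<bullet> ?g) - 2 * C * (?d \<bullet> ?d)) * exp (- (2 * C) * t)))) (at t)"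
        unfolding W_def
        by (auto intro!: derivative_eq_intros simp: algebra_simps inner_commute)
      then have W': "(W has_real_derivative ((- 2 * (?d \<bullet> ?g) - 2 * C * (?d \<bullet> ?d)) * exp (- (2 * C) * t))) (at t)"
        by (simp add: has_field_derivative_def mult.commute[of _ "_ * _"])
      have "- (?d \<bullet> ?g) \<le> C * (?d \<bullet> ?d)"
      proof -
        have "- (?d \<bullet> ?g) \<le> norm ?d * norm ?g" using Cauchy_Schwarz_ineq2[of ?d ?g] by linarith
        also have "\<dots> \<le> norm ?d * (C * norm ?d)"
          using t by (intro mult_left_mono C bd) auto
        finally show ?thesis by (simp add: power2_eq_square algebra_simps flip: power2_norm_eq_inner)
      qed
      then have "(- 2 * (?d \<bullet> ?g) - 2 * C * (?d \<bullet> ?d)) * exp (- (2 * C) * t) \<le> 0"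
        by (auto intro!: mult_nonpos_nonneg)
      with W' show "\<exists>D. (W has_real_derivative D) (at t) \<and> D \<le> 0"
        by blast
    next
      show "continuous_on {0..T} W"
        unfolding W_def
        by (auto intro!: continuous_intros continuous_on_subset[OF cont(1)] continuous_on_subset[OF cont(2)])
    qed (use T False in auto)
  qed simp
  then have "(U T - V T) \<bullet> (U T - V T) \<le> 0"
    by (simp add: W_def eq mult_le_0_iff)
  then show ?thesis by (metis eq_iff_diff_eq_0 inner_eq_zero_iff inner_ge_zero order_antisym)
qed

section \<open>The space of square integrable controls\<close>

text \<open>As a restricted measure of total mass 1, it turns set integrals over the unit interval
  into plain integrals, with plain integrability and plain almost-everywhere statements.\<close>

abbreviation leb01 :: "real measure" where
  "leb01 \<equiv> restrict_space lborel {0..1}"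

lemma space_leb01 [simp]: "space leb01 = {0..1}"
  by (simp add: space_restrict_space)

lemma finite_measure_leb01: "finite_measure leb01"
  by (rule finite_measureI) (simp add: emeasure_restrict_space)

lemma L2_iff: "L2 u \<longleftrightarrow> u \<in> borel_measurable leb01 \<and> integrable leb01 (\<lambda>t. (norm (u t))\<^sup>2)"
  by (simp add: L2_def set_borel_measurable_def borel_measurable_restrict_space_iff
      set_integrable_def integrable_restrict_space)

lemma L2inner_eq: "L2inner u v = (\<integral>t. u t \<bullet> v t \<partial>leb01)"
  by (simp add: L2inner_def set_lebesgue_integral_def integral_restrict_space)

lemma L2norm_eq: "L2norm u = sqrt (\<integral>t. (norm (u t))\<^sup>2 \<partial>leb01)"
  by (simp add: L2norm_def set_lebesgue_integral_def integral_restrict_space)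

lemma L2norm_eq_inner: "L2norm u = sqrt (L2inner u u)"
  by (simp add: L2norm_eq L2inner_eq power2_norm_eq_inner)

lemma L2_zero: "L2 (\<lambda>_. 0)"
  by (simp add: L2_iff)

lemma L2_scaleR: "L2 u \<Longrightarrow> L2 (\<lambda>t. c *\<^sub>R u t)"
  by (auto simp: L2_iff power_mult_distrib)

lemma L2_add: assumes "L2 u" "L2 v" shows "L2 (\<lambda>t. u t + v t)"
  unfolding L2_iff
proof
  have [measurable]: "u \<in> borel_measurable leb01" "v \<in> borel_measurable leb01"
    using assms by (auto simp: L2_iff)
  show "(\<lambda>t. u t + v t) \<in> borel_measurable leb01" by measurable
  have "integrable leb01 (\<lambda>t. 2 * ((norm (u t))\<^sup>2 + (norm (v t))\<^sup>2))"
    using assms by (auto simp: L2_iff)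
  then show "integrable leb01 (\<lambda>t. (norm (u t + v t))\<^sup>2)"
  proof (rule Bochner_Integration.integrable_bound)
    have "(norm (x + y))\<^sup>2 \<le> 2 * ((norm x)\<^sup>2 + (norm y)\<^sup>2)" for x y :: "real^'a"
      using zero_le_power2[of "norm (x - y)"]
      by (simp add: power2_norm_eq_inner inner_add inner_diff inner_commute)
    then show "AE t in leb01. norm ((norm (u t + v t))\<^sup>2) \<le> norm (2 * ((norm (u t))\<^sup>2 + (norm (v t))\<^sup>2))"
      by simp
  qed measurable
qed

lemma L2_uminus: "L2 u \<Longrightarrow> L2 (\<lambda>t. - u t)"
  by (auto simp: L2_iff)

lemma L2_diff: "L2 u \<Longrightarrow> L2 v \<Longrightarrow> L2 (\<lambda>t. u t - v t)"
  using L2_add[OF _ L2_uminus, of u v] by simp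

lemma integrable_L2_inner:
  assumes "L2 u" "L2 v" shows "integrable leb01 (\<lambda>t. u t \<bullet> v t)"
proof -
  have [measurable]: "u \<in> borel_measurable leb01" "v \<in> borel_measurable leb01"
    using assms by (auto simp: L2_iff)
  have "integrable leb01 (\<lambda>t. (norm (u t))\<^sup>2 + (norm (v t))\<^sup>2)"
    using assms by (auto simp: L2_iff)
  then show ?thesis
  proof (rule Bochner_Integration.integrable_bound)
    have "\<bar>x \<bullet> y\<bar> \<le> (norm x)\<^sup>2 + (norm y)\<^sup>2" for x y :: "real^'a"
    proof -
      have "\<bar>x \<bullet> y\<bar> \<le> norm x * norm y" by (rule Cauchy_Schwarz_ineq2)
      also have "\<dots> \<le> (norm x)\<^sup>2 + (norm y)\<^sup>2"
        using sum_squares_bound[of "norm x" "norm y"] mult_nonneg_nonneg[OF norm_ge_zero norm_ge_zero, of x y]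
        by linarith
      finally show ?thesis .
    qed
    then show "AE t in leb01. norm (u t \<bullet> v t) \<le> norm ((norm (u t))\<^sup>2 + (norm (v t))\<^sup>2)"
      by simp
  qed measurable
qed

text \<open>A partial equivalence, reflexive exactly at square integrable functions. The quotient by
  it therefore contains no junk classes, and every \<open>rep_l2 u\<close> satisfies
  \<open>L2\<close>.\<close>

definition L2_rel :: "(real \<Rightarrow> real^'k) \<Rightarrow> (real \<Rightarrow> real^'k) \<Rightarrow> bool" where
  "L2_rel u v \<longleftrightarrow> L2 u \<and> L2 v \<and> (AE t in leb01. u t = v t)"

quotient_type 'k l2 = "real \<Rightarrow> real^('k::finite)" / partial: L2_rel
proof (rule part_equivpI)
  show "\<exists>u. L2_rel u u" unfolding L2_rel_def using L2_zero by auto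
  show "symp L2_rel" unfolding L2_rel_def by (rule sympI) (auto elim: eventually_mono)
  show "transp L2_rel" unfolding L2_rel_def by (rule transpI) (auto elim: eventually_elim2)
qed

lemma L2_rep [simp]: "L2 (rep_l2 u)"
  using Quotient_rep_reflp[OF Quotient_l2, of u] by (simp add: L2_rel_def)

lemma abs_rep_l2 [simp]: "abs_l2 (rep_l2 u) = u"
  by (rule Quotient_abs_rep[OF Quotient_l2])

lemma abs_l2_eq_iff:
  assumes "L2 u" "L2 v"
  shows "abs_l2 u = abs_l2 v \<longleftrightarrow> (AE t in leb01. u t = v t)"
  using Quotient_rel[OF Quotient_l2, of u v] assms by (simp add: L2_rel_def)

instantiation l2 :: (finite) real_vector
begin

lift_definition zero_l2 :: "'a l2" is "\<lambda>_. 0"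
  by (simp add: L2_rel_def L2_zero)

lift_definition plus_l2 :: "'a l2 \<Rightarrow> 'a l2 \<Rightarrow> 'a l2" is "\<lambda>u v t. u t + v t"
  by (auto simp: L2_rel_def intro: L2_add elim: eventually_elim2)

lift_definition uminus_l2 :: "'a l2 \<Rightarrow> 'a l2" is "\<lambda>u t. - u t"
  by (auto simp: L2_rel_def intro: L2_uminus elim: eventually_mono)

lift_definition minus_l2 :: "'a l2 \<Rightarrow> 'a l2 \<Rightarrow> 'a l2" is "\<lambda>u v t. u t - v t"
  by (auto simp: L2_rel_def intro: L2_diff elim: eventually_elim2)

lift_definition scaleR_l2 :: "real \<Rightarrow> 'a l2 \<Rightarrow> 'a l2" is "\<lambda>c u t. c *\<^sub>R u t"
  by (auto simp: L2_rel_def intro: L2_scaleR elim: eventually_mono)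

instance
proof
  fix a b c :: "'a l2" and r s :: real
  show "a + b + c = a + (b + c)"
    by transfer (auto simp: L2_rel_def add.assoc intro!: L2_add)
  show "a + b = b + a"
    by transfer (auto simp: L2_rel_def add.commute intro!: L2_add)
  show "0 + a = a"
    by transfer (auto simp: L2_rel_def)
  show "- a + a = 0"
    by transfer (auto simp: L2_rel_def L2_zero)
  show "a - b = a + - b"
    by transfer (auto simp: L2_rel_def intro!: L2_diff)
  show "r *\<^sub>R (a + b) = r *\<^sub>R a + r *\<^sub>R b"
    by transfer (auto simp: L2_rel_def scaleR_add_right intro!: L2_add L2_scaleR)
  show "(r + s) *\<^sub>R a = r *\<^sub>R a + s *\<^sub>R a"
    by transfer (auto simp: L2_rel_def scaleR_add_left intro!: L2_add L2_scaleR)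
  show "r *\<^sub>R s *\<^sub>R a = (r * s) *\<^sub>R a"
    by transfer (auto simp: L2_rel_def intro!: L2_scaleR)
  show "1 *\<^sub>R a = a"
    by transfer (auto simp: L2_rel_def)
qed

end

instantiation l2 :: (finite) real_inner
begin

lift_definition inner_l2 :: "'a l2 \<Rightarrow> 'a l2 \<Rightarrow> real" is L2inner
proof -
  fix u u' v v' :: "real \<Rightarrow> real^'a"
  assume "L2_rel u u'" "L2_rel v v'"
  then have [measurable]: "u \<in> borel_measurable leb01" "v \<in> borel_measurable leb01"
      "u' \<in> borel_measurable leb01" "v' \<in> borel_measurable leb01"
    and eq: "AE t in leb01. u t = u' t" "AE t in leb01. v t = v' t"
    by (auto simp: L2_rel_def L2_iff)
  from eq have "AE t in leb01. u t \<bullet> v t = u' t \<bullet> v' t"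
    by eventually_elim simp
  then show "L2inner u v = L2inner u' v'"
    unfolding L2inner_eq by (intro integral_cong_AE) measurable
qed

definition norm_l2 :: "'a l2 \<Rightarrow> real" where "norm_l2 u = sqrt (u \<bullet> u)"
definition dist_l2 :: "'a l2 \<Rightarrow> 'a l2 \<Rightarrow> real" where "dist_l2 u v = norm (u - v)"
definition sgn_l2 :: "'a l2 \<Rightarrow> 'a l2" where "sgn_l2 u = inverse (norm u) *\<^sub>R u"
definition uniformity_l2 :: "('a l2 \<times> 'a l2) filter" where
  "uniformity_l2 = (INF e\<in>{0<..}. principal {(x, y). dist x y < e})"
definition open_l2 :: "'a l2 set \<Rightarrow> bool" where
  "open_l2 S \<longleftrightarrow> (\<forall>x\<in>S. \<forall>\<^sub>F (x', y) in uniformity. x' = x \<longrightarrow> y \<in> S)"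

instance
proof
  fix a b c :: "'a l2" and r :: real
  show "dist a b = norm (a - b)" by (rule dist_l2_def)
  show "sgn a = a /\<^sub>R norm a" by (rule sgn_l2_def)
  show "uniformity = (INF e\<in>{0<..}. principal {(x, y :: 'a l2). dist x y < e})"
    by (rule uniformity_l2_def)
  show "open S = (\<forall>x\<in>S. \<forall>\<^sub>F (x', y) in uniformity. x' = x \<longrightarrow> y \<in> S)" for S :: "'a l2 set"
    by (rule open_l2_def)
  show "norm a = sqrt (a \<bullet> a)" by (rule norm_l2_def)
  show "a \<bullet> b = b \<bullet> a"
    by transfer (simp add: L2inner_eq inner_commute)
  show "(a + b) \<bullet> c = a \<bullet> c + b \<bullet> c"
    by transfer (simp add: L2_rel_def L2inner_eq inner_add_left integrable_L2_inner)
  show "r *\<^sub>R a \<bullet> b = r * (a \<bullet> b)"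
    by transfer (simp add: L2inner_eq)
  show "0 \<le> a \<bullet> a"
    by transfer (auto simp: L2inner_eq intro!: integral_nonneg_AE)
  show "a \<bullet> a = 0 \<longleftrightarrow> a = 0"
  proof transfer
    fix a :: "real \<Rightarrow> real^'a" assume "L2_rel a a"
    then have a: "L2 a" by (simp add: L2_rel_def)
    \<comment> \<open>Definiteness is the point where identifying functions that agree almost
      everywhere matters.\<close>
    have "(\<integral>t. a t \<bullet> a t \<partial>leb01) = 0 \<longleftrightarrow> (AE t in leb01. a t \<bullet> a t = 0)"
      by (rule integral_nonneg_eq_0_iff_AE[OF integrable_L2_inner[OF a a]]) (rule AE_I2, rule inner_ge_zero)
    then show "L2inner a a = 0 \<longleftrightarrow> L2_rel a (\<lambda>_. 0)"
      by (simp only: L2inner_eq L2_rel_def L2_zero a inner_eq_zero_iff simp_thms)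
  qed
qed

end

lemma L2norm_abs: "L2 u \<Longrightarrow> norm (abs_l2 u) = L2norm u"
  unfolding norm_eq_sqrt_inner L2norm_eq_inner by (simp add: inner_l2.abs_eq L2_rel_def)

lemma L2inner_abs: "L2 u \<Longrightarrow> L2 v \<Longrightarrow> abs_l2 u \<bullet> abs_l2 v = L2inner u v"
  by (simp add: inner_l2.abs_eq L2_rel_def)

lemma abs_l2_add: "L2 u \<Longrightarrow> L2 v \<Longrightarrow> abs_l2 (\<lambda>t. u t + v t) = abs_l2 u + abs_l2 v"
  by (simp add: plus_l2.abs_eq L2_rel_def)

lemma abs_l2_diff: "L2 u \<Longrightarrow> L2 v \<Longrightarrow> abs_l2 (\<lambda>t. u t - v t) = abs_l2 u - abs_l2 v"
  by (simp add: minus_l2.abs_eq L2_rel_def)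

lemma abs_l2_scaleR: "L2 u \<Longrightarrow> abs_l2 (\<lambda>t. c *\<^sub>R u t) = c *\<^sub>R abs_l2 u"
  by (simp add: scaleR_l2.abs_eq L2_rel_def)

lemma norm_l2_rep: "norm u = L2norm (rep_l2 u)"
  using L2norm_abs[OF L2_rep, of u] by simp

section \<open>Volterra equations with square integrable kernels\<close>

text \<open>Discriminant argument: the integral of the square of
  \<open>l * \<bar>f x\<bar> - \<bar>g x\<bar>\<close> is nonnegative for every real
  \<open>l\<close>, and \<open>l\<close> is then chosen optimally.\<close>

lemma integral_Cauchy_Schwarz:
  fixes f g :: "'a \<Rightarrow> real"
  assumes [measurable]: "f \<in> borel_measurable M" "g \<in> borel_measurable M"
    and f2: "integrable M (\<lambda>x. (f x)\<^sup>2)" and g2: "integrable M (\<lambda>x. (g x)\<^sup>2)"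
  shows "integrable M (\<lambda>x. f x * g x)"
    and "(\<integral>x. \<bar>f x * g x\<bar> \<partial>M) \<le> sqrt (\<integral>x. (f x)\<^sup>2 \<partial>M) * sqrt (\<integral>x. (g x)\<^sup>2 \<partial>M)"
proof -
  have "integrable M (\<lambda>x. (f x)\<^sup>2 + (g x)\<^sup>2)" using f2 g2 by simp
  then show fg: "integrable M (\<lambda>x. f x * g x)"
  proof (rule Bochner_Integration.integrable_bound)
    have "\<bar>a * b\<bar> \<le> a\<^sup>2 + b\<^sup>2" for a b :: real
      using sum_squares_bound[of "\<bar>a\<bar>" "\<bar>b\<bar>"] abs_ge_zero[of "a * b"]
      by (simp only: abs_mult power2_abs)
    then show "AE x in M. norm (f x * g x) \<le> norm ((f x)\<^sup>2 + (g x)\<^sup>2)" by simp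
  qed measurable
  define A B P where "A = (\<integral>x. (f x)\<^sup>2 \<partial>M)" and "B = (\<integral>x. (g x)\<^sup>2 \<partial>M)" and "P = (\<integral>x. \<bar>f x * g x\<bar> \<partial>M)"
  have pos: "A \<ge> 0" "B \<ge> 0" "P \<ge> 0" by (auto simp: A_def B_def P_def)
  have quad: "2 * l * P \<le> l\<^sup>2 * A + B" for l
  proof -
    have "0 \<le> (\<integral>x. (l * \<bar>f x\<bar> - \<bar>g x\<bar>)\<^sup>2 \<partial>M)" by simp
    also have "\<dots> = (\<integral>x. l\<^sup>2 * (f x)\<^sup>2 + (g x)\<^sup>2 - 2 * l * \<bar>f x * g x\<bar> \<partial>M)"
      by (intro Bochner_Integration.integral_cong) (auto simp: power2_eq_square algebra_simps abs_mult)
    also have "\<dots> = l\<^sup>2 * A + B - 2 * l * P"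
      unfolding A_def B_def P_def using f2 g2 fg by simp
    finally show ?thesis by simp
  qed
  have "P\<^sup>2 \<le> A * B"
  proof (cases "A = 0")
    case True
    have "P = 0"
    proof (rule ccontr)
      assume "P \<noteq> 0"
      \<comment> \<open>When \<open>A\<close> is 0 the quadratic in \<open>l\<close> degenerates to
        a linear one; this \<open>l\<close> turns it into B + 1 \<le> B. Otherwise the minimiser
        \<open>P / A\<close> is used.\<close>
      with quad[of "(B + 1) / (2 * P)"] True show False by simp
    qed
    then show ?thesis using pos by simp
  next
    case False
    with quad[of "P / A"] pos show ?thesis by (simp add: power2_eq_square field_simps)
  qed
  then show "P \<le> sqrt A * sqrt B"
    using pos by (metis real_le_rsqrt real_sqrt_mult)
qed

lemma measurable_leb01_continuous:
  fixes f :: "real \<Rightarrow> 'a::topological_space"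
  assumes "continuous_on {0..1} f"
  shows "f \<in> borel_measurable leb01"
proof -
  have "sets leb01 = sets (restrict_space borel {0..1::real})"
    by (simp add: sets_restrict_space)
  then show ?thesis
    using borel_measurable_continuous_on_restrict[OF assms] measurable_cong_sets by blast
qed

lemma integrable_leb01_continuous:
  fixes f :: "real \<Rightarrow> 'a::euclidean_space"
  assumes "continuous_on {0..1} f"
  shows "integrable leb01 f"
  using borel_integrable_compact[OF compact_Icc assms]
  by (simp add: integrable_restrict_space set_integrable_def)

text \<open>One theory for two directions of time: \<open>D t\<close> will be \<open>{0..t}\<close>
  for the state and \<open>{t..1}\<close> for the adjoint. The axiom \<open>w_int\<close> is the
  purpose of the weight: by Cauchy-Schwarz, a kernel of L2 norm \<open>R\<close> sends functions
  bounded by \<open>w \<kappa>\<close> to functions bounded by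
  \<open>R * \<kappa> * w \<kappa>\<close>, which contracts once \<open>\<kappa>\<close> is small.
  \<open>D_cont\<close> is convergence of the indicators away from the null set consisting of
  \<open>t\<close>.\<close>

locale volterra =
  fixes D :: "real \<Rightarrow> real set" and w :: "real \<Rightarrow> real \<Rightarrow> real"
  assumes D_sets: "t \<in> {0..1} \<Longrightarrow> D t \<in> sets leb01"
    and D_cont: "\<lbrakk>X \<longlonglongrightarrow> t; x \<noteq> t; x \<in> {0..1}\<rbrakk> \<Longrightarrow> \<forall>\<^sub>F n in sequentially. x \<in> D (X n) \<longleftrightarrow> x \<in> D t"
    and w_cont: "continuous_on {0..1} (w \<kappa>)"
    and w_ge_1: "t \<in> {0..1} \<Longrightarrow> w \<kappa> t \<ge> 1"
    and w_int: "\<kappa> > 0 \<Longrightarrow> t \<in> {0..1} \<Longrightarrow> (LINT s:D t|leb01. (w \<kappa> s)\<^sup>2) \<le> (\<kappa> * w \<kappa> t)\<^sup>2"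
begin

lemma set_integrable_D:
  fixes f :: "real \<Rightarrow> 'a::{banach, second_countable_topology}"
  shows "t \<in> {0..1} \<Longrightarrow> integrable leb01 f \<Longrightarrow> set_integrable leb01 (D t) f"
  unfolding set_integrable_def by (intro integrable_mult_indicator D_sets)

text \<open>Dominated convergence with majorant \<open>norm (f s)\<close>: by \<open>D_cont\<close>
  the indicators become constant along the sequence at almost every point.\<close>

lemma integral_D_continuous:
  fixes f :: "real \<Rightarrow> 'a::euclidean_space"
  assumes f: "integrable leb01 f"
  shows "continuous_on {0..1} (\<lambda>t. LINT s:D t|leb01. f s)"
  unfolding continuous_on_sequentially comp_def
proof (intro allI ballI impI, elim conjE)
  fix X :: "nat \<Rightarrow> real" and t :: real
  assume t: "t \<in> {0..1}" and X: "\<forall>n. X n \<in> {0..1}" "X \<longlonglongrightarrow> t"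
  have ae: "AE x in leb01. x \<noteq> t \<and> x \<in> {0..1}"
    using AE_lborel_singleton[of t] by (subst AE_restrict_space_iff) (auto elim: eventually_mono)
  show "(\<lambda>n. LINT s:D (X n)|leb01. f s) \<longlonglongrightarrow> (LINT s:D t|leb01. f s)"
    unfolding set_lebesgue_integral_def
  proof (rule integral_dominated_convergence[where w="\<lambda>s. norm (f s)"])
    show "AE x in leb01. (\<lambda>n. indicator (D (X n)) x *\<^sub>R f x) \<longlonglongrightarrow> indicator (D t) x *\<^sub>R f x"
      using ae
    proof eventually_elim
      fix x assume "x \<noteq> t \<and> x \<in> {0..1}"
      then have "\<forall>\<^sub>F n in sequentially. x \<in> D (X n) \<longleftrightarrow> x \<in> D t"
        by (intro D_cont X) auto
      then have "\<forall>\<^sub>F n in sequentially. indicator (D (X n)) x *\<^sub>R f x = indicator (D t) x *\<^sub>R f x"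
        by eventually_elim (simp add: indicator_def)
      then show "(\<lambda>n. indicator (D (X n)) x *\<^sub>R f x) \<longlonglongrightarrow> indicator (D t) x *\<^sub>R f x"
        by (rule tendsto_eventually)
    qed
  qed (use f X t D_sets in \<open>auto simp: indicator_def\<close>)
qed

lemma norm_integral_D_le:
  fixes f :: "real \<Rightarrow> 'a::euclidean_space"
  assumes "t \<in> {0..1}" "integrable leb01 g" "\<And>s. s \<in> {0..1} \<Longrightarrow> norm (f s) \<le> g s"
  shows "norm (LINT s:D t|leb01. f s) \<le> (LINT s:D t|leb01. g s)"
  unfolding set_lebesgue_integral_def
proof (rule order_trans[OF integral_norm_bound integral_mono'])
  show "integrable leb01 (\<lambda>s. indicat_real (D t) s *\<^sub>R g s)"
    using set_integrable_D[OF assms(1,2)] by (simp add: set_integrable_def)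
qed (use assms order_trans[OF norm_ge_zero assms(3)] in \<open>auto simp: indicator_def\<close>)

text \<open>The contraction estimate behind both the a priori bounds and the existence result:
  \<open>R * \<kappa>\<close> is the norm of the integral operator in the sup norm weighted by
  \<open>w \<kappa>\<close>.\<close>

lemma weighted_Cauchy_Schwarz:
  assumes [measurable]: "m \<in> borel_measurable leb01" and m2: "integrable leb01 (\<lambda>s. (m s)\<^sup>2)"
    and t: "t \<in> {0..1}" and \<kappa>: "\<kappa> > 0" and R: "(\<integral>s. (m s)\<^sup>2 \<partial>leb01) \<le> R\<^sup>2" "R \<ge> 0"
  shows "integrable leb01 (\<lambda>s. m s * w \<kappa> s)"
    and "(LINT s:D t|leb01. \<bar>m s * w \<kappa> s\<bar>) \<le> R * \<kappa> * w \<kappa> t"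
proof -
  have wc[measurable]: "w \<kappa> \<in> borel_measurable leb01"
    by (rule measurable_leb01_continuous[OF w_cont])
  have [measurable]: "D t \<in> sets leb01" by (rule D_sets[OF t])
  have w2: "integrable leb01 (\<lambda>s. (w \<kappa> s)\<^sup>2)"
    by (rule integrable_leb01_continuous) (intro continuous_intros w_cont)
  show "integrable leb01 (\<lambda>s. m s * w \<kappa> s)"
    by (rule integral_Cauchy_Schwarz(1)) (use m2 w2 in auto)
  have iw2: "integrable leb01 (\<lambda>s. (indicator (D t) s * w \<kappa> s)\<^sup>2)"
    using integrable_mult_indicator[OF D_sets[OF t] w2]
    by (rule Bochner_Integration.integrable_bound) (auto simp: indicator_def)
  have "(LINT s:D t|leb01. \<bar>m s * w \<kappa> s\<bar>) = (\<integral>s. \<bar>m s * (indicator (D t) s * w \<kappa> s)\<bar> \<partial>leb01)"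
    unfolding set_lebesgue_integral_def
    by (intro Bochner_Integration.integral_cong) (auto simp: indicator_def)
  also have "\<dots> \<le> sqrt (\<integral>s. (m s)\<^sup>2 \<partial>leb01) * sqrt (\<integral>s. (indicator (D t) s * w \<kappa> s)\<^sup>2 \<partial>leb01)"
    by (rule integral_Cauchy_Schwarz(2)) (use m2 iw2 in auto)
  also have "(\<integral>s. (indicator (D t) s * w \<kappa> s)\<^sup>2 \<partial>leb01) = (LINT s:D t|leb01. (w \<kappa> s)\<^sup>2)"
    unfolding set_lebesgue_integral_def
    by (intro Bochner_Integration.integral_cong) (auto simp: indicator_def)
  also have "sqrt (\<integral>s. (m s)\<^sup>2 \<partial>leb01) * sqrt (LINT s:D t|leb01. (w \<kappa> s)\<^sup>2) \<le> R * (\<kappa> * w \<kappa> t)"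
    using w_ge_1[OF t, of \<kappa>] w_int[OF \<kappa> t] \<kappa> R
    by (intro mult_mono real_le_lsqrt) (auto simp: set_lebesgue_integral_def)
  finally show "(LINT s:D t|leb01. \<bar>m s * w \<kappa> s\<bar>) \<le> R * \<kappa> * w \<kappa> t" by (simp add: mult.assoc)
qed

text \<open>At a maximum point of the ratio of \<open>y\<close> to the weight, the integral term is
  at most half of the left side and can be absorbed. \<open>C\<close> is obtained before
  \<open>m\<close> and \<open>y\<close>, so it depends on \<open>R\<close> alone and is uniform over
  all kernels of L2 norm at most \<open>R\<close>.\<close>

lemma gronwall:
  fixes R :: real
  assumes R: "R \<ge> 0"
  obtains C where "C \<ge> 1"
    "\<And>m y c t. \<lbrakk>m \<in> borel_measurable leb01; integrable leb01 (\<lambda>s. (m s)\<^sup>2); (\<integral>s. (m s)\<^sup>2 \<partial>leb01) \<le> R\<^sup>2;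
        continuous_on {0..1} y;
        \<And>t. t \<in> {0..1} \<Longrightarrow> 0 \<le> y t \<and> y t \<le> c + (LINT s:D t|leb01. \<bar>m s\<bar> * y s); t \<in> {0..1}\<rbrakk>
      \<Longrightarrow> y t \<le> C * c"
proof -
  \<comment> \<open>This makes \<open>R * \<kappa>\<close> at most 1/2; the summand 1 allows
    \<open>R\<close> to be 0.\<close>
  define \<kappa> where "\<kappa> = 1 / (2 * (R + 1))"
  have \<kappa>: "\<kappa> > 0" "R * \<kappa> \<le> 1/2" using R by (auto simp: \<kappa>_def field_simps)
  let ?w = "w \<kappa>"
  note wc = w_cont[of \<kappa>] and w1 = w_ge_1[of _ \<kappa>]
  have "compact (?w ` {0..1})" using wc by (intro compact_continuous_image) auto
  then obtain B where "\<forall>x\<in>?w ` {0..1}. norm x \<le> B"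
    using compact_imp_bounded[of "?w ` {0..1}"] unfolding bounded_iff by blast
  then have B: "?w t \<le> B" if "t \<in> {0..1}" for t
    using that by (auto simp: abs_le_iff)
  have B1: "B \<ge> 1" using w1[of 0] B[of 0] by simp
  show thesis
  proof (rule that[of "2 * B"])
    fix m y :: "real \<Rightarrow> real" and c t :: real
    assume m: "m \<in> borel_measurable leb01" "integrable leb01 (\<lambda>s. (m s)\<^sup>2)" "(\<integral>s. (m s)\<^sup>2 \<partial>leb01) \<le> R\<^sup>2"
      and y: "continuous_on {0..1} y"
      and ineq: "\<And>t. t \<in> {0..1} \<Longrightarrow> 0 \<le> y t \<and> y t \<le> c + (LINT s:D t|leb01. \<bar>m s\<bar> * y s)" and t: "t \<in> {0..1}"
    have "continuous_on {0..1} (\<lambda>t. y t / ?w t)"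
      using w1 by (intro continuous_intros y wc) force
    then obtain t0 where t0: "t0 \<in> {0..1}" "\<And>t. t \<in> {0..1} \<Longrightarrow> y t / ?w t \<le> y t0 / ?w t0"
      using continuous_attains_sup[of "{0..1}" "\<lambda>t. y t / ?w t"] by (auto simp del: atLeastAtMost_iff)
    \<comment> \<open>\<open>M\<close> is the weighted sup norm of \<open>y\<close>. Absorption
      gives at most \<open>2 * c\<close> for \<open>M * w \<kappa> t0\<close>, hence for
      \<open>M\<close> as the weight is at least 1; returning to the plain sup norm costs the
      maximum \<open>B\<close> of the weight, whence the constant \<open>2 * B\<close>.\<close>
    define M where "M = y t0 / ?w t0"
    have M0: "M \<ge> 0" using ineq[OF t0(1)] w1[OF t0(1)] by (auto simp: M_def)
    have yM: "y t \<le> M * ?w t" if "t \<in> {0..1}" for t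
      using t0(2)[OF that] w1[OF that] by (simp add: M_def[symmetric] field_simps)
    note W = weighted_Cauchy_Schwarz[OF m(1,2) t0(1) \<kappa>(1) m(3) R]
    have "norm (LINT s:D t0|leb01. \<bar>m s\<bar> * y s) \<le> (LINT s:D t0|leb01. M * \<bar>m s * ?w s\<bar>)"
    proof (rule norm_integral_D_le[OF t0(1)])
      show "integrable leb01 (\<lambda>s. M * \<bar>m s * ?w s\<bar>)" using W(1) by auto
      fix s :: real assume s: "s \<in> {0..1}"
      then show "norm (\<bar>m s\<bar> * y s) \<le> M * \<bar>m s * ?w s\<bar>"
        using ineq[OF s] w1[OF s] mult_left_mono[OF yM[OF s], of "\<bar>m s\<bar>"]
        by (auto simp: abs_mult mult_ac)
    qed
    also have "\<dots> = M * (LINT s:D t0|leb01. \<bar>m s * ?w s\<bar>)"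
      unfolding set_lebesgue_integral_def
      by (simp add: mult.left_commute[of _ M])
    also have "\<dots> \<le> M * (R * \<kappa> * ?w t0)"
      by (intro mult_left_mono W M0)
    also have "\<dots> \<le> M * (1/2 * ?w t0)"
      using \<kappa> w1[OF t0(1)] by (intro mult_left_mono mult_right_mono M0) auto
    finally have "(LINT s:D t0|leb01. \<bar>m s\<bar> * y s) \<le> M * ?w t0 / 2" by simp
    with ineq[OF t0(1)] have "y t0 \<le> c + M * ?w t0 / 2" by linarith
    moreover have "y t0 = M * ?w t0" using w1[OF t0(1)] by (simp add: M_def)
    ultimately have Mc: "M * ?w t0 \<le> 2 * c" by simp
    have "M * 1 \<le> M * ?w t0" by (intro mult_left_mono w1 t0 M0)
    with Mc have "M \<le> 2 * c" by simp
    have "y t \<le> M * ?w t" by (rule yM[OF t])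
    also have "\<dots> \<le> 2 * c * B"
      using \<open>M \<le> 2 * c\<close> B[OF t] w1[OF t] M0 by (intro mult_mono) auto
    finally show "y t \<le> 2 * B * c" by (simp add: mult_ac)
  qed (use B1 in auto)
qed

text \<open>Form of \<open>gronwall\<close> for vector equations with a perturbation:
  \<open>d\<close> is the change of the boundary value and \<open>r\<close> the source. With one
  solution it yields bounds, with a difference of two solutions Lipschitz dependence on the
  control.\<close>

lemma volterra_bound:
  fixes R :: real
  assumes R: "R \<ge> 0"
  obtains C where "C \<ge> 1"
    "\<And>m r d (e :: real \<Rightarrow> 'a::euclidean_space) f t.
      \<lbrakk>m \<in> borel_measurable leb01; integrable leb01 (\<lambda>s. (m s)\<^sup>2); (\<integral>s. (m s)\<^sup>2 \<partial>leb01) \<le> R\<^sup>2;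
        continuous_on {0..1} e; integrable leb01 r;
        \<And>t. t \<in> {0..1} \<Longrightarrow> e t = d + (LINT s:D t|leb01. f s);
        \<And>s. s \<in> {0..1} \<Longrightarrow> 0 \<le> r s \<and> norm (f s) \<le> m s * norm (e s) + r s; t \<in> {0..1}\<rbrakk>
      \<Longrightarrow> norm (e t) \<le> C * (norm d + (\<integral>s. r s \<partial>leb01))"
proof (rule gronwall[OF R])
  fix C
  assume C: "C \<ge> 1"
    "\<And>m y c t. \<lbrakk>m \<in> borel_measurable leb01; integrable leb01 (\<lambda>s. (m s)\<^sup>2); (\<integral>s. (m s)\<^sup>2 \<partial>leb01) \<le> R\<^sup>2;
        continuous_on {0..1} y;
        \<And>t. t \<in> {0..1} \<Longrightarrow> 0 \<le> y t \<and> y t \<le> c + (LINT s:D t|leb01. \<bar>m s\<bar> * y s); t \<in> {0..1}\<rbrakk>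
      \<Longrightarrow> y t \<le> C * c"
  show thesis
  proof (rule that[OF C(1)])
    fix m r f d and t :: real and e :: "real \<Rightarrow> 'a"
    assume m: "m \<in> borel_measurable leb01" "integrable leb01 (\<lambda>s. (m s)\<^sup>2)" "(\<integral>s. (m s)\<^sup>2 \<partial>leb01) \<le> R\<^sup>2"
      and e: "continuous_on {0..1} e" and r: "integrable leb01 r"
      and eq: "\<And>t. t \<in> {0..1} \<Longrightarrow> e t = d + (LINT s:D t|leb01. f s)"
      and bd: "\<And>s. s \<in> {0..1} \<Longrightarrow> 0 \<le> r s \<and> norm (f s) \<le> m s * norm (e s) + r s" and t: "t \<in> {0..1}"
    have ne: "continuous_on {0..1} (\<lambda>s. norm (e s))" by (intro continuous_intros e)
    have ime: "integrable leb01 (\<lambda>s. \<bar>m s\<bar> * norm (e s))"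
    proof (rule integral_Cauchy_Schwarz(1))
      show "integrable leb01 (\<lambda>s. (norm (e s))\<^sup>2)"
        by (rule integrable_leb01_continuous) (intro continuous_intros ne)
    qed (use m measurable_leb01_continuous[OF ne] in auto)
    show "norm (e t) \<le> C * (norm d + (\<integral>s. r s \<partial>leb01))"
    proof (rule C(2)[OF m ne _ t])
      fix t :: real assume t: "t \<in> {0..1}"
      have "norm (LINT s:D t|leb01. f s) \<le> (LINT s:D t|leb01. \<bar>m s\<bar> * norm (e s) + r s)"
      proof (rule norm_integral_D_le[OF t])
        fix s :: real assume s: "s \<in> {0..1}"
        have "m s * norm (e s) \<le> \<bar>m s\<bar> * norm (e s)" by (intro mult_right_mono) auto
        with bd[OF s] show "norm (f s) \<le> \<bar>m s\<bar> * norm (e s) + r s" by linarith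
      qed (use ime r in auto)
      also have "\<dots> = (LINT s:D t|leb01. \<bar>m s\<bar> * norm (e s)) + (LINT s:D t|leb01. r s)"
        by (intro set_integral_add set_integrable_D t ime r)
      also have "(LINT s:D t|leb01. r s) \<le> (\<integral>s. r s \<partial>leb01)"
        unfolding set_lebesgue_integral_def
        by (rule integral_mono) (use set_integrable_D[OF t r] r bd in \<open>auto simp: set_integrable_def indicator_def\<close>)
      finally show "0 \<le> norm (e t) \<and> norm (e t) \<le> norm d + (\<integral>s. r s \<partial>leb01) + (LINT s:D t|leb01. \<bar>m s\<bar> * norm (e s))"
        using eq[OF t] norm_triangle_ineq[of d "LINT s:D t|leb01. f s"] by simp
    qed
  qed
qed

text \<open>Banach's fixed point theorem for the quotient of the solution by the weight. A square
  integrable Lipschitz modulus \<open>m\<close> suffices, which is what an L2 control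
  provides.\<close>

lemma volterra_exists:
  fixes \<Phi> :: "real \<Rightarrow> 'a::euclidean_space \<Rightarrow> 'a"
  assumes meas: "\<And>y. continuous_on {0..1} y \<Longrightarrow> (\<lambda>s. \<Phi> s (y s)) \<in> borel_measurable leb01"
    and lip: "\<And>s y z. s \<in> {0..1} \<Longrightarrow> norm (\<Phi> s y - \<Phi> s z) \<le> m s * norm (y - z)"
    and base: "\<And>s. s \<in> {0..1} \<Longrightarrow> norm (\<Phi> s 0) \<le> b s"
    and m: "m \<in> borel_measurable leb01" "integrable leb01 (\<lambda>s. (m s)\<^sup>2)" and b: "integrable leb01 b"
  obtains y where "continuous_on {0..1} y" "\<And>t. t \<in> {0..1} \<Longrightarrow> y t = y0 + (LINT s:D t|leb01. \<Phi> s (y s))"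
proof -
  define R where "R = sqrt (\<integral>s. (m s)\<^sup>2 \<partial>leb01)"
  have R: "R \<ge> 0" "(\<integral>s. (m s)\<^sup>2 \<partial>leb01) \<le> R\<^sup>2" by (auto simp: R_def)
  define \<kappa> where "\<kappa> = 1 / (2 * (R + 1))"
  have \<kappa>: "\<kappa> > 0" "R * \<kappa> \<le> 1/2" using R by (auto simp: \<kappa>_def field_simps)
  let ?w = "w \<kappa>"
  note wc = w_cont[of \<kappa>] and w1 = w_ge_1[of _ \<kappa>]
  \<comment> \<open>Retraction of the line onto the unit interval: it extends a continuous function
    on the interval to a bounded continuous one on the line without changing its sup norm.\<close>
  define cl where "cl t = max 0 (min 1 t)" for t :: real
  have cl: "cl t \<in> {0..1}" "s \<in> {0..1} \<Longrightarrow> cl s = s" for t s by (auto simp: cl_def)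
  have cl_cont: "continuous_on UNIV cl" unfolding cl_def by (intro continuous_intros)
  have yc: "continuous_on {0..1} (\<lambda>s. ?w s *\<^sub>R apply_bcontfun Z s)" for Z :: "real \<Rightarrow>\<^sub>C 'a"
    by (intro continuous_intros wc continuous_on_apply_bcontfun)
  have int: "integrable leb01 (\<lambda>s. \<Phi> s (y s))" if y: "continuous_on {0..1} y" for y
  proof -
    have ne: "continuous_on {0..1} (\<lambda>s. norm (y s))" by (intro continuous_intros y)
    have "integrable leb01 (\<lambda>s. m s * norm (y s))"
    proof (rule integral_Cauchy_Schwarz(1))
      show "integrable leb01 (\<lambda>s. (norm (y s))\<^sup>2)"
        by (rule integrable_leb01_continuous) (intro continuous_intros ne)
    qed (use m measurable_leb01_continuous[OF ne] in auto)
    then have "integrable leb01 (\<lambda>s. m s * norm (y s) + b s)" using b by simp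
    then show ?thesis
    proof (rule Bochner_Integration.integrable_bound)
      show "AE s in leb01. norm (\<Phi> s (y s)) \<le> norm (m s * norm (y s) + b s)"
      proof (rule AE_I2)
        fix s assume "s \<in> space leb01"
        then have s: "s \<in> {0..1}" by simp
        show "norm (\<Phi> s (y s)) \<le> norm (m s * norm (y s) + b s)"
          using lip[OF s, of "y s" 0] base[OF s] norm_triangle_ineq2[of "\<Phi> s (y s)" "\<Phi> s 0"] by simp
      qed
    qed (rule meas[OF y])
  qed
  define J where "J Z t = y0 + (LINT s:D t|leb01. \<Phi> s (?w s *\<^sub>R apply_bcontfun Z s))" for Z t
  have J_cont: "continuous_on {0..1} (J Z)" for Z
    unfolding J_def by (intro continuous_intros integral_D_continuous int yc)
  define T where "T Z t = J Z (cl t) /\<^sub>R ?w (cl t)" for Z t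
  have T_bc: "T Z \<in> bcontfun" for Z
  proof -
    have c: "continuous_on {0..1} (\<lambda>t. J Z t /\<^sub>R ?w t)"
      using w1 by (intro continuous_intros J_cont wc) force
    then have "compact ((\<lambda>t. J Z t /\<^sub>R ?w t) ` {0..1})" by (intro compact_continuous_image) auto
    then obtain B where "\<forall>t\<in>{0..1}. norm (J Z t /\<^sub>R ?w t) \<le> B"
      using compact_imp_bounded[of "(\<lambda>t. J Z t /\<^sub>R ?w t) ` {0..1}"] unfolding bounded_iff by fast
    then have "norm (T Z t) \<le> B" for t using cl(1)[of t] by (simp add: T_def)
    moreover have "continuous_on UNIV (T Z)"
      unfolding T_def by (rule continuous_on_compose2[OF c cl_cont]) (use cl in auto)
    ultimately show ?thesis by (rule bcontfun_normI[rotated])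
  qed
  have app: "apply_bcontfun (Bcontfun (T Z)) = T Z" for Z
    by (rule Bcontfun_inverse[OF T_bc])
  have contr: "dist (Bcontfun (T Z)) (Bcontfun (T Z')) \<le> 1/2 * dist Z Z'" for Z Z'
  proof -
    have "norm (T Z t - T Z' t) \<le> 1/2 * norm (Z - Z')" for t
    proof -
      define s where "s = cl t"
      have s: "s \<in> {0..1}" using cl by (simp add: s_def)
      note W = weighted_Cauchy_Schwarz[OF m s \<kappa>(1) R(2,1)]
      have "J Z s - J Z' s = (LINT s:D s|leb01. \<Phi> s (?w s *\<^sub>R apply_bcontfun Z s) - \<Phi> s (?w s *\<^sub>R apply_bcontfun Z' s))"
        unfolding J_def by (subst set_integral_diff) (use s in \<open>auto intro!: set_integrable_D int yc\<close>)
      also have "norm \<dots> \<le> (LINT s:D s|leb01. norm (Z - Z') * \<bar>m s * ?w s\<bar>)"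
      proof (rule norm_integral_D_le[OF s])
        show "integrable leb01 (\<lambda>s. norm (Z - Z') * \<bar>m s * ?w s\<bar>)" using W(1) by auto
        fix r :: real assume r: "r \<in> {0..1}"
        have "norm (\<Phi> r (?w r *\<^sub>R apply_bcontfun Z r) - \<Phi> r (?w r *\<^sub>R apply_bcontfun Z' r))
           \<le> m r * norm (?w r *\<^sub>R apply_bcontfun (Z - Z') r)"
          using lip[OF r, of "?w r *\<^sub>R apply_bcontfun Z r" "?w r *\<^sub>R apply_bcontfun Z' r"] by (simp add: scaleR_diff_right)
        also have "\<dots> \<le> \<bar>m r\<bar> * (?w r * norm (Z - Z'))"
          using w1[OF r] norm_bounded[of "Z - Z'" r]
          by (intro mult_mono) (auto intro!: mult_left_mono simp del: minus_bcontfun.rep_eq)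
        finally show "norm (\<Phi> r (?w r *\<^sub>R apply_bcontfun Z r) - \<Phi> r (?w r *\<^sub>R apply_bcontfun Z' r)) \<le> norm (Z - Z') * \<bar>m r * ?w r\<bar>"
          using w1[OF r] by (simp add: abs_mult mult_ac)
      qed
      also have "\<dots> = norm (Z - Z') * (LINT s:D s|leb01. \<bar>m s * ?w s\<bar>)"
        unfolding set_lebesgue_integral_def by (simp add: mult.left_commute[of _ "norm (Z - Z')"])
      also have "\<dots> \<le> norm (Z - Z') * (R * \<kappa> * ?w s)"
        by (intro mult_left_mono W) auto
      also have "\<dots> \<le> norm (Z - Z') * (1/2 * ?w s)"
        using \<kappa> w1[OF s] by (intro mult_left_mono mult_right_mono) auto
      finally have J: "norm (J Z s - J Z' s) \<le> norm (Z - Z') * (1/2 * ?w s)" .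
      have "norm (T Z t - T Z' t) = norm (J Z s - J Z' s) / ?w s"
        using w1[OF s] unfolding T_def s_def[symmetric]
        by (simp add: divide_inverse_commute flip: scaleR_diff_right)
      also have "\<dots> \<le> 1/2 * norm (Z - Z')"
        using J w1[OF s] by (simp add: field_simps)
      finally show ?thesis .
    qed
    then show ?thesis
      by (intro dist_bound) (auto simp: app dist_norm)
  qed
  obtain Z where Z: "Bcontfun (T Z) = Z"
    using banach_fix_type[of "1/2" "\<lambda>Z. Bcontfun (T Z)"] contr by auto
  have fixp: "?w t *\<^sub>R apply_bcontfun Z t = J Z t" if t: "t \<in> {0..1}" for t
  proof -
    have "apply_bcontfun Z t = T Z t" using app[of Z] Z by simp
    then show ?thesis using w1[OF t] by (simp add: T_def cl(2)[OF t])
  qed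
  show thesis
  proof (rule that[of "\<lambda>t. ?w t *\<^sub>R apply_bcontfun Z t"])
    show "?w t *\<^sub>R apply_bcontfun Z t = y0 + (LINT s:D t|leb01. \<Phi> s (?w s *\<^sub>R apply_bcontfun Z s))" if "t \<in> {0..1}" for t
      using fixp[OF that] by (simp add: J_def)
  qed (rule yc)
qed

end

section \<open>Exponential weights for the forward and the backward equation\<close>

lemma integral_exp_Icc:
  fixes c :: real
  assumes "c \<noteq> 0" "a \<le> b"
  shows "(LINT s:{a..b}|lborel. exp (c * s)) = (exp (c * b) - exp (c * a)) / c"
  using assms
  by (subst set_borel_integral_eq_integral)
    (auto intro!: integral_unique fundamental_theorem_of_calculus[where f="\<lambda>s. exp (c * s) / c", THEN has_integral_eq_rhs]
      borel_integrable_atLeastAtMost' continuous_intros derivative_eq_intros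
      simp: diff_divide_distrib simp flip: has_real_derivative_iff_has_vector_derivative)

lemma set_integral_leb01:
  fixes f :: "real \<Rightarrow> 'a::{banach, second_countable_topology}"
  assumes "A \<subseteq> {0..1}"
  shows "(LINT s:A|leb01. f s) = (LINT s:A|lborel. f s)"
  unfolding set_lebesgue_integral_def
  by (subst integral_restrict_space)
    (use assms in \<open>auto intro!: Bochner_Integration.integral_cong simp: indicator_def\<close>)

text \<open>The square of the weight is \<open>exp (t / \<kappa>\<^sup>2)\<close>, whose primitive
  is \<open>\<kappa>\<^sup>2\<close> times itself. Dropping the contribution of the lower end gives
  exactly the bound in \<open>w_int\<close>.\<close>

interpretation fwd: volterra "\<lambda>t. {0..t}" "\<lambda>\<kappa> t. exp (t / (2 * \<kappa>\<^sup>2))"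
proof
  fix t \<kappa> :: real and X x
  show "t \<in> {0..1} \<Longrightarrow> {0..t} \<in> sets leb01" by (auto simp: sets_restrict_space_iff)
  show "\<forall>\<^sub>F n in sequentially. x \<in> {0..X n} \<longleftrightarrow> x \<in> {0..t}" if "X \<longlonglongrightarrow> t" "x \<noteq> t" "x \<in> {0..1}"
  proof (cases "x < t")
    case True
    with order_tendstoD(1)[OF that(1)] have "\<forall>\<^sub>F n in sequentially. x < X n" by blast
    then show ?thesis by eventually_elim (use True in auto)
  next
    case False
    with that order_tendstoD(2)[OF that(1), of x] have "\<forall>\<^sub>F n in sequentially. X n < x" by auto
    then show ?thesis by eventually_elim (use False that in auto)
  qed
  show "continuous_on {0..1} (\<lambda>t. exp (t / (2 * \<kappa>\<^sup>2)))"
    unfolding divide_inverse by (intro continuous_intros)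
  show "t \<in> {0..1} \<Longrightarrow> 1 \<le> exp (t / (2 * \<kappa>\<^sup>2))" by simp
  show "(LINT s:{0..t}|leb01. (exp (s / (2 * \<kappa>\<^sup>2)))\<^sup>2) \<le> (\<kappa> * exp (t / (2 * \<kappa>\<^sup>2)))\<^sup>2"
    if "0 < \<kappa>" "t \<in> {0..1}"
  proof -
    have sq: "(exp (s / (2 * \<kappa>\<^sup>2)))\<^sup>2 = exp (1 / \<kappa>\<^sup>2 * s)" for s
      by (simp add: power2_eq_square flip: exp_add)
    have "(LINT s:{0..t}|leb01. (exp (s / (2 * \<kappa>\<^sup>2)))\<^sup>2) = (exp (1 / \<kappa>\<^sup>2 * t) - exp (1 / \<kappa>\<^sup>2 * 0)) / (1 / \<kappa>\<^sup>2)"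
      using that integral_exp_Icc[of "1 / \<kappa>\<^sup>2" 0 t]
      by (subst set_integral_leb01) (auto simp: sq)
    also have "\<dots> = \<kappa>\<^sup>2 * exp (1 / \<kappa>\<^sup>2 * t) - \<kappa>\<^sup>2"
      by (simp add: algebra_simps)
    also have "\<dots> \<le> (\<kappa> * exp (t / (2 * \<kappa>\<^sup>2)))\<^sup>2"
      by (simp add: power_mult_distrib sq)
    finally show ?thesis .
  qed
qed

text \<open>The forward weight under the reflection of time t to 1 - t, so that it is steep towards
  the initial time, where the backward integral accumulates.\<close>

interpretation bwd: volterra "\<lambda>t. {t..1}" "\<lambda>\<kappa> t. exp ((1 - t) / (2 * \<kappa>\<^sup>2))"
proof
  fix t \<kappa> :: real and X x
  show "t \<in> {0..1} \<Longrightarrow> {t..1} \<in> sets leb01" by (auto simp: sets_restrict_space_iff)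
  show "\<forall>\<^sub>F n in sequentially. x \<in> {X n..1} \<longleftrightarrow> x \<in> {t..1}" if "X \<longlonglongrightarrow> t" "x \<noteq> t" "x \<in> {0..1}"
  proof (cases "x < t")
    case True
    with order_tendstoD(1)[OF that(1)] have "\<forall>\<^sub>F n in sequentially. x < X n" by blast
    then show ?thesis by eventually_elim (use True in auto)
  next
    case False
    with that order_tendstoD(2)[OF that(1), of x] have "\<forall>\<^sub>F n in sequentially. X n < x" by auto
    then show ?thesis by eventually_elim (use False that in auto)
  qed
  show "continuous_on {0..1} (\<lambda>t. exp ((1 - t) / (2 * \<kappa>\<^sup>2)))"
    unfolding divide_inverse by (intro continuous_intros)
  show "t \<in> {0..1} \<Longrightarrow> 1 \<le> exp ((1 - t) / (2 * \<kappa>\<^sup>2))" by simp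
  show "(LINT s:{t..1}|leb01. (exp ((1 - s) / (2 * \<kappa>\<^sup>2)))\<^sup>2) \<le> (\<kappa> * exp ((1 - t) / (2 * \<kappa>\<^sup>2)))\<^sup>2"
    if "0 < \<kappa>" "t \<in> {0..1}"
  proof -
    have sq: "(exp ((1 - s) / (2 * \<kappa>\<^sup>2)))\<^sup>2 = exp (1 / \<kappa>\<^sup>2) * exp (- (1 / \<kappa>\<^sup>2) * s)" for s
      by (simp add: power2_eq_square diff_divide_distrib flip: exp_add)
    have "(LINT s:{t..1}|leb01. (exp ((1 - s) / (2 * \<kappa>\<^sup>2)))\<^sup>2)
        = exp (1 / \<kappa>\<^sup>2) * ((exp (- (1 / \<kappa>\<^sup>2) * 1) - exp (- (1 / \<kappa>\<^sup>2) * t)) / - (1 / \<kappa>\<^sup>2))"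
      using that integral_exp_Icc[of "- (1 / \<kappa>\<^sup>2)" t 1]
      by (subst set_integral_leb01) (auto simp: sq)
    also have "\<dots> = \<kappa>\<^sup>2 * (exp (1 / \<kappa>\<^sup>2) * exp (- (1 / \<kappa>\<^sup>2) * t)) - \<kappa>\<^sup>2"
      by (simp add: algebra_simps flip: exp_add)
    also have "\<dots> \<le> (\<kappa> * exp ((1 - t) / (2 * \<kappa>\<^sup>2)))\<^sup>2"
      by (simp add: power_mult_distrib sq)
    finally show ?thesis .
  qed
qed

section \<open>Duality and measurability\<close>

text \<open>Integration by parts for p' = -f and q' = g with p(1) = c and q(0) = 0. The two
  functions are known only as integrals, so the identity is read off from Fubini's theorem on a
  triangle.\<close>

lemma integration_by_parts_duality:
  fixes f g :: "real \<Rightarrow> 'a::euclidean_space"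
  assumes f: "integrable leb01 f" and g: "integrable leb01 g"
    and p: "\<And>t. t \<in> {0..1} \<Longrightarrow> p t = c + (LINT s:{t..1}|leb01. f s)"
    and q: "\<And>t. t \<in> {0..1} \<Longrightarrow> q t = (LINT s:{0..t}|leb01. g s)"
  shows "c \<bullet> q 1 = (\<integral>t. p t \<bullet> g t \<partial>leb01) - (\<integral>s. f s \<bullet> q s \<partial>leb01)"
proof -
  interpret finite_measure leb01 by (rule finite_measure_leb01)
  interpret pair_sigma_finite leb01 leb01 ..
  have [measurable]: "f \<in> borel_measurable leb01" "g \<in> borel_measurable leb01"
    using f g by auto
  have [measurable]: "(\<lambda>x. x) \<in> leb01 \<rightarrow>\<^sub>M borel" by (simp add: measurable_restrict_space1)
  have norms: "integrable (leb01 \<Otimes>\<^sub>M leb01) (\<lambda>z. norm (f (fst z)) * norm (g (snd z)))"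
    by (rule Fubini_integrable) (use f g in \<open>auto intro!: integrable_mult_left\<close>)
  \<comment> \<open>The density on the triangle \<open>t \<le> s\<close>: integrating over
    \<open>s\<close> produces the tail integral in \<open>p\<close>, integrating over
    \<open>t\<close> produces \<open>q\<close>.\<close>
  define \<phi> where "\<phi> s t = (if t \<le> s then f s \<bullet> g t else 0)" for s t
  have \<phi>: "integrable (leb01 \<Otimes>\<^sub>M leb01) (case_prod \<phi>)"
    using norms
  proof (rule Bochner_Integration.integrable_bound)
    show "case_prod \<phi> \<in> borel_measurable (leb01 \<Otimes>\<^sub>M leb01)"
      unfolding \<phi>_def by measurable
    show "AE z in leb01 \<Otimes>\<^sub>M leb01. norm (case_prod \<phi> z) \<le> norm (norm (f (fst z)) * norm (g (snd z)))"
      by (rule AE_I2) (auto simp: \<phi>_def Cauchy_Schwarz_ineq2)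
  qed
  have 1: "(\<integral>s. \<phi> s t \<partial>leb01) = (LINT s:{t..1}|leb01. f s) \<bullet> g t" if t: "t \<in> {0..1}" for t
  proof -
    have "(\<integral>s. \<phi> s t \<partial>leb01) = (\<integral>s. (indicator {t..1} s *\<^sub>R f s) \<bullet> g t \<partial>leb01)"
      by (intro Bochner_Integration.integral_cong) (auto simp: \<phi>_def indicator_def)
    also have "\<dots> = (LINT s:{t..1}|leb01. f s) \<bullet> g t"
      unfolding set_lebesgue_integral_def
      using bwd.set_integrable_D[OF t f] by (intro integral_inner_left) (simp add: set_integrable_def)
    finally show ?thesis .
  qed
  have 2: "(\<integral>t. \<phi> s t \<partial>leb01) = f s \<bullet> (LINT t:{0..s}|leb01. g t)" if s: "s \<in> {0..1}" for s
  proof -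
    have "(\<integral>t. \<phi> s t \<partial>leb01) = (\<integral>t. f s \<bullet> (indicator {0..s} t *\<^sub>R g t) \<partial>leb01)"
      by (intro Bochner_Integration.integral_cong) (auto simp: \<phi>_def indicator_def)
    also have "\<dots> = f s \<bullet> (LINT t:{0..s}|leb01. g t)"
      unfolding set_lebesgue_integral_def
      using fwd.set_integrable_D[OF s g] by (intro integral_inner_right) (simp add: set_integrable_def)
    finally show ?thesis .
  qed
  have int: "integrable leb01 (\<lambda>t. \<integral>s. \<phi> s t \<partial>leb01)"
    by (rule integrable_snd[OF \<phi>])
  have cg: "integrable leb01 (\<lambda>t. c \<bullet> g t)" using g by simp
  have "(\<integral>t. p t \<bullet> g t \<partial>leb01) = (\<integral>t. c \<bullet> g t + (\<integral>s. \<phi> s t \<partial>leb01) \<partial>leb01)"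
    by (intro Bochner_Integration.integral_cong) (auto simp: p 1 inner_add_left)
  also have "\<dots> = (\<integral>t. c \<bullet> g t \<partial>leb01) + (\<integral>t. \<integral>s. \<phi> s t \<partial>leb01 \<partial>leb01)"
    by (rule Bochner_Integration.integral_add[OF cg int])
  also have "(\<integral>t. c \<bullet> g t \<partial>leb01) = c \<bullet> (\<integral>t. g t \<partial>leb01)"
    using g by simp
  also have "(\<integral>t. g t \<partial>leb01) = q 1"
    by (subst q) (auto simp: set_lebesgue_integral_def intro!: Bochner_Integration.integral_cong)
  also have "(\<integral>t. \<integral>s. \<phi> s t \<partial>leb01 \<partial>leb01) = (\<integral>s. \<integral>t. \<phi> s t \<partial>leb01 \<partial>leb01)"
    by (rule Fubini_integral[OF \<phi>])
  also have "\<dots> = (\<integral>s. f s \<bullet> q s \<partial>leb01)"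
    by (intro Bochner_Integration.integral_cong) (auto simp: q 2)
  finally show ?thesis by simp
qed

text \<open>The adjoint of a linear map, given by its coordinates so that measurability in a parameter is evident.\<close>

definition coord_adjoint :: "('b::euclidean_space \<Rightarrow> 'a::real_inner) \<Rightarrow> 'a \<Rightarrow> 'b" where
  "coord_adjoint f l = (\<Sum>b\<in>Basis. (f b \<bullet> l) *\<^sub>R b)"

lemma coord_adjoint_inner:
  assumes "linear f" shows "coord_adjoint f l \<bullet> v = l \<bullet> f v"
proof -
  have "f v = (\<Sum>b\<in>Basis. (v \<bullet> b) *\<^sub>R f b)"
    by (subst (1) euclidean_representation[of v, symmetric]) (simp add: linear_sum[OF assms] linear_cmul[OF assms])
  then show ?thesis
    by (simp add: coord_adjoint_def inner_sum_left inner_sum_right inner_commute mult.commute)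
qed

text \<open>The adjoint vector is tested against itself: its squared norm is \<open>l\<close> paired
  with the image of that vector under \<open>f\<close>.\<close>

lemma norm_coord_adjoint_le:
  assumes f: "linear f" and B: "\<And>v. norm (f v) \<le> B * norm v"
  shows "norm (coord_adjoint f l) \<le> B * norm l"
proof (cases "coord_adjoint f l = 0")
  case True
  \<comment> \<open>No sign of \<open>B\<close> is assumed; it follows from the bound at a basis
    vector. For \<open>l\<close> equal to 0 both sides vanish.\<close>
  have "0 \<le> B" if "l \<noteq> 0"
  proof -
    obtain b :: 'a where b: "b \<in> Basis" using nonempty_Basis by blast
    show ?thesis using order_trans[OF norm_ge_zero B[of b]] b by simp
  qed
  with True show ?thesis by (cases "l = 0") auto
next
  case False
  let ?c = "coord_adjoint f l"
  have "(norm ?c)\<^sup>2 = l \<bullet> f ?c"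
    by (simp add: power2_norm_eq_inner coord_adjoint_inner[OF f])
  also have "\<dots> \<le> norm l * norm (f ?c)" by (rule norm_cauchy_schwarz)
  also have "\<dots> \<le> norm l * (B * norm ?c)" by (intro mult_left_mono B) auto
  finally show ?thesis using False by (simp add: power2_eq_square mult_ac)
qed

lemma coord_adjoint_diff:
  "coord_adjoint (\<lambda>v. f v - g v) l = coord_adjoint f l - coord_adjoint g l"
  "coord_adjoint f (l - k) = coord_adjoint f l - coord_adjoint f k"
  by (simp_all add: coord_adjoint_def inner_diff algebra_simps sum_subtractf)

text \<open>Expanding \<open>u s\<close> in the basis leaves finitely many products of a measurable
  coordinate with the continuous curve \<open>s\<close> to \<open>A s b\<close>.\<close>

lemma measurable_blinfun_apply:
  fixes A :: "real \<Rightarrow> 'b::euclidean_space \<Rightarrow>\<^sub>L 'a::euclidean_space"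
  assumes A: "continuous_on {0..1} A" and [measurable]: "u \<in> borel_measurable leb01"
  shows "(\<lambda>s. A s (u s)) \<in> borel_measurable leb01"
proof -
  have [measurable]: "(\<lambda>s. A s b) \<in> borel_measurable leb01" for b
    by (rule measurable_leb01_continuous) (intro continuous_intros A)
  have "A s (u s) = (\<Sum>b\<in>Basis. (u s \<bullet> b) *\<^sub>R A s b)" for s
    by (subst (1) euclidean_representation[of "u s", symmetric]) (simp add: blinfun.sum_right blinfun.scaleR_right)
  then show ?thesis by simp
qed

section \<open>Norm bounds for square integrable controls\<close>

lemma L2_norm:
  assumes "L2 u"
  shows "(\<lambda>s. norm (u s)) \<in> borel_measurable leb01" "integrable leb01 (\<lambda>s. (norm (u s))\<^sup>2)"
    "integrable leb01 (\<lambda>s. norm (u s))" "(\<integral>s. norm (u s) \<partial>leb01) \<le> L2norm u"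
    "(\<integral>s. (norm (u s))\<^sup>2 \<partial>leb01) = (L2norm u)\<^sup>2"
proof -
  have [measurable]: "u \<in> borel_measurable leb01" and u2: "integrable leb01 (\<lambda>s. (norm (u s))\<^sup>2)"
    using assms by (auto simp: L2_iff)
  \<comment> \<open>Cauchy-Schwarz against the constant 1, on a space of total mass 1, puts the L1
    norm below the L2 norm.\<close>
  have one: "integrable leb01 (\<lambda>s. (1::real)\<^sup>2)" by (rule integrable_leb01_continuous) auto
  have m1: "(\<integral>s. 1 \<partial>leb01) = (1::real)" by (simp add: measure_restrict_space)
  show "(\<lambda>s. norm (u s)) \<in> borel_measurable leb01" "integrable leb01 (\<lambda>s. (norm (u s))\<^sup>2)"
    using u2 by auto
  show "integrable leb01 (\<lambda>s. norm (u s))" "(\<integral>s. norm (u s) \<partial>leb01) \<le> L2norm u"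
    using integral_Cauchy_Schwarz[OF _ _ u2 one] m1 by (auto simp: L2norm_eq)
  show "(\<integral>s. (norm (u s))\<^sup>2 \<partial>leb01) = (L2norm u)\<^sup>2" by (simp add: L2norm_eq)
qed

lemma L2norm_ge_0: "0 \<le> L2norm u"
  by (simp add: L2norm_eq)

text \<open>Bundles what \<open>volterra_bound\<close> asks of a kernel \<open>m\<close> (first
  three parts) or of a source \<open>r\<close> (last two) proportional to the norm of a
  control.\<close>

lemma L2norm_scaled:
  assumes "L2 u" "L2norm u \<le> R" "c \<ge> 0" 
  shows "(\<lambda>s. c * norm (u s)) \<in> borel_measurable leb01" "integrable leb01 (\<lambda>s. (c * norm (u s))\<^sup>2)"
    "(\<integral>s. (c * norm (u s))\<^sup>2 \<partial>leb01) \<le> (c * R)\<^sup>2"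
    "integrable leb01 (\<lambda>s. c * norm (u s))" "(\<integral>s. c * norm (u s) \<partial>leb01) \<le> c * R"
proof -
  note * = L2_norm[OF assms(1)]
  show "(\<lambda>s. c * norm (u s)) \<in> borel_measurable leb01" "integrable leb01 (\<lambda>s. (c * norm (u s))\<^sup>2)"
    "integrable leb01 (\<lambda>s. c * norm (u s))" using * by (auto simp: power_mult_distrib)
  have "(L2norm u)\<^sup>2 \<le> R\<^sup>2" using assms(2) L2norm_ge_0[of u] by (rule power_mono)
  then show "(\<integral>s. (c * norm (u s))\<^sup>2 \<partial>leb01) \<le> (c * R)\<^sup>2"
    using * by (simp add: power_mult_distrib mult_left_mono)
  show "(\<integral>s. c * norm (u s) \<partial>leb01) \<le> c * R"
    using *(4) assms by (simp add: mult_left_mono)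
qed

lemma L2_of_continuous:
  assumes "continuous_on {0..1} g" shows "L2 g"
  unfolding L2_iff
  using assms by (intro conjI measurable_leb01_continuous integrable_leb01_continuous continuous_intros)

lemma integrable_inner_continuous:
  fixes p g :: "real \<Rightarrow> 'a::euclidean_space"
  assumes p: "continuous_on {0..1} p" and g: "integrable leb01 g"
  shows "integrable leb01 (\<lambda>s. p s \<bullet> g s)"
proof -
  have [measurable]: "p \<in> borel_measurable leb01" by (rule measurable_leb01_continuous[OF p])
  have [measurable]: "g \<in> borel_measurable leb01" using g by simp
  have "compact (p ` {0..1})" using p by (intro compact_continuous_image) auto
  then obtain B where "\<forall>y\<in>p ` {0..1}. norm y \<le> B"
    using compact_imp_bounded[of "p ` {0..1}"] unfolding bounded_iff by blast
  then have B: "norm (p s) \<le> B" if "s \<in> {0..1}" for s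
    using that by auto
  have "integrable leb01 (\<lambda>s. B * norm (g s))" using g by simp
  then show ?thesis
  proof (rule Bochner_Integration.integrable_bound)
    show "AE s in leb01. norm (p s \<bullet> g s) \<le> norm (B * norm (g s))"
    proof (rule AE_I2)
      fix s assume "s \<in> space leb01"
      then have "norm (p s \<bullet> g s) \<le> B * norm (g s)"
        unfolding real_norm_def by (intro order_trans[OF Cauchy_Schwarz_ineq2] mult_right_mono B) auto
      then show "norm (p s \<bullet> g s) \<le> norm (B * norm (g s))" by simp
    qed
  qed measurable
qed

section \<open>Trajectory and adjoint state\<close>

text \<open>The absolute value in the assumption puts 0 into the ball whatever the sign of
  \<open>R\<close>, so comparison with \<open>f 0\<close> gives the bound \<open>B\<close>.\<close>

lemma lipschitz_on_ball_bounded: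
  fixes f :: "'a::real_normed_vector \<Rightarrow> 'b::real_normed_vector" and R :: real
  assumes "\<exists>C. \<forall>x y. norm x \<le> \<bar>R\<bar> \<and> norm y \<le> \<bar>R\<bar> \<longrightarrow> norm (f x - f y) \<le> C * norm (x - y)"
  obtains B C where "B \<ge> 0" "C \<ge> 0" "\<And>x. norm x \<le> R \<Longrightarrow> norm (f x) \<le> B"
    "\<And>x y. norm x \<le> R \<Longrightarrow> norm y \<le> R \<Longrightarrow> norm (f x - f y) \<le> C * norm (x - y)"
proof -
  obtain C where C: "\<And>x y. norm x \<le> \<bar>R\<bar> \<Longrightarrow> norm y \<le> \<bar>R\<bar> \<Longrightarrow> norm (f x - f y) \<le> C * norm (x - y)"
    using assms by blast
  have C': "norm (f x - f y) \<le> \<bar>C\<bar> * norm (x - y)" if "norm x \<le> \<bar>R\<bar>" "norm y \<le> \<bar>R\<bar>" for x y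
    using C[OF that] mult_right_mono[OF abs_ge_self[of C] norm_ge_zero[of "x - y"]] by linarith
  show thesis
  proof
    show "norm (f x) \<le> norm (f 0) + \<bar>C\<bar> * \<bar>R\<bar>" if "norm x \<le> R" for x
    proof -
      have "norm (f x - f 0) \<le> \<bar>C\<bar> * norm x" using C'[of x 0] that by simp
      also have "\<dots> \<le> \<bar>C\<bar> * \<bar>R\<bar>" using that by (intro mult_left_mono) auto
      finally show ?thesis using norm_triangle_ineq2[of "f x" "f 0"] by linarith
    qed
    show "norm (f x - f y) \<le> \<bar>C\<bar> * norm (x - y)" if "norm x \<le> R" "norm y \<le> R" for x y
      using C' that by auto
  qed auto
qed

text \<open>The data in operator form: \<open>F x\<close> is a linear map on controls and
  \<open>DF\<close> its derivative. The field \<open>ga\<close> will be the gradient of the cost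
  \<open>a\<close>; the adjoint state needs it only as terminal value, so \<open>a\<close> itself
  appears no earlier than in the chain rule.\<close>

locale control_problem =
  fixes F :: "'a::euclidean_space \<Rightarrow> (real^'k::finite) \<Rightarrow>\<^sub>L 'a"
    and DF :: "'a \<Rightarrow> 'a \<Rightarrow>\<^sub>L (real^'k) \<Rightarrow>\<^sub>L 'a"
    and x0 :: 'a and L :: real and ga :: "'a \<Rightarrow> 'a"
  assumes F_lip: "norm (F x - F y) \<le> L * norm (x - y)" and L_nonneg: "L \<ge> 0"
    and F_deriv: "(F has_derivative DF x) (at x)"
    and DF_lip: "\<exists>C. \<forall>x y. norm x \<le> R \<and> norm y \<le> R \<longrightarrow> norm (DF x - DF y) \<le> C * norm (x - y)"
    and ga_lip: "\<exists>C. \<forall>x y. norm x \<le> R \<and> norm y \<le> R \<longrightarrow> norm (ga x - ga y) \<le> C * norm (x - y)"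
begin

lemma F_cont: "continuous_on S F"
  by (intro continuous_at_imp_continuous_on ballI has_derivative_continuous[OF F_deriv])

lemma F_growth: "norm (F x) \<le> norm (F 0) + L * norm x"
  using F_lip[of x 0] norm_triangle_ineq2[of "F x" "F 0"] by simp

lemmas DF_bound = lipschitz_on_ball_bounded[OF DF_lip]
lemmas ga_bound = lipschitz_on_ball_bounded[OF ga_lip]

lemma DF_cont: "continuous_on UNIV DF"
  unfolding continuous_on_eq_continuous_within
proof
  fix x :: 'a
  obtain B C where C: "\<And>y z. norm y \<le> norm x + 1 \<Longrightarrow> norm z \<le> norm x + 1 \<Longrightarrow> norm (DF y - DF z) \<le> C * norm (y - z)" "C \<ge> 0"
    using DF_bound[of "norm x + 1"] by metis
  have "C-lipschitz_on (ball x 1) DF"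
  proof (rule lipschitz_onI)
    fix y z assume "y \<in> ball x 1" "z \<in> ball x 1"
    then have "norm y \<le> norm x + 1" "norm z \<le> norm x + 1"
      using norm_triangle_ineq2[of y x] norm_triangle_ineq2[of z x] by (auto simp: dist_norm norm_minus_commute)
    then show "dist (DF y) (DF z) \<le> C * dist y z" using C by (simp add: dist_norm)
  qed (rule C)
  then have "continuous_on (ball x 1) DF" by (rule lipschitz_on_continuous_on)
  then show "continuous (at x within UNIV) DF"
    by (simp add: continuous_on_eq_continuous_at)
qed

text \<open>Mean value theorem along the segment, which stays in the ball by convexity; there the
  derivative differs from the one at \<open>x\<close> by at most
  \<open>C * norm (z - x)\<close>.\<close>

lemma F_taylor:
  assumes "norm x \<le> R" "norm z \<le> R"
    and C: "\<And>x y. norm x \<le> R \<Longrightarrow> norm y \<le> R \<Longrightarrow> norm (DF x - DF y) \<le> C * norm (x - y)" "C \<ge> 0"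
  shows "norm (F z - F x - DF x (z - x)) \<le> C * (norm (z - x))\<^sup>2"
proof -
  have seg: "norm y \<le> R" "norm (y - x) \<le> norm (z - x)" if "y \<in> closed_segment x z" for y
  proof -
    have "convex (cball 0 R :: 'a set)" by simp
    from closed_segment_subset[OF _ _ this, of x z] that assms show "norm y \<le> R" by auto
    show "norm (y - x) \<le> norm (z - x)" using segment_bound[OF that] by (simp add: norm_minus_commute)
  qed
  have "norm (F z - F x - DF x (z - x)) \<le> norm (z - x) * (C * norm (z - x))"
  proof (rule differentiable_bound_linearization[where S="closed_segment x z" and f'="\<lambda>x. DF x"])
    show "x + t *\<^sub>R (z - x) \<in> closed_segment x z" if "t \<in> {0..1}" for t
      using that by (auto simp: in_segment algebra_simps intro!: exI[of _ t])
    show "(F has_derivative DF y) (at y within closed_segment x z)" for y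
      by (rule has_derivative_at_withinI[OF F_deriv])
    fix y assume y: "y \<in> closed_segment x z"
    have "norm (DF y - DF x) \<le> C * norm (y - x)" using seg[OF y] assms by (intro C) auto
    also have "\<dots> \<le> C * norm (z - x)" using seg[OF y] C by (intro mult_left_mono) auto
    also have "norm (DF y - DF x) = onorm (blinfun_apply (DF y) - blinfun_apply (DF x))"
      by (simp add: norm_blinfun.rep_eq minus_blinfun.rep_eq fun_diff_def)
    finally show "onorm (blinfun_apply (DF y) - blinfun_apply (DF x)) \<le> C * norm (z - x)" .
  qed auto
  then show ?thesis by (simp add: power2_eq_square mult_ac)
qed

definition is_traj :: "(real \<Rightarrow> real^'k) \<Rightarrow> (real \<Rightarrow> 'a) \<Rightarrow> bool" where
  "is_traj u x \<longleftrightarrow> continuous_on {0..1} x \<and> (\<forall>t\<in>{0..1}. x t = x0 + (LINT s:{0..t}|leb01. F (x s) (u s)))"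

text \<open>On \<open>{0..1}\<close> the choice is forced by \<open>traj_unique\<close>; elsewhere
  the values are arbitrary and never inspected.\<close>

definition traj :: "(real \<Rightarrow> real^'k) \<Rightarrow> real \<Rightarrow> 'a" where
  "traj u = (SOME x. is_traj u x)"

lemma F_apply_measurable:
  assumes "L2 u" "continuous_on {0..1} x"
  shows "(\<lambda>s. F (x s) (u s)) \<in> borel_measurable leb01"
  using assms by (intro measurable_blinfun_apply continuous_on_compose2[OF F_cont[of UNIV]]) (auto simp: L2_iff)

lemma F_apply_integrable:
  assumes u: "L2 u" and x: "continuous_on {0..1} x"
  shows "integrable leb01 (\<lambda>s. F (x s) (u s))"
proof -
  have "compact ((\<lambda>s. F (x s)) ` {0..1})"
    by (intro compact_continuous_image continuous_on_compose2[OF F_cont[of UNIV] x]) auto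
  then obtain B where "\<forall>y\<in>(\<lambda>s. F (x s)) ` {0..1}. norm y \<le> B"
    using compact_imp_bounded[of "(\<lambda>s. F (x s)) ` {0..1}"] unfolding bounded_iff by blast
  then have B: "norm (F (x s)) \<le> B" if "s \<in> {0..1}" for s
    using that by auto
  have "integrable leb01 (\<lambda>s. B * norm (u s))" using L2_norm[OF u] by simp
  then show ?thesis
  proof (rule Bochner_Integration.integrable_bound)
    show "AE s in leb01. norm (F (x s) (u s)) \<le> norm (B * norm (u s))"
    proof (rule AE_I2)
      fix s assume "s \<in> space leb01"
      then have "norm (F (x s) (u s)) \<le> B * norm (u s)"
        by (intro order_trans[OF norm_blinfun] mult_right_mono B) auto
      then show "norm (F (x s) (u s)) \<le> norm (B * norm (u s))" by simp
    qed
  qed (rule F_apply_measurable[OF u x])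
qed

lemma traj: assumes u: "L2 u" shows "is_traj u (traj u)"
proof -
  obtain x where "continuous_on {0..1} x" "\<And>t. t \<in> {0..1} \<Longrightarrow> x t = x0 + (LINT s:{0..t}|leb01. F (x s) (u s))"
  proof (rule fwd.volterra_exists[where \<Phi>="\<lambda>s y. F y (u s)" and m="\<lambda>s. L * norm (u s)"
        and b="\<lambda>s. norm (F 0) * norm (u s)" and ?y0.0=x0])
    show "norm (F y (u s) - F z (u s)) \<le> L * norm (u s) * norm (y - z)" for s y z
    proof -
      have "norm (F y (u s) - F z (u s)) = norm ((F y - F z) (u s))" by (simp add: blinfun.diff_left)
      also have "\<dots> \<le> (L * norm (y - z)) * norm (u s)"
        by (intro order_trans[OF norm_blinfun] mult_right_mono F_lip) auto
      finally show ?thesis by (simp add: mult_ac)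
    qed
  qed (use u L2_norm[OF u] in \<open>auto simp: power_mult_distrib norm_blinfun intro: F_apply_measurable\<close>)
  then have "is_traj u x" by (simp add: is_traj_def)
  then show ?thesis unfolding traj_def by (rule someI[where P="is_traj u"])
qed

text \<open>Stated for arbitrary solutions rather than for \<open>traj\<close>, so that equal
  controls in the second bound give uniqueness.\<close>

lemma is_traj_bounds:
  assumes R: "R \<ge> 0"
  obtains M C where "M \<ge> 0" "C \<ge> 0"
    "\<And>u x t. \<lbrakk>L2 u; L2norm u \<le> R; is_traj u x; t \<in> {0..1}\<rbrakk> \<Longrightarrow> norm (x t) \<le> M"
    "\<And>u v x y t. \<lbrakk>L2 u; L2norm u \<le> R; is_traj u x; L2 v; L2norm v \<le> R; is_traj v y; t \<in> {0..1}\<rbrakk>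
      \<Longrightarrow> norm (x t - y t) \<le> C * L2norm (\<lambda>s. u s - v s)"
proof -
  have LR: "L * R \<ge> 0" using L_nonneg R by simp
  show thesis
  proof (rule fwd.volterra_bound[OF LR])
    fix G :: real assume G: "G \<ge> 1"
    assume gr: "\<And>m r d (e :: real \<Rightarrow> 'a) f t.
      \<lbrakk>m \<in> borel_measurable leb01; integrable leb01 (\<lambda>s. (m s)\<^sup>2); (\<integral>s. (m s)\<^sup>2 \<partial>leb01) \<le> (L * R)\<^sup>2;
        continuous_on {0..1} e; integrable leb01 r;
        \<And>t. t \<in> {0..1} \<Longrightarrow> e t = d + (LINT s:{0..t}|leb01. f s);
        \<And>s. s \<in> {0..1} \<Longrightarrow> 0 \<le> r s \<and> norm (f s) \<le> m s * norm (e s) + r s; t \<in> {0..1}\<rbrakk>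
      \<Longrightarrow> norm (e t) \<le> G * (norm d + (\<integral>s. r s \<partial>leb01))"
    define M where "M = G * (norm x0 + norm (F 0) * R)"
    \<comment> \<open>A bound for the operator norm of \<open>F\<close> along all trajectories with
      controls in the ball, from the linear growth of \<open>F\<close> and the state bound
      \<open>M\<close>.\<close>
    define K where "K = norm (F 0) + L * M"
    have M0: "M \<ge> 0" using G R by (simp add: M_def)
    have K0: "K \<ge> 0" using M0 L_nonneg by (simp add: K_def)
    have bound: "norm (x t) \<le> M" if u: "L2 u" "L2norm u \<le> R" and x: "is_traj u x" and t: "t \<in> {0..1}" for u x t
    proof -
      have "norm (x t) \<le> G * (norm x0 + (\<integral>s. norm (F 0) * norm (u s) \<partial>leb01))"
      proof (rule gr[where f="\<lambda>s. F (x s) (u s)"])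
        show "0 \<le> norm (F 0) * norm (u s) \<and> norm (F (x s) (u s)) \<le> L * norm (u s) * norm (x s) + norm (F 0) * norm (u s)" for s
        proof -
          have "norm (F (x s) (u s)) \<le> (norm (F 0) + L * norm (x s)) * norm (u s)"
            by (intro order_trans[OF norm_blinfun] mult_right_mono F_growth) auto
          then show ?thesis by (simp add: algebra_simps)
        qed
      qed (use L2norm_scaled[OF u L_nonneg] L2norm_scaled(4)[OF u, of "norm (F 0)"] x t in \<open>auto simp: is_traj_def\<close>)
      also have "\<dots> \<le> M"
        unfolding M_def using G L2norm_scaled(5)[OF u, of "norm (F 0)"] by (intro mult_left_mono add_left_mono) auto
      finally show ?thesis .
    qed
    have lip: "norm (x t - y t) \<le> G * K * L2norm (\<lambda>s. u s - v s)"
      if u: "L2 u" "L2norm u \<le> R" "is_traj u x" and v: "L2 v" "L2norm v \<le> R" "is_traj v y" and t: "t \<in> {0..1}"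
      for u v x y t
    proof -
      have uv: "L2 (\<lambda>s. u s - v s)" by (rule L2_diff[OF u(1) v(1)])
      have xc: "continuous_on {0..1} x" "continuous_on {0..1} y" using u v by (auto simp: is_traj_def)
      have "norm (x t - y t) \<le> G * (norm (0::'a) + (\<integral>s. K * norm (u s - v s) \<partial>leb01))"
      proof (rule gr[where f="\<lambda>s. F (x s) (u s) - F (y s) (v s)"])
        show "x t - y t = 0 + (LINT s:{0..t}|leb01. F (x s) (u s) - F (y s) (v s))" if t: "t \<in> {0..1}" for t
          using u v t
          by (subst set_integral_diff) (auto simp: is_traj_def intro!: fwd.set_integrable_D F_apply_integrable)
        fix s :: real assume s: "s \<in> {0..1}"
        \<comment> \<open>The change of state contributes the Gronwall kernel
          \<open>L * norm (u s)\<close>, the change of control the source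
          \<open>K * norm (u s - v s)\<close>.\<close>
        have "F (x s) (u s) - F (y s) (v s) = (F (x s) - F (y s)) (u s) + F (y s) (u s - v s)"
          by (simp add: blinfun.diff_left blinfun.diff_right)
        also have "norm \<dots> \<le> (L * norm (x s - y s)) * norm (u s) + K * norm (u s - v s)"
        proof (intro norm_triangle_mono order_trans[OF norm_blinfun] mult_right_mono F_lip)
          have "L * norm (y s) \<le> L * M" by (intro mult_left_mono bound[OF v s] L_nonneg)
          then show "norm (F (y s)) \<le> K" using F_growth[of "y s"] by (simp add: K_def)
        qed auto
        finally show "0 \<le> K * norm (u s - v s) \<and> norm (F (x s) (u s) - F (y s) (v s)) \<le> L * norm (u s) * norm (x s - y s) + K * norm (u s - v s)"
          using K0 by (simp add: mult_ac)
      qed (use L2norm_scaled[OF u(1,2) L_nonneg] L2norm_scaled(4)[OF uv order_refl K0] xc t in \<open>auto intro!: continuous_intros\<close>)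
      also have "\<dots> \<le> G * (0 + K * L2norm (\<lambda>s. u s - v s))"
        using G L2norm_scaled(5)[OF uv order_refl K0] by (intro mult_left_mono add_mono) auto
      finally show ?thesis by simp
    qed
    show thesis
    proof (rule that[of M "G * K"])
      show "G * K \<ge> 0" using G K0 by simp
    qed (fact M0 bound lip)+
  qed
qed

lemma traj_unique:
  assumes "L2 u" "is_traj u x" "t \<in> {0..1}"
  shows "x t = traj u t"
proof -
  have "x t - traj u t = 0"
  proof (rule is_traj_bounds[OF L2norm_ge_0[of u]])
    fix M C assume "\<And>u' v x y t. \<lbrakk>L2 u'; L2norm u' \<le> L2norm u; is_traj u' x; L2 v; L2norm v \<le> L2norm u; is_traj v y; t \<in> {0..1}\<rbrakk>
      \<Longrightarrow> norm (x t - y t) \<le> C * L2norm (\<lambda>s. u' s - v s)"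
    from this[OF assms(1) order_refl assms(2) assms(1) order_refl traj[OF assms(1)] assms(3)]
    show ?thesis by (simp add: L2norm_eq)
  qed
  then show ?thesis by simp
qed

abbreviation adj_kernel :: "(real \<Rightarrow> real^'k) \<Rightarrow> real \<Rightarrow> 'a \<Rightarrow> 'a" where
  "adj_kernel u s \<equiv> coord_adjoint (\<lambda>y. DF (traj u s) y (u s))"

definition is_adj :: "(real \<Rightarrow> real^'k) \<Rightarrow> (real \<Rightarrow> 'a) \<Rightarrow> bool" where
  "is_adj u l \<longleftrightarrow> continuous_on {0..1} l \<and>
     (\<forall>t\<in>{0..1}. l t = ga (traj u 1) + (LINT s:{t..1}|leb01. adj_kernel u s (l s)))"

definition adj :: "(real \<Rightarrow> real^'k) \<Rightarrow> real \<Rightarrow> 'a" where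
  "adj u = (SOME l. is_adj u l)"

lemma traj_cont: "L2 u \<Longrightarrow> continuous_on {0..1} (traj u)"
  using traj by (simp add: is_traj_def)

lemma linear_DF_apply: "linear (\<lambda>y. DF x y v)"
  by (intro linearI) (simp_all add: blinfun.bilinear_simps)

lemma adj_kernel_measurable:
  assumes u: "L2 u" and l: "continuous_on {0..1} l"
  shows "(\<lambda>s. adj_kernel u s (l s)) \<in> borel_measurable leb01"
proof -
  have [measurable]: "(\<lambda>s. DF (traj u s) b (u s)) \<in> borel_measurable leb01" for b
    by (rule measurable_blinfun_apply)
      (use u traj_cont[OF u] in \<open>auto simp: L2_iff intro!: continuous_intros continuous_on_compose2[OF DF_cont]\<close>)
  have [measurable]: "l \<in> borel_measurable leb01" by (rule measurable_leb01_continuous[OF l])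
  show ?thesis unfolding coord_adjoint_def by measurable
qed

lemma adj_kernel_diff_le:
  assumes "norm (DF x - DF y) \<le> A" "norm (DF y) \<le> B"
  shows "norm (coord_adjoint (\<lambda>h. DF x h u) k - coord_adjoint (\<lambda>h. DF y h v) k)
    \<le> (A * norm u + B * norm (u - v)) * norm k"
  unfolding coord_adjoint_diff(1)[symmetric]
proof (rule norm_coord_adjoint_le)
  show "linear (\<lambda>h. DF x h u - DF y h v)" by (intro linear_compose_sub linear_DF_apply)
  fix h
  have "DF x h u - DF y h v = (DF x - DF y) h u + DF y h (u - v)"
    by (simp add: blinfun.bilinear_simps)
  also have "norm \<dots> \<le> (A * norm h) * norm u + (B * norm h) * norm (u - v)"
    by (intro norm_triangle_mono order_trans[OF norm_blinfun] mult_right_mono assms) auto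
  finally show "norm (DF x h u - DF y h v) \<le> (A * norm u + B * norm (u - v)) * norm h"
    by (simp add: algebra_simps)
qed

lemma adj_kernel_le:
  assumes "norm (DF x) \<le> B"
  shows "norm (coord_adjoint (\<lambda>h. DF x h u) k) \<le> B * norm u * norm k"
proof (rule norm_coord_adjoint_le[OF linear_DF_apply])
  fix h
  have "norm (DF x h u) \<le> (B * norm h) * norm u"
    by (intro order_trans[OF norm_blinfun] mult_right_mono assms) auto
  then show "norm (DF x h u) \<le> B * norm u * norm h" by (simp add: mult_ac)
qed

lemma adj: assumes u: "L2 u" shows "is_adj u (adj u)"
proof -
  \<comment> \<open>\<open>DF\<close> is controlled on balls, so the trajectory must be bounded
    before the linear adjoint equation has a kernel bound \<open>B * norm (u s)\<close>.\<close>
  obtain M where M: "\<And>t. t \<in> {0..1} \<Longrightarrow> norm (traj u t) \<le> M"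
    by (rule is_traj_bounds[OF L2norm_ge_0[of u]]) (use traj[OF u] u in blast)
  obtain B where B: "B \<ge> 0" "\<And>x. norm x \<le> M \<Longrightarrow> norm (DF x) \<le> B"
    using DF_bound[of M] by metis
  obtain l where "continuous_on {0..1} l"
    "\<And>t. t \<in> {0..1} \<Longrightarrow> l t = ga (traj u 1) + (LINT s:{t..1}|leb01. adj_kernel u s (l s))"
  proof (rule bwd.volterra_exists[where \<Phi>="adj_kernel u" and m="\<lambda>s. B * norm (u s)"
        and b="\<lambda>s. 0" and ?y0.0="ga (traj u 1)"])
    show "norm (adj_kernel u s y - adj_kernel u s z) \<le> B * norm (u s) * norm (y - z)" if "s \<in> {0..1}" for s y z
      unfolding coord_adjoint_diff(2)[symmetric] by (intro adj_kernel_le B M that)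
  qed (use u L2_norm[OF u] in \<open>auto simp: power_mult_distrib coord_adjoint_def[of _ 0] intro: adj_kernel_measurable\<close>)
  then have "is_adj u l" by (simp add: is_adj_def)
  then show ?thesis unfolding adj_def by (rule someI[where P="is_adj u"])
qed

lemma adj_cont: "L2 u \<Longrightarrow> continuous_on {0..1} (adj u)"
  using adj by (simp add: is_adj_def)

lemma adj_kernel_integrable:
  assumes u: "L2 u" and l: "continuous_on {0..1} l"
  shows "integrable leb01 (\<lambda>s. adj_kernel u s (l s))"
proof -
  have c: "continuous_on {0..1} (\<lambda>s. norm (DF (traj u s)) * norm (l s))"
    by (intro continuous_intros continuous_on_compose2[OF DF_cont traj_cont[OF u]] l) auto
  then have "compact ((\<lambda>s. norm (DF (traj u s)) * norm (l s)) ` {0..1})"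
    by (rule compact_continuous_image) auto
  then obtain B where "\<forall>x\<in>(\<lambda>s. norm (DF (traj u s)) * norm (l s)) ` {0..1}. norm x \<le> B"
    using compact_imp_bounded[of "(\<lambda>s. norm (DF (traj u s)) * norm (l s)) ` {0..1}"] unfolding bounded_iff by blast
  then have B: "norm (DF (traj u s)) * norm (l s) \<le> B" if "s \<in> {0..1}" for s
    using that by auto
  have "integrable leb01 (\<lambda>s. B * norm (u s))" using L2_norm[OF u] by simp
  then show ?thesis
  proof (rule Bochner_Integration.integrable_bound)
    show "AE s in leb01. norm (adj_kernel u s (l s)) \<le> norm (B * norm (u s))"
    proof (rule AE_I2)
      fix s assume s: "s \<in> space leb01"
      have "norm (adj_kernel u s (l s)) \<le> (norm (DF (traj u s)) * norm (l s)) * norm (u s)"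
        using adj_kernel_le[OF order_refl, of "traj u s" "u s" "l s"] by (simp add: mult_ac)
      also have "\<dots> \<le> B * norm (u s)" using s by (intro mult_right_mono B) auto
      finally show "norm (adj_kernel u s (l s)) \<le> norm (B * norm (u s))" by simp
    qed
  qed (rule adj_kernel_measurable[OF u l])
qed

end

section \<open>The derivative of the endpoint\<close>

context control_problem
begin

lemma traj_bounds:
  assumes R: "R \<ge> 0"
  obtains M C where "M \<ge> 0" "C \<ge> 0"
    "\<And>u t. \<lbrakk>L2 u; L2norm u \<le> R; t \<in> {0..1}\<rbrakk> \<Longrightarrow> norm (traj u t) \<le> M"
    "\<And>u v t. \<lbrakk>L2 u; L2norm u \<le> R; L2 v; L2norm v \<le> R; t \<in> {0..1}\<rbrakk>
      \<Longrightarrow> norm (traj u t - traj v t) \<le> C * L2norm (\<lambda>s. u s - v s)"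
proof (rule is_traj_bounds[OF R])
  fix M C :: real
  assume M: "M \<ge> 0" and C: "C \<ge> 0"
    and bound: "\<And>u x t. \<lbrakk>L2 u; L2norm u \<le> R; is_traj u x; t \<in> {0..1}\<rbrakk> \<Longrightarrow> norm (x t) \<le> M"
    and lip: "\<And>u v x y t. \<lbrakk>L2 u; L2norm u \<le> R; is_traj u x; L2 v; L2norm v \<le> R; is_traj v y; t \<in> {0..1}\<rbrakk>
      \<Longrightarrow> norm (x t - y t) \<le> C * L2norm (\<lambda>s. u s - v s)"
  show thesis
    by (rule that[OF M C bound[OF _ _ traj] lip[OF _ _ traj _ _ traj]])
qed

text \<open>Two backward estimates with the same kernel bound. For a difference of adjoint states,
  the perturbation sits in the terminal value and in the transposed kernel, both controlled by
  \<open>traj_bounds\<close>.\<close>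

lemma adj_bounds:
  assumes R: "R \<ge> 0"
  obtains M C where "M \<ge> 0" "C \<ge> 0"
    "\<And>u t. \<lbrakk>L2 u; L2norm u \<le> R; t \<in> {0..1}\<rbrakk> \<Longrightarrow> norm (adj u t) \<le> M"
    "\<And>u v t. \<lbrakk>L2 u; L2norm u \<le> R; L2 v; L2norm v \<le> R; t \<in> {0..1}\<rbrakk>
      \<Longrightarrow> norm (adj u t - adj v t) \<le> C * L2norm (\<lambda>s. u s - v s)"
proof (rule traj_bounds[OF R])
  fix Mx Cx :: real
  assume Mx: "Mx \<ge> 0" and Cx: "Cx \<ge> 0"
    and x_le: "\<And>u t. \<lbrakk>L2 u; L2norm u \<le> R; t \<in> {0..1}\<rbrakk> \<Longrightarrow> norm (traj u t) \<le> Mx"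
    and x_lip: "\<And>u v t. \<lbrakk>L2 u; L2norm u \<le> R; L2 v; L2norm v \<le> R; t \<in> {0..1}\<rbrakk>
      \<Longrightarrow> norm (traj u t - traj v t) \<le> Cx * L2norm (\<lambda>s. u s - v s)"
  obtain B Cd where B: "B \<ge> 0" "Cd \<ge> 0" "\<And>x. norm x \<le> Mx \<Longrightarrow> norm (DF x) \<le> B"
    "\<And>x y. norm x \<le> Mx \<Longrightarrow> norm y \<le> Mx \<Longrightarrow> norm (DF x - DF y) \<le> Cd * norm (x - y)"
    using DF_bound[of Mx] by metis
  obtain Bg Cg where Bg: "Bg \<ge> 0" "Cg \<ge> 0" "\<And>x. norm x \<le> Mx \<Longrightarrow> norm (ga x) \<le> Bg"
    "\<And>x y. norm x \<le> Mx \<Longrightarrow> norm y \<le> Mx \<Longrightarrow> norm (ga x - ga y) \<le> Cg * norm (x - y)"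
    using ga_bound[of Mx] by metis
  have BR: "B * R \<ge> 0" using B R by simp
  show thesis
  proof (rule bwd.volterra_bound[OF BR])
    fix G :: real assume G: "G \<ge> 1"
    assume gr: "\<And>m r d (e :: real \<Rightarrow> 'a) f t.
      \<lbrakk>m \<in> borel_measurable leb01; integrable leb01 (\<lambda>s. (m s)\<^sup>2); (\<integral>s. (m s)\<^sup>2 \<partial>leb01) \<le> (B * R)\<^sup>2;
        continuous_on {0..1} e; integrable leb01 r;
        \<And>t. t \<in> {0..1} \<Longrightarrow> e t = d + (LINT s:{t..1}|leb01. f s);
        \<And>s. s \<in> {0..1} \<Longrightarrow> 0 \<le> r s \<and> norm (f s) \<le> m s * norm (e s) + r s; t \<in> {0..1}\<rbrakk>
      \<Longrightarrow> norm (e t) \<le> G * (norm d + (\<integral>s. r s \<partial>leb01))"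
    define M where "M = G * Bg"
    have M0: "M \<ge> 0" using G Bg by (simp add: M_def)
    have bound: "norm (adj u t) \<le> M" if u: "L2 u" "L2norm u \<le> R" and t: "t \<in> {0..1}" for u t
    proof -
      have "norm (adj u t) \<le> G * (norm (ga (traj u 1)) + (\<integral>s. 0 \<partial>leb01))"
      proof (rule gr[where f="\<lambda>s. adj_kernel u s (adj u s)"])
        show "0 \<le> (0::real) \<and> norm (adj_kernel u s (adj u s)) \<le> B * norm (u s) * norm (adj u s) + 0"
          if "s \<in> {0..1}" for s
          using adj_kernel_le[OF B(3)[OF x_le[OF u that]]] by simp
      qed (use L2norm_scaled[OF u B(1)] adj[OF u(1)] t in \<open>auto simp: is_adj_def\<close>)
      also have "\<dots> \<le> G * (Bg + 0)"
        using G by (intro mult_left_mono add_mono Bg x_le u) auto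
      finally show ?thesis by (simp add: M_def)
    qed
    \<comment> \<open>Summands in order: change of the terminal value, change of \<open>DF\<close>
      along the trajectories (weighted by a control of norm at most \<open>R\<close>), direct change
      of the control in the kernel.\<close>
    define C where "C = G * (Cg * Cx + (M * (Cd * Cx) * R + M * B))"
    have C0: "C \<ge> 0" using G Bg B Cx M0 R by (simp add: C_def)
    have lip: "norm (adj u t - adj v t) \<le> C * L2norm (\<lambda>s. u s - v s)"
      if u: "L2 u" "L2norm u \<le> R" and v: "L2 v" "L2norm v \<le> R" and t: "t \<in> {0..1}"
      for u v t
    proof -
      have uv: "L2 (\<lambda>s. u s - v s)" by (rule L2_diff[OF u(1) v(1)])
      define \<delta> where "\<delta> = L2norm (\<lambda>s. u s - v s)"
      have \<delta>: "\<delta> \<ge> 0" by (simp add: \<delta>_def L2norm_ge_0)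
      have distr: "(Cd * (Cx * \<delta>) * p + B * q) * M = M * (Cd * Cx) * \<delta> * p + M * B * q" for p q
        by (simp add: algebra_simps)
      have c1: "0 \<le> M * (Cd * Cx) * \<delta>" and c2: "0 \<le> M * B" using M0 B Cx \<delta> by auto
      have "norm (adj u t - adj v t) \<le> G * (norm (ga (traj u 1) - ga (traj v 1))
          + (\<integral>s. M * (Cd * Cx) * \<delta> * norm (u s) + M * B * norm (u s - v s) \<partial>leb01))"
      proof (rule gr[where f="\<lambda>s. adj_kernel u s (adj u s) - adj_kernel v s (adj v s)"])
        show "adj u t - adj v t = ga (traj u 1) - ga (traj v 1) +
            (LINT s:{t..1}|leb01. adj_kernel u s (adj u s) - adj_kernel v s (adj v s))" if t: "t \<in> {0..1}" for t
          using adj[OF u(1)] adj[OF v(1)] t u v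
          by (subst set_integral_diff)
            (auto simp: is_adj_def intro!: bwd.set_integrable_D adj_kernel_integrable)
        fix s :: real assume s: "s \<in> {0..1}"
        \<comment> \<open>The first term is the Gronwall kernel acting on the difference; the second
          compares two kernels on the same bounded vector and becomes the source.\<close>
        have split: "adj_kernel u s (adj u s) - adj_kernel v s (adj v s)
            = adj_kernel u s (adj u s - adj v s) + (adj_kernel u s (adj v s) - adj_kernel v s (adj v s))"
          by (simp add: coord_adjoint_diff)
        have "norm (adj_kernel u s (adj u s - adj v s) + (adj_kernel u s (adj v s) - adj_kernel v s (adj v s)))
          \<le> B * norm (u s) * norm (adj u s - adj v s) + (Cd * (Cx * \<delta>) * norm (u s) + B * norm (u s - v s)) * M"
        proof (rule norm_triangle_mono)
          show "norm (adj_kernel u s (adj u s - adj v s)) \<le> B * norm (u s) * norm (adj u s - adj v s)"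
            by (rule adj_kernel_le[OF B(3)[OF x_le[OF u s]]])
          have "norm (DF (traj u s) - DF (traj v s)) \<le> Cd * norm (traj u s - traj v s)"
            by (rule B(4)[OF x_le[OF u s] x_le[OF v s]])
          also have "\<dots> \<le> Cd * (Cx * \<delta>)"
            unfolding \<delta>_def by (rule mult_left_mono[OF x_lip[OF u v s] B(2)])
          finally have "norm (DF (traj u s) - DF (traj v s)) \<le> Cd * (Cx * \<delta>)" .
          then have "norm (adj_kernel u s (adj v s) - adj_kernel v s (adj v s))
              \<le> (Cd * (Cx * \<delta>) * norm (u s) + B * norm (u s - v s)) * norm (adj v s)"
            by (rule adj_kernel_diff_le[OF _ B(3)[OF x_le[OF v s]]])
          also have "\<dots> \<le> (Cd * (Cx * \<delta>) * norm (u s) + B * norm (u s - v s)) * M"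
            by (rule mult_left_mono[OF bound[OF v s]]) (use B(1,2) Cx \<delta> in auto)
          finally show "norm (adj_kernel u s (adj v s) - adj_kernel v s (adj v s))
              \<le> (Cd * (Cx * \<delta>) * norm (u s) + B * norm (u s - v s)) * M" .
        qed
        then have le: "norm (adj_kernel u s (adj u s) - adj_kernel v s (adj v s))
            \<le> B * norm (u s) * norm (adj u s - adj v s) + (M * (Cd * Cx) * \<delta> * norm (u s) + M * B * norm (u s - v s))"
          by (simp only: split distr)
        have "0 \<le> M * (Cd * Cx) * \<delta> * norm (u s) + M * B * norm (u s - v s)"
          by (intro add_nonneg_nonneg mult_nonneg_nonneg[OF c1] mult_nonneg_nonneg[OF c2] norm_ge_zero)
        with le show "0 \<le> M * (Cd * Cx) * \<delta> * norm (u s) + M * B * norm (u s - v s) \<and>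
          norm (adj_kernel u s (adj u s) - adj_kernel v s (adj v s))
            \<le> B * norm (u s) * norm (adj u s - adj v s) + (M * (Cd * Cx) * \<delta> * norm (u s) + M * B * norm (u s - v s))"
          by blast
      qed (use L2norm_scaled[OF u B(1)] L2norm_scaled(4)[OF u c1] L2norm_scaled(4)[OF uv order_refl c2] u v t
          in \<open>auto intro!: continuous_intros adj_cont\<close>)
      also have "\<dots> \<le> G * (Cg * (Cx * \<delta>) + (M * (Cd * Cx) * \<delta> * R + M * B * \<delta>))"
      proof (intro mult_left_mono add_mono)
        have "norm (ga (traj u 1) - ga (traj v 1)) \<le> Cg * norm (traj u 1 - traj v 1)"
          by (intro Bg(4) x_le u v) auto
        also have "\<dots> \<le> Cg * (Cx * \<delta>)"
          unfolding \<delta>_def by (intro mult_left_mono x_lip u v Bg) auto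
        finally show "norm (ga (traj u 1) - ga (traj v 1)) \<le> Cg * (Cx * \<delta>)" .
        show "(\<integral>s. M * (Cd * Cx) * \<delta> * norm (u s) + M * B * norm (u s - v s) \<partial>leb01)
            \<le> M * (Cd * Cx) * \<delta> * R + M * B * \<delta>"
          using L2norm_scaled(4,5)[OF u c1] L2norm_scaled(4,5)[OF uv order_refl c2]
          by (subst Bochner_Integration.integral_add) (auto simp: \<delta>_def[symmetric])
      qed (use G in auto)
      also have "\<dots> = C * \<delta>" by (simp add: C_def algebra_simps)
      finally show ?thesis by (simp add: \<delta>_def)
    qed
    show thesis
      by (rule that[of M C]) (fact M0 C0 bound lip)+
  qed
qed

text \<open>The gradient of \<open>u \<mapsto> a (x\<^sub>u 1)\<close> has a continuous representative, namely the transpose of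
  \<open>F (x\<^sub>u t)\<close> applied to the adjoint state.\<close>

definition endpoint_grad :: "(real \<Rightarrow> real^'k) \<Rightarrow> real \<Rightarrow> real^'k" where
  "endpoint_grad u t = coord_adjoint (F (traj u t)) (adj u t)"

lemma endpoint_grad_cont: "L2 u \<Longrightarrow> continuous_on {0..1} (endpoint_grad u)"
  unfolding endpoint_grad_def coord_adjoint_def
  by (intro continuous_intros continuous_on_compose2[OF F_cont[of UNIV] traj_cont] adj_cont) auto

lemma linear_F: "linear (F x)"
  by (intro bounded_linear.linear blinfun.bounded_linear_right)

text \<open>Product rule for the transposed \<open>F\<close> applied to the adjoint state. The bound
  is uniform in \<open>t\<close>, which is what a Lipschitz map into continuous functions with the
  sup norm needs.\<close>

lemma endpoint_grad_lipschitz: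
  assumes R: "R \<ge> 0"
  obtains C where "C \<ge> 0"
    "\<And>u v t. \<lbrakk>L2 u; L2norm u \<le> R; L2 v; L2norm v \<le> R; t \<in> {0..1}\<rbrakk>
      \<Longrightarrow> norm (endpoint_grad u t - endpoint_grad v t) \<le> C * L2norm (\<lambda>s. u s - v s)"
proof (rule traj_bounds[OF R], rule adj_bounds[OF R])
  fix Mx Cx Ma Ca :: real
  assume x: "Mx \<ge> 0" "Cx \<ge> 0" "\<And>u t. \<lbrakk>L2 u; L2norm u \<le> R; t \<in> {0..1}\<rbrakk> \<Longrightarrow> norm (traj u t) \<le> Mx"
      "\<And>u v t. \<lbrakk>L2 u; L2norm u \<le> R; L2 v; L2norm v \<le> R; t \<in> {0..1}\<rbrakk>
        \<Longrightarrow> norm (traj u t - traj v t) \<le> Cx * L2norm (\<lambda>s. u s - v s)"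
    and l: "Ma \<ge> 0" "Ca \<ge> 0" "\<And>u t. \<lbrakk>L2 u; L2norm u \<le> R; t \<in> {0..1}\<rbrakk> \<Longrightarrow> norm (adj u t) \<le> Ma"
      "\<And>u v t. \<lbrakk>L2 u; L2norm u \<le> R; L2 v; L2norm v \<le> R; t \<in> {0..1}\<rbrakk>
        \<Longrightarrow> norm (adj u t - adj v t) \<le> Ca * L2norm (\<lambda>s. u s - v s)"
  define K where "K = norm (F 0) + L * Mx"
  have K0: "K \<ge> 0" using x L_nonneg by (simp add: K_def)
  show thesis
  proof (rule that[of "K * Ca + L * Cx * Ma"])
    show "0 \<le> K * Ca + L * Cx * Ma" using K0 l x L_nonneg by simp
    fix u v :: "real \<Rightarrow> real^'k" and t
    assume u: "L2 u" "L2norm u \<le> R" and v: "L2 v" "L2norm v \<le> R" and t: "t \<in> {0..1::real}"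
    define \<delta> where "\<delta> = L2norm (\<lambda>s. u s - v s)"
    have \<delta>: "\<delta> \<ge> 0" by (simp add: \<delta>_def L2norm_ge_0)
    have "L * norm (traj u t) \<le> L * Mx" by (intro mult_left_mono x u t L_nonneg)
    then have FK: "norm (F (traj u t)) \<le> K" using F_growth[of "traj u t"] by (simp add: K_def)
    have "endpoint_grad u t - endpoint_grad v t = coord_adjoint (F (traj u t)) (adj u t - adj v t)
        + coord_adjoint (\<lambda>w. F (traj u t) w - F (traj v t) w) (adj v t)"
      by (simp add: endpoint_grad_def coord_adjoint_diff)
    also have "norm \<dots> \<le> K * (Ca * \<delta>) + (L * (Cx * \<delta>)) * Ma"
    proof (intro norm_triangle_mono)
      have "norm (coord_adjoint (F (traj u t)) (adj u t - adj v t)) \<le> K * norm (adj u t - adj v t)"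
        by (intro norm_coord_adjoint_le linear_F order_trans[OF norm_blinfun] mult_right_mono FK) auto
      also have "\<dots> \<le> K * (Ca * \<delta>)"
        unfolding \<delta>_def by (intro mult_left_mono l u v t K0)
      finally show "norm (coord_adjoint (F (traj u t)) (adj u t - adj v t)) \<le> K * (Ca * \<delta>)" .
      have "norm (coord_adjoint (\<lambda>w. F (traj u t) w - F (traj v t) w) (adj v t)) \<le> (L * (Cx * \<delta>)) * norm (adj v t)"
      proof (intro norm_coord_adjoint_le linear_compose_sub linear_F)
        fix w
        have "norm (F (traj u t) w - F (traj v t) w) \<le> (L * norm (traj u t - traj v t)) * norm w"
          unfolding blinfun.diff_left[symmetric]
          by (intro order_trans[OF norm_blinfun] mult_right_mono F_lip) auto
        also have "\<dots> \<le> (L * (Cx * \<delta>)) * norm w"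
          unfolding \<delta>_def by (intro mult_right_mono mult_left_mono x u v t L_nonneg) auto
        finally show "norm (F (traj u t) w - F (traj v t) w) \<le> (L * (Cx * \<delta>)) * norm w" .
      qed
      also have "\<dots> \<le> (L * (Cx * \<delta>)) * Ma"
        using x \<delta> L_nonneg by (intro mult_left_mono l v t) auto
      finally show "norm (coord_adjoint (\<lambda>w. F (traj u t) w - F (traj v t) w) (adj v t)) \<le> (L * (Cx * \<delta>)) * Ma" .
    qed
    also have "\<dots> = (K * Ca + L * Cx * Ma) * \<delta>" by (simp add: algebra_simps)
    finally show "norm (endpoint_grad u t - endpoint_grad v t) \<le> (K * Ca + L * Cx * Ma) * L2norm (\<lambda>s. u s - v s)"
      by (simp add: \<delta>_def)
  qed
qed

text \<open>Pairing the increment of the state with the adjoint state cancels the terms linear in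
  that increment. The remainder contains a Taylor remainder of \<open>F\<close> and a product of
  increments of state and control, each quadratic in \<open>h\<close>. The bound on
  \<open>u + h\<close> keeps both controls in one ball; the triangle inequality supplies it on
  \<open>l2\<close>.\<close>

lemma endpoint_expansion:
  assumes u: "L2 u"
  obtains K where "K \<ge> 0"
    "\<And>h. \<lbrakk>L2 h; L2norm h \<le> 1; L2norm (\<lambda>s. u s + h s) \<le> L2norm u + 1\<rbrakk> \<Longrightarrow>
      \<bar>ga (traj u 1) \<bullet> (traj (\<lambda>s. u s + h s) 1 - traj u 1) - L2inner (endpoint_grad u) h\<bar> \<le> K * (L2norm h)\<^sup>2"
    "\<And>h. \<lbrakk>L2 h; L2norm h \<le> 1; L2norm (\<lambda>s. u s + h s) \<le> L2norm u + 1\<rbrakk> \<Longrightarrow>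
      norm (traj (\<lambda>s. u s + h s) 1 - traj u 1) \<le> K * L2norm h"
proof -
  define R where "R = L2norm u + 1"
  have R0: "R \<ge> 0" and uR: "L2norm u \<le> R" using L2norm_ge_0[of u] by (auto simp: R_def)
  define x where "x = traj u"
  define l where "l = adj u"
  have xc: "continuous_on {0..1} x" and lc: "continuous_on {0..1} l"
    using traj_cont[OF u] adj_cont[OF u] by (auto simp: x_def l_def)
  show thesis
  proof (rule traj_bounds[OF R0], rule adj_bounds[OF R0])
    fix Mx Cx Ma Ca :: real
    assume x: "Mx \<ge> 0" "Cx \<ge> 0" "\<And>u t. \<lbrakk>L2 u; L2norm u \<le> R; t \<in> {0..1}\<rbrakk> \<Longrightarrow> norm (traj u t) \<le> Mx"
        "\<And>u v t. \<lbrakk>L2 u; L2norm u \<le> R; L2 v; L2norm v \<le> R; t \<in> {0..1}\<rbrakk>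
          \<Longrightarrow> norm (traj u t - traj v t) \<le> Cx * L2norm (\<lambda>s. u s - v s)"
      and l: "Ma \<ge> 0" "\<And>u t. \<lbrakk>L2 u; L2norm u \<le> R; t \<in> {0..1}\<rbrakk> \<Longrightarrow> norm (adj u t) \<le> Ma"
    obtain B Cd where B: "B \<ge> 0" "Cd \<ge> 0" "\<And>x. norm x \<le> Mx \<Longrightarrow> norm (DF x) \<le> B"
      "\<And>x y. norm x \<le> Mx \<Longrightarrow> norm y \<le> Mx \<Longrightarrow> norm (DF x - DF y) \<le> Cd * norm (x - y)"
      using DF_bound[of Mx] by metis
    \<comment> \<open>First summand: Taylor remainder with state increment at most
      \<open>Cx * L2norm h\<close>, integrated against \<open>u\<close>. Second: increment of
      \<open>F\<close> times \<open>h\<close>. Both are weighted by the adjoint bound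
      \<open>Ma\<close>.\<close>
    define K1 where "K1 = Ma * (Cd * Cx\<^sup>2 * R + L * Cx)"
    have K1: "K1 \<ge> 0" using l B x R0 L_nonneg by (simp add: K1_def)
    have z_lip: "norm (traj (\<lambda>s. u s + h s) t - x t) \<le> Cx * L2norm h"
      if "L2 h" "L2norm (\<lambda>s. u s + h s) \<le> R" "t \<in> {0..1}" for h t
      using x(4)[OF L2_add[OF u that(1)] that(2) u uR that(3)] by (simp add: x_def)
    have main: "\<bar>ga (x 1) \<bullet> (traj (\<lambda>s. u s + h s) 1 - x 1) - L2inner (endpoint_grad u) h\<bar> \<le> K1 * (L2norm h)\<^sup>2"
      if h: "L2 h" and uhR: "L2norm (\<lambda>s. u s + h s) \<le> R" for h
    proof -
      define z where "z = traj (\<lambda>s. u s + h s)"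
      define \<eta> where "\<eta> = L2norm h"
      have \<eta>: "\<eta> \<ge> 0" by (simp add: \<eta>_def L2norm_ge_0)
      have uh: "L2 (\<lambda>s. u s + h s)" by (rule L2_add[OF u h])
      have zc: "continuous_on {0..1} z" using traj_cont[OF uh] by (simp add: z_def)
      define f where "f s = adj_kernel u s (l s)" for s
      define g where "g s = F (z s) (u s + h s) - F (x s) (u s)" for s
      have fi: "integrable leb01 f" unfolding f_def by (rule adj_kernel_integrable[OF u lc])
      have gi: "integrable leb01 g"
        unfolding g_def by (intro Bochner_Integration.integrable_diff F_apply_integrable u uh xc zc)
      have q: "z t - x t = (LINT s:{0..t}|leb01. g s)" if t: "t \<in> {0..1}" for t
        using traj[OF u] traj[OF uh] t unfolding g_def x_def z_def
        by (subst set_integral_diff)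
          (auto simp: is_traj_def intro!: fwd.set_integrable_D F_apply_integrable u uh traj_cont)
      have p: "l t = ga (x 1) + (LINT s:{t..1}|leb01. f s)" if t: "t \<in> {0..1}" for t
        using adj[OF u] t by (simp add: is_adj_def f_def l_def x_def)
      \<comment> \<open>Duality with the adjoint state as \<open>p\<close> and the true, not
        linearised, increment of the state as \<open>q\<close>.\<close>
      have dual: "ga (x 1) \<bullet> (z 1 - x 1) = (\<integral>t. l t \<bullet> g t \<partial>leb01) - (\<integral>s. f s \<bullet> (z s - x s) \<partial>leb01)"
        by (rule integration_by_parts_duality[OF fi gi p q])
      have i1: "integrable leb01 (\<lambda>s. l s \<bullet> g s)" by (rule integrable_inner_continuous[OF lc gi])
      have i2: "integrable leb01 (\<lambda>s. f s \<bullet> (z s - x s))"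
        using integrable_inner_continuous[OF continuous_on_diff[OF zc xc] fi] by (simp add: inner_commute)
      have i3: "integrable leb01 (\<lambda>s. endpoint_grad u s \<bullet> h s)"
        by (intro integrable_L2_inner L2_of_continuous endpoint_grad_cont u h)
      define r where "r s = l s \<bullet> g s - f s \<bullet> (z s - x s) - endpoint_grad u s \<bullet> h s" for s
      define c1 where "c1 = Ma * (Cd * Cx\<^sup>2) * \<eta>\<^sup>2"
      define c2 where "c2 = Ma * (L * Cx) * \<eta>"
      have c: "c1 \<ge> 0" "c2 \<ge> 0" using l B x L_nonneg \<eta> by (auto simp: c1_def c2_def)
      have r_le: "\<bar>r s\<bar> \<le> c1 * norm (u s) + c2 * norm (h s)" if s: "s \<in> {0..1}" for s
      proof -
        define d where "d = z s - x s"
        have d: "norm d \<le> Cx * \<eta>" using z_lip[OF h uhR s] by (simp add: d_def z_def \<eta>_def)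
        have zM: "norm (z s) \<le> Mx" and xM: "norm (x s) \<le> Mx"
          unfolding z_def x_def by (intro x uh uhR u uR s)+
        \<comment> \<open>Moving the transposes back gathers everything against \<open>l s\<close>;
          adding and subtracting \<open>F (x s) (h s)\<close> isolates the two second-order
          terms.\<close>
        have "r s = l s \<bullet> ((F (z s) - F (x s) - DF (x s) d) (u s) + (F (z s) - F (x s)) (h s))"
          unfolding r_def f_def g_def endpoint_grad_def d_def[symmetric] x_def[symmetric] l_def[symmetric]
            coord_adjoint_inner[OF linear_DF_apply] coord_adjoint_inner[OF linear_F]
          by (simp add: blinfun.bilinear_simps inner_diff_right inner_add_right)
        also have "\<bar>\<dots>\<bar> \<le> norm (l s) * norm ((F (z s) - F (x s) - DF (x s) d) (u s) + (F (z s) - F (x s)) (h s))"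
          by (rule Cauchy_Schwarz_ineq2)
        also have "\<dots> \<le> Ma * (Cd * (Cx * \<eta>)\<^sup>2 * norm (u s) + L * (Cx * \<eta>) * norm (h s))"
        proof (intro mult_mono norm_triangle_mono order_trans[OF norm_blinfun] mult_right_mono)
          show "norm (l s) \<le> Ma" unfolding l_def by (intro l u uR s)
          have "norm (F (z s) - F (x s) - DF (x s) d) \<le> Cd * (norm d)\<^sup>2"
            unfolding d_def by (intro F_taylor[OF xM zM] B) auto
          also have "\<dots> \<le> Cd * (Cx * \<eta>)\<^sup>2" using d by (intro mult_left_mono power_mono B) auto
          finally show "norm (F (z s) - F (x s) - DF (x s) d) \<le> Cd * (Cx * \<eta>)\<^sup>2" .
          have "norm (F (z s) - F (x s)) \<le> L * norm d" unfolding d_def by (rule F_lip)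
          also have "\<dots> \<le> L * (Cx * \<eta>)" using d L_nonneg by (intro mult_left_mono) auto
          finally show "norm (F (z s) - F (x s)) \<le> L * (Cx * \<eta>)" .
        qed (use l(1) B(1,2) x(1,2) L_nonneg \<eta> in auto)
        finally show ?thesis by (simp add: c1_def c2_def power2_eq_square algebra_simps)
      qed
      have "ga (x 1) \<bullet> (z 1 - x 1) - L2inner (endpoint_grad u) h = (\<integral>s. r s \<partial>leb01)"
        unfolding dual L2inner_eq r_def using i1 i2 i3 by simp
      moreover have "\<bar>\<integral>s. r s \<partial>leb01\<bar> \<le> (\<integral>s. c1 * norm (u s) + c2 * norm (h s) \<partial>leb01)"
        unfolding real_norm_def[symmetric]
      proof (rule Bochner_Integration.integral_norm_bound_integral)
        show "integrable leb01 r" unfolding r_def using i1 i2 i3 by simp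
      qed (use r_le L2_norm[OF u] L2_norm[OF h] in auto)
      moreover have "(\<integral>s. c1 * norm (u s) + c2 * norm (h s) \<partial>leb01) \<le> c1 * R + c2 * \<eta>"
        using L2norm_scaled(4,5)[OF u uR c(1)] L2norm_scaled(4,5)[OF h order_refl c(2)]
        by (subst Bochner_Integration.integral_add) (auto simp: \<eta>_def)
      moreover have "c1 * R + c2 * \<eta> = K1 * (L2norm h)\<^sup>2"
        by (simp add: c1_def c2_def K1_def \<eta>_def power2_eq_square algebra_simps)
      ultimately show ?thesis by (simp add: z_def)
    qed
    show thesis
    proof (rule that[of "max K1 Cx"])
      show "max K1 Cx \<ge> 0" using K1 by simp
      fix h assume h: "L2 h" "L2norm h \<le> 1" "L2norm (\<lambda>s. u s + h s) \<le> L2norm u + 1"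
      have "K1 * (L2norm h)\<^sup>2 \<le> max K1 Cx * (L2norm h)\<^sup>2" "Cx * L2norm h \<le> max K1 Cx * L2norm h"
        by (auto intro!: mult_right_mono L2norm_ge_0)
      then show "\<bar>ga (traj u 1) \<bullet> (traj (\<lambda>s. u s + h s) 1 - traj u 1) - L2inner (endpoint_grad u) h\<bar> \<le> max K1 Cx * (L2norm h)\<^sup>2"
        "norm (traj (\<lambda>s. u s + h s) 1 - traj u 1) \<le> max K1 Cx * L2norm h"
        using main[of h] z_lip[of h 1] h by (auto simp: x_def R_def)
    qed
  qed
qed

end

section \<open>The gradient as a field on the space of controls\<close>

definition clamp01 :: "real \<Rightarrow> real" where
  "clamp01 t = max 0 (min 1 t)"

lemma clamp01: "clamp01 t \<in> {0..1}" "t \<in> {0..1} \<Longrightarrow> clamp01 t = t"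
  by (auto simp: clamp01_def)

lemma clamp01_cont: "continuous_on UNIV clamp01"
  unfolding clamp01_def by (intro continuous_intros)

text \<open>The map \<open>\<iota>\<close> of \<open>gradient_flow_exists\<close>. Bounded
  continuous functions on the line stand in for continuous functions on the unit interval, after
  composition with \<open>clamp01\<close>.\<close>

definition l2_embed :: "(real \<Rightarrow>\<^sub>C (real^'k)) \<Rightarrow> 'k::finite l2" where
  "l2_embed b = abs_l2 (apply_bcontfun b)"

lemma L2_bcontfun: "L2 (apply_bcontfun b)"
  by (rule L2_of_continuous) (rule continuous_on_apply_bcontfun)

lemma norm_l2_embed_le: "norm (l2_embed b) \<le> norm b"
proof -
  have "(\<integral>t. (norm (apply_bcontfun b t))\<^sup>2 \<partial>leb01) \<le> (\<integral>t. (norm b)\<^sup>2 \<partial>leb01)"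
    using L2_bcontfun[of b]
    by (intro integral_mono integrable_leb01_continuous power_mono norm_bounded continuous_intros) (auto simp: L2_iff)
  also have "\<dots> = (norm b)\<^sup>2" by (simp add: measure_restrict_space)
  finally show ?thesis
    unfolding l2_embed_def L2norm_abs[OF L2_bcontfun] L2norm_eq by (intro real_le_lsqrt) auto
qed

lemma bounded_linear_l2_embed: "bounded_linear l2_embed"
proof (rule bounded_linear_intro[where K=1])
  show "l2_embed (b + c) = l2_embed b + l2_embed c" for b c :: "real \<Rightarrow>\<^sub>C (real^'a)"
    unfolding l2_embed_def by (simp add: plus_bcontfun.rep_eq abs_l2_add L2_bcontfun)
  show "l2_embed (r *\<^sub>R b) = r *\<^sub>R l2_embed b" for r and b :: "real \<Rightarrow>\<^sub>C (real^'a)"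
    unfolding l2_embed_def by (simp add: scaleR_bcontfun.rep_eq abs_l2_scaleR L2_bcontfun)
qed (simp add: norm_l2_embed_le)

lemma norm_abs_l2_diff: "L2 u \<Longrightarrow> L2 v \<Longrightarrow> norm (abs_l2 u - abs_l2 v) = L2norm (\<lambda>s. u s - v s)"
  by (simp add: L2norm_abs L2_diff flip: abs_l2_diff)

lemma norm_l2_diff: "norm (u - v) = L2norm (\<lambda>s. rep_l2 u s - rep_l2 v s)"
  using norm_abs_l2_diff[OF L2_rep L2_rep, of u v] by simp

context control_problem
begin

text \<open>Trajectories depend on the class of the control only: Lipschitz dependence at L2
  distance zero. This makes functionals written with \<open>rep_l2\<close> meaningful.\<close>

lemma traj_cong:
  assumes "L2 u" "L2 v" "L2norm (\<lambda>s. u s - v s) = 0" "t \<in> {0..1}"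
  shows "traj u t = traj v t"
proof -
  have "norm (traj u t - traj v t) \<le> 0"
  proof (rule traj_bounds[of "max (L2norm u) (L2norm v)"])
    show "0 \<le> max (L2norm u) (L2norm v)" by (simp add: le_max_iff_disj L2norm_ge_0)
    fix M C assume "\<And>u' v' t. \<lbrakk>L2 u'; L2norm u' \<le> max (L2norm u) (L2norm v); L2 v'; L2norm v' \<le> max (L2norm u) (L2norm v); t \<in> {0..1}\<rbrakk>
      \<Longrightarrow> norm (traj u' t - traj v' t) \<le> C * L2norm (\<lambda>s. u' s - v' s)"
    from this[OF assms(1) _ assms(2) _ assms(4)] assms(3) show ?thesis by simp
  qed
  then show ?thesis by simp
qed

text \<open>The map \<open>H\<close> of \<open>gradient_flow_exists\<close>: the part of the
  gradient beside the identity, before it is embedded into \<open>l2\<close>.\<close>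

definition grad_bcontfun :: "real \<Rightarrow> 'k l2 \<Rightarrow> real \<Rightarrow>\<^sub>C (real^'k)" where
  "grad_bcontfun \<beta> u = Bcontfun (\<lambda>t. \<beta> *\<^sub>R endpoint_grad (rep_l2 u) (clamp01 t))"

lemma apply_grad_bcontfun: "apply_bcontfun (grad_bcontfun \<beta> u) t = \<beta> *\<^sub>R endpoint_grad (rep_l2 u) (clamp01 t)"
proof -
  let ?g = "\<lambda>t. \<beta> *\<^sub>R endpoint_grad (rep_l2 u) t"
  have c: "continuous_on {0..1} ?g"
    by (intro continuous_intros endpoint_grad_cont L2_rep)
  then have "compact (?g ` {0..1})" by (rule compact_continuous_image) auto
  then obtain B where B: "\<forall>y\<in>?g ` {0..1}. norm y \<le> B"
    using compact_imp_bounded[of "?g ` {0..1}"] unfolding bounded_iff by blast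
  have "(\<lambda>t. ?g (clamp01 t)) \<in> bcontfun"
  proof (rule bcontfun_normI)
    show "continuous_on UNIV (\<lambda>t. ?g (clamp01 t))"
      by (rule continuous_on_compose2[OF c clamp01_cont]) (use clamp01 in auto)
    show "norm (?g (clamp01 t)) \<le> B" for t
      by (rule B[rule_format]) (intro imageI clamp01)
  qed
  then show ?thesis unfolding grad_bcontfun_def by (subst Bcontfun_inverse) auto
qed

lemma grad_bcontfun_lipschitz:
  "\<exists>C. \<forall>u v. norm u \<le> R \<and> norm v \<le> R \<longrightarrow> norm (grad_bcontfun \<beta> u - grad_bcontfun \<beta> v) \<le> C * norm (u - v)"
proof (rule endpoint_grad_lipschitz[of "max 0 R"])
  fix C :: real
  assume C: "C \<ge> 0" "\<And>u v t. \<lbrakk>L2 u; L2norm u \<le> max 0 R; L2 v; L2norm v \<le> max 0 R; t \<in> {0..1}\<rbrakk>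
      \<Longrightarrow> norm (endpoint_grad u t - endpoint_grad v t) \<le> C * L2norm (\<lambda>s. u s - v s)"
  show ?thesis
  proof (intro exI[of _ "\<bar>\<beta>\<bar> * C"] allI impI, elim conjE)
    fix u v :: "'k l2" assume uv: "norm u \<le> R" "norm v \<le> R"
    show "norm (grad_bcontfun \<beta> u - grad_bcontfun \<beta> v) \<le> \<bar>\<beta>\<bar> * C * norm (u - v)"
    proof (rule norm_bound)
      fix t
      have "norm (apply_bcontfun (grad_bcontfun \<beta> u - grad_bcontfun \<beta> v) t)
          = \<bar>\<beta>\<bar> * norm (endpoint_grad (rep_l2 u) (clamp01 t) - endpoint_grad (rep_l2 v) (clamp01 t))"
        by (simp add: apply_grad_bcontfun flip: scaleR_diff_right)
      also have "\<dots> \<le> \<bar>\<beta>\<bar> * (C * norm (u - v))"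
        unfolding norm_l2_diff
        by (intro mult_left_mono C L2_rep clamp01) (use uv in \<open>auto simp: norm_l2_rep\<close>)
      finally show "norm (apply_bcontfun (grad_bcontfun \<beta> u - grad_bcontfun \<beta> v) t) \<le> \<bar>\<beta>\<bar> * C * norm (u - v)"
        by (simp add: mult.assoc)
    qed
  qed
qed simp

lemma l2_embed_grad: "l2_embed (grad_bcontfun \<beta> u) = \<beta> *\<^sub>R abs_l2 (endpoint_grad (rep_l2 u))"
proof -
  have g: "L2 (endpoint_grad (rep_l2 u))" by (intro L2_of_continuous endpoint_grad_cont L2_rep)
  have "abs_l2 (apply_bcontfun (grad_bcontfun \<beta> u)) = abs_l2 (\<lambda>t. \<beta> *\<^sub>R endpoint_grad (rep_l2 u) t)"
    by (subst abs_l2_eq_iff) (auto intro!: L2_bcontfun L2_scaleR g AE_I2 simp: apply_grad_bcontfun clamp01)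
  then show ?thesis by (simp add: l2_embed_def abs_l2_scaleR[OF g])
qed

text \<open>Chain rule by hand: \<open>endpoint_expansion\<close> gives only the increment of the
  endpoint paired with \<open>ga\<close>, which is all that the first-order expansion of
  \<open>a\<close> involves. Each of the two errors takes half of \<open>e\<close>.\<close>

lemma endpoint_cost_has_derivative:
  assumes a: "\<And>x. (a has_derivative (\<lambda>h. ga x \<bullet> h)) (at x)"
  shows "((\<lambda>u. a (traj (rep_l2 u) 1)) has_derivative (\<lambda>h. abs_l2 (endpoint_grad (rep_l2 u)) \<bullet> h)) (at u)"
  unfolding has_derivative_at_alt
proof (intro conjI allI impI)
  show "bounded_linear (\<lambda>h. abs_l2 (endpoint_grad (rep_l2 u)) \<bullet> h)" by (rule bounded_linear_inner_right)
  fix e :: real assume e: "e > 0"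
  have g: "L2 (endpoint_grad (rep_l2 u))" by (intro L2_of_continuous endpoint_grad_cont L2_rep)
  let ?x = "traj (rep_l2 u) 1" and ?g = "abs_l2 (endpoint_grad (rep_l2 u))"
  show "\<exists>d>0. \<forall>y. norm (y - u) < d \<longrightarrow> norm (a (traj (rep_l2 y) 1) - a ?x - ?g \<bullet> (y - u)) \<le> e * norm (y - u)"
  proof (rule endpoint_expansion[OF L2_rep[of u]])
    fix K :: real
    assume K: "K \<ge> 0"
      "\<And>h. \<lbrakk>L2 h; L2norm h \<le> 1; L2norm (\<lambda>s. rep_l2 u s + h s) \<le> L2norm (rep_l2 u) + 1\<rbrakk> \<Longrightarrow>
        \<bar>ga ?x \<bullet> (traj (\<lambda>s. rep_l2 u s + h s) 1 - ?x) - L2inner (endpoint_grad (rep_l2 u)) h\<bar> \<le> K * (L2norm h)\<^sup>2"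
      "\<And>h. \<lbrakk>L2 h; L2norm h \<le> 1; L2norm (\<lambda>s. rep_l2 u s + h s) \<le> L2norm (rep_l2 u) + 1\<rbrakk> \<Longrightarrow>
        norm (traj (\<lambda>s. rep_l2 u s + h s) 1 - ?x) \<le> K * L2norm h"
    have e1: "e / (2 * (K + 1)) > 0" using e K by simp
    obtain d where d: "d > 0" "\<And>y. norm (y - ?x) < d \<Longrightarrow> \<bar>a y - a ?x - ga ?x \<bullet> (y - ?x)\<bar> \<le> e / (2 * (K + 1)) * norm (y - ?x)"
      using a[of ?x] e1 unfolding has_derivative_at_alt real_norm_def by metis
    \<comment> \<open>The entries of the minimum serve, in order: the range of the expansion, the
      neighbourhood in which \<open>a\<close> is close to its linearisation, and the absorption of
      the quadratic error. \<open>K + 1\<close> replaces \<open>K\<close> because \<open>K\<close>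
      may be 0.\<close>
    show ?thesis
    proof (intro exI[of _ "Min {1, d / (K + 1), e / (2 * (K + 1))}"] conjI allI impI)
      show "Min {1, d / (K + 1), e / (2 * (K + 1))} > 0" using d e K by simp
      fix y assume "norm (y - u) < Min {1, d / (K + 1), e / (2 * (K + 1))}"
      then have n: "norm (y - u) < 1" "norm (y - u) < d / (K + 1)" "norm (y - u) < e / (2 * (K + 1))" by auto
      define h where "h s = rep_l2 y s - rep_l2 u s" for s
      have h: "L2 h" unfolding h_def by (intro L2_diff L2_rep)
      have hn: "L2norm h = norm (y - u)" unfolding norm_l2_diff h_def by simp
      have ah: "abs_l2 h = y - u" unfolding h_def by (simp add: abs_l2_diff)
      have uh: "(\<lambda>s. rep_l2 u s + h s) = rep_l2 y" by (simp add: h_def)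
      have "L2norm (rep_l2 y) \<le> L2norm (rep_l2 u) + 1"
        using norm_triangle_ineq2[of y u] n by (simp add: norm_l2_rep[symmetric])
      then have k: "\<bar>ga ?x \<bullet> (traj (rep_l2 y) 1 - ?x) - ?g \<bullet> (y - u)\<bar> \<le> K * (norm (y - u))\<^sup>2"
          "norm (traj (rep_l2 y) 1 - ?x) \<le> K * norm (y - u)"
        using K(2,3)[OF h] n uh by (simp_all add: hn L2inner_abs[OF g h, symmetric] ah)
      have "K * norm (y - u) \<le> (K + 1) * norm (y - u)" by (intro mult_right_mono) auto
      also have "\<dots> < d" using n K by (simp add: field_simps)
      finally have "\<bar>a (traj (rep_l2 y) 1) - a ?x - ga ?x \<bullet> (traj (rep_l2 y) 1 - ?x)\<bar>
          \<le> e / (2 * (K + 1)) * norm (traj (rep_l2 y) 1 - ?x)"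
        by (intro d order_le_less_trans[OF k(2)])
      also have "\<dots> \<le> e / (2 * (K + 1)) * ((K + 1) * norm (y - u))"
        using k(2) e1 K by (intro mult_left_mono order_trans[OF k(2)] mult_right_mono) auto
      also have "\<dots> = e / 2 * norm (y - u)" using K by (simp add: field_simps)
      finally have 1: "\<bar>a (traj (rep_l2 y) 1) - a ?x - ga ?x \<bullet> (traj (rep_l2 y) 1 - ?x)\<bar> \<le> e / 2 * norm (y - u)" .
      have "K * (norm (y - u))\<^sup>2 = (K * norm (y - u)) * norm (y - u)" by (simp add: power2_eq_square)
      also have "\<dots> \<le> ((K + 1) * (e / (2 * (K + 1)))) * norm (y - u)"
        using n K by (intro mult_right_mono mult_mono) auto
      also have "\<dots> = e / 2 * norm (y - u)" using K(1) by (simp add: field_simps)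
      finally have 2: "K * (norm (y - u))\<^sup>2 \<le> e / 2 * norm (y - u)" .
      have "\<bar>a (traj (rep_l2 y) 1) - a ?x - ?g \<bullet> (y - u)\<bar> \<le> e / 2 * norm (y - u) + e / 2 * norm (y - u)"
        using 1 2 k(1) by linarith
      then show "norm (a (traj (rep_l2 y) 1) - a ?x - ?g \<bullet> (y - u)) \<le> e * norm (y - u)" by simp
    qed
  qed
qed

end

text \<open>Brings the derivative into the difference-quotient form of
  \<open>is_C1_flow_solution\<close>.\<close>

lemma has_vector_derivative_iff_quotient:
  "(V has_vector_derivative D) (at t within S) \<longleftrightarrow>
    ((\<lambda>s. norm ((V s - V t) /\<^sub>R (s - t) - D)) \<longlongrightarrow> 0) (at t within S)"
proof -
  have "norm (V s - V t - (s - t) *\<^sub>R D) / norm (s - t) = norm ((V s - V t) /\<^sub>R (s - t) - D)" if "s \<noteq> t" for s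
  proof -
    have "(V s - V t) /\<^sub>R (s - t) - D = (V s - V t - (s - t) *\<^sub>R D) /\<^sub>R (s - t)"
      using that by (simp add: scaleR_diff_right)
    then show ?thesis by (simp add: divide_inverse_commute)
  qed
  then have "((\<lambda>s. norm (V s - V t - (s - t) *\<^sub>R D) / norm (s - t)) \<longlongrightarrow> 0) (at t within S) \<longleftrightarrow>
      ((\<lambda>s. norm ((V s - V t) /\<^sub>R (s - t) - D)) \<longlongrightarrow> 0) (at t within S)"
    by (intro filterlim_cong) (auto simp: eventually_at_filter)
  then show ?thesis
    unfolding has_vector_derivative_def has_derivative_iff_norm
    by (simp add: bounded_linear_scaleR_left)
qed

section \<open>Twice continuously differentiable data\<close>

text \<open>\<open>gradient_flow_exists\<close> takes the values of \<open>H\<close> in a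
  \<open>banach\<close> type; here it is the type of \<open>grad_bcontfun\<close>.\<close>

instance bcontfun :: (metric_space, banach) banach ..

text \<open>The second derivative is bounded on the compact ball, and the ball is convex, so the
  mean value inequality applies to the first derivative.\<close>

lemma C2_derivative_lipschitz:
  fixes f :: "'a::euclidean_space \<Rightarrow> 'b::euclidean_space"
  assumes "C2 f"
  obtains f' where "\<And>x. (f has_derivative blinfun_apply (f' x)) (at x)"
    "\<And>R. \<exists>C. \<forall>x y. norm x \<le> R \<and> norm y \<le> R \<longrightarrow> norm (f' x - f' y) \<le> C * norm (x - y)"
proof -
  obtain f' f'' where f': "\<And>x. (f has_derivative blinfun_apply (f' x)) (at x)"
    and f'': "\<And>x. (f' has_derivative blinfun_apply (f'' x)) (at x)" and c: "continuous_on UNIV f''"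
    using assms unfolding C2_def by blast
  have "\<exists>C. \<forall>x y. norm x \<le> R \<and> norm y \<le> R \<longrightarrow> norm (f' x - f' y) \<le> C * norm (x - y)" for R
  proof -
    have "compact (f'' ` cball 0 R)"
      by (intro compact_continuous_image continuous_on_subset[OF c]) auto
    then obtain C where "\<forall>y\<in>f'' ` cball 0 R. norm y \<le> C"
      using compact_imp_bounded[of "f'' ` cball 0 R"] unfolding bounded_iff by blast
    then have C: "onorm (f'' x) \<le> C" if "x \<in> cball 0 R" for x
      using that by (auto simp: norm_blinfun.rep_eq[symmetric])
    have "norm (f' x - f' y) \<le> C * norm (x - y)" if "norm x \<le> R" "norm y \<le> R" for x y
      by (rule differentiable_bound[OF _ has_derivative_at_withinI[OF f''] C, where S="cball 0 R"])
        (use that in auto)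
    then show ?thesis by blast
  qed
  with f' show thesis by (rule that)
qed

section \<open>From matrix columns to operator-valued data\<close>

lemma lipschitz_on_balls_sum:
  fixes f :: "'i \<Rightarrow> 'a::real_normed_vector \<Rightarrow> 'b::real_normed_vector"
    and T :: "'i \<Rightarrow> 'b \<Rightarrow> 'c::real_normed_vector"
  assumes "finite I" and T: "\<And>i. bounded_linear (T i)"
    and f: "\<And>i. \<exists>C. \<forall>x y. norm x \<le> R \<and> norm y \<le> R \<longrightarrow> norm (f i x - f i y) \<le> C * norm (x - y)"
  shows "\<exists>C. \<forall>x y. norm x \<le> R \<and> norm y \<le> R \<longrightarrow>
      norm ((\<Sum>i\<in>I. T i (f i x)) - (\<Sum>i\<in>I. T i (f i y))) \<le> C * norm (x - y)"
proof -
  obtain C where C: "\<And>i x y. norm x \<le> R \<Longrightarrow> norm y \<le> R \<Longrightarrow> norm (f i x - f i y) \<le> C i * norm (x - y)"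
    using f by metis
  show ?thesis
  proof (intro exI[of _ "\<Sum>i\<in>I. onorm (T i) * C i"] allI impI, elim conjE)
    fix x y :: 'a assume xy: "norm x \<le> R" "norm y \<le> R"
    have "norm ((\<Sum>i\<in>I. T i (f i x)) - (\<Sum>i\<in>I. T i (f i y))) \<le> (\<Sum>i\<in>I. norm (T i (f i x - f i y)))"
      unfolding sum_subtractf[symmetric] linear_diff[OF bounded_linear.linear[OF T], symmetric] by (rule norm_sum)
    also have "\<dots> \<le> (\<Sum>i\<in>I. onorm (T i) * (C i * norm (x - y)))"
      by (intro sum_mono order_trans[OF onorm[OF T]] mult_left_mono C xy onorm_pos_le T)
    also have "\<dots> = (\<Sum>i\<in>I. onorm (T i) * C i) * norm (x - y)"
      by (simp add: sum_distrib_right mult.assoc)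
    finally show "norm ((\<Sum>i\<in>I. T i (f i x)) - (\<Sum>i\<in>I. T i (f i y))) \<le> (\<Sum>i\<in>I. onorm (T i) * C i) * norm (x - y)" .
  qed
qed

text \<open>Cauchy-Schwarz row by row, summed in the l1 norm. The factor is crude, but any bound
  linear in \<open>norm A\<close> keeps \<open>F\<close> globally Lipschitz as an operator.\<close>

lemma norm_matrix_vector_mult_le:
  fixes A :: "real^'k^'n"
  shows "norm (A *v v) \<le> real CARD('n) * norm A * norm v"
proof -
  have "norm (A *v v) \<le> (\<Sum>j\<in>UNIV. \<bar>(A *v v) $ j\<bar>)" by (rule norm_le_l1_cart)
  also have "\<dots> \<le> (\<Sum>j\<in>(UNIV::'n set). norm A * norm v)"
  proof (rule sum_mono)
    fix j
    have "(A *v v) $ j = A $ j \<bullet> v" by (rule matrix_vector_mul_component)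
    also have "\<bar>\<dots>\<bar> \<le> norm (A $ j) * norm v" by (rule Cauchy_Schwarz_ineq2)
    also have "\<dots> \<le> norm A * norm v" by (intro mult_right_mono Finite_Cartesian_Product.norm_nth_le) auto
    finally show "\<bar>(A *v v) $ j\<bar> \<le> norm A * norm v" .
  qed
  also have "\<dots> = real CARD('n) * norm A * norm v" by simp
  finally show ?thesis .
qed

text \<open>The rank-one operator sending \<open>v\<close> to its \<open>i\<close>-th coordinate
  times \<open>c\<close>. It is linear in \<open>c\<close>, so regularity known for single columns
  passes to the matrix as an operator by summation.\<close>

definition column_action :: "'k \<Rightarrow> real^'n \<Rightarrow> (real^'k::finite) \<Rightarrow>\<^sub>L (real^'n)" where
  "column_action i c = blinfun_scaleR_left c o\<^sub>L blinfun_inner_left (axis i 1)"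

lemma bounded_linear_column_action: "bounded_linear (column_action i)"
  unfolding column_action_def
  by (rule bounded_linear_compose[OF bounded_bilinear.bounded_linear_left[OF bounded_bilinear_blinfun_compose]
        bounded_linear_blinfun_scaleR_left])

lemma matrix_vector_mult_eq_column_action:
  "A *v v = blinfun_apply (\<Sum>i\<in>UNIV. column_action i (column i A)) v"
  by (simp add: column_action_def blinfun.sum_left matrix_mult_sum inner_axis inner_commute scalar_mult_eq_scaleR)

lemma control_problem_matrix:
  fixes F :: "real^'n \<Rightarrow> real^'k^'n" and a :: "real^'n \<Rightarrow> real"
  assumes F_lip: "L-lipschitz_on UNIV F" and F_C2: "\<And>i. C2 (\<lambda>x. column i (F x))" and a_C2: "C2 a"
  obtains DF ga where
    "control_problem (\<lambda>x. \<Sum>i\<in>UNIV. column_action i (column i (F x))) DF (real CARD('n) * L) ga"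
    "\<And>x. (a has_derivative (\<lambda>h. ga x \<bullet> h)) (at x)"
proof -
  have "\<forall>i. \<exists>f'. (\<forall>x. ((\<lambda>x. column i (F x)) has_derivative blinfun_apply (f' x)) (at x)) \<and>
      (\<forall>R. \<exists>C. \<forall>x y. norm x \<le> R \<and> norm y \<le> R \<longrightarrow> norm (f' x - f' y) \<le> C * norm (x - y))"
    using C2_derivative_lipschitz[OF F_C2] by metis
  then obtain f' where f': "\<And>i x. ((\<lambda>x. column i (F x)) has_derivative blinfun_apply (f' i x)) (at x)"
    and f'_lip: "\<And>i R. \<exists>C. \<forall>x y. norm x \<le> R \<and> norm y \<le> R \<longrightarrow> norm (f' i x - f' i y) \<le> C * norm (x - y)"
    by metis
  obtain a' where a': "\<And>x. (a has_derivative blinfun_apply (a' x)) (at x)"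
    and a'_lip: "\<And>R. \<exists>C. \<forall>x y. norm x \<le> R \<and> norm y \<le> R \<longrightarrow> norm (a' x - a' y) \<le> C * norm (x - y)"
    using C2_derivative_lipschitz[OF a_C2] by metis
  \<comment> \<open>Composition after the derivative of a column: by the chain rule,
    \<open>T i\<close> maps it to the derivative of the corresponding summand of the
    operator.\<close>
  define T where "T i f = Blinfun (column_action i) o\<^sub>L f" for i :: 'k and f :: "(real^'n) \<Rightarrow>\<^sub>L (real^'n)"
  have T: "bounded_linear (T i)" for i
    unfolding T_def by (rule bounded_bilinear.bounded_linear_right[OF bounded_bilinear_blinfun_compose])
  have T_apply: "blinfun_apply (T i f) h = column_action i (f h)" for i f h
    by (simp add: T_def bounded_linear_Blinfun_apply[OF bounded_linear_column_action])
  define DF where "DF x = (\<Sum>i\<in>UNIV. T i (f' i x))" for x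
  \<comment> \<open>The derivative of \<open>a\<close> is a functional into the reals; its transpose
    applied to 1 is the gradient vector.\<close>
  define ga where "ga x = coord_adjoint (blinfun_apply (a' x)) 1" for x
  let ?F = "\<lambda>x. \<Sum>i\<in>UNIV. column_action i (column i (F x))"
  have lin: "linear (blinfun_apply (a' x))" for x
    by (intro bounded_linear.linear blinfun.bounded_linear_right)
  have "control_problem ?F DF (real CARD('n) * L) ga"
  proof
    show "0 \<le> real CARD('n) * L" using lipschitz_on_nonneg[OF F_lip] by simp
    show "norm (?F x - ?F y) \<le> real CARD('n) * L * norm (x - y)" for x y
    proof (rule norm_blinfun_bound)
      show "0 \<le> real CARD('n) * L * norm (x - y)" using lipschitz_on_nonneg[OF F_lip] by simp
      fix v
      have "norm ((?F x - ?F y) v) = norm ((F x - F y) *v v)"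
        by (simp add: blinfun.diff_left matrix_vector_mult_diff_rdistrib flip: matrix_vector_mult_eq_column_action)
      also have "\<dots> \<le> real CARD('n) * norm (F x - F y) * norm v" by (rule norm_matrix_vector_mult_le)
      also have "\<dots> \<le> real CARD('n) * (L * norm (x - y)) * norm v"
        using lipschitz_onD[OF F_lip, of x y] by (intro mult_right_mono mult_left_mono) (auto simp: dist_norm)
      finally show "norm ((?F x - ?F y) v) \<le> real CARD('n) * L * norm (x - y) * norm v" by (simp add: mult_ac)
    qed
    show "(?F has_derivative DF x) (at x)" for x
    proof -
      have "(?F has_derivative (\<lambda>h. \<Sum>i\<in>UNIV. column_action i (f' i x h))) (at x)"
        by (intro has_derivative_sum bounded_linear.has_derivative[OF bounded_linear_column_action] f')
      moreover have "(\<lambda>h. \<Sum>i\<in>UNIV. column_action i (f' i x h)) = blinfun_apply (DF x)"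
        by (simp add: DF_def blinfun.sum_left T_apply fun_eq_iff)
      ultimately show ?thesis by simp
    qed
    show "\<exists>C. \<forall>x y. norm x \<le> R \<and> norm y \<le> R \<longrightarrow> norm (DF x - DF y) \<le> C * norm (x - y)" for R
      unfolding DF_def by (rule lipschitz_on_balls_sum[OF finite T f'_lip])
    show "\<exists>C. \<forall>x y. norm x \<le> R \<and> norm y \<le> R \<longrightarrow> norm (ga x - ga y) \<le> C * norm (x - y)" for R
    proof -
      obtain C where C: "\<And>x y. norm x \<le> R \<Longrightarrow> norm y \<le> R \<Longrightarrow> norm (a' x - a' y) \<le> C * norm (x - y)"
        using a'_lip by metis
      have "norm (ga x - ga y) \<le> C * norm (x - y)" if "norm x \<le> R" "norm y \<le> R" for x y
      proof -
        have "norm (coord_adjoint (\<lambda>v. a' x v - a' y v) (1::real)) \<le> norm (a' x - a' y) * norm (1::real)"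
        proof (rule norm_coord_adjoint_le)
          show "linear (\<lambda>v. a' x v - a' y v)" by (intro linear_compose_sub lin)
          show "norm (a' x v - a' y v) \<le> norm (a' x - a' y) * norm v" for v
            using norm_blinfun[of "a' x - a' y" v] by (simp add: blinfun.diff_left)
        qed
        with C[OF that] show ?thesis by (simp add: ga_def coord_adjoint_diff)
      qed
      then show ?thesis by blast
    qed
  qed
  moreover have "(a has_derivative (\<lambda>h. ga x \<bullet> h)) (at x)" for x
    using a'[of x] by (simp add: ga_def coord_adjoint_inner[OF lin])
  ultimately show thesis by (rule that)
qed

text \<open>On classes, existence and uniqueness come from \<open>gradient_flow_exists\<close> and
  \<open>flow_unique\<close>. What remains is to translate the endpoint, the functional, the
  gradients and the flow between functions and classes.\<close>

theorem mainTheorem6: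
  fixes F :: "real^'n \<Rightarrow> real^'k^'n" and x0 :: "real^'n"
    and a :: "real^'n \<Rightarrow> real" and \<beta> :: real
  assumes F_lip: "\<exists>L. L-lipschitz_on UNIV F"
    and a_nonneg: "\<forall>x. a x \<ge> 0"
    and F_C2: "\<forall>i. C2 (\<lambda>x. column i (F x))"
    and a_C2: "C2 a"
    and beta_pos: "\<beta> > 0"
  shows "(\<exists>G. is_L2_gradient (Fbeta F x0 a \<beta>) G) \<and>
         (\<forall>G. is_L2_gradient (Fbeta F x0 a \<beta>) G \<longrightarrow>
            (\<forall>u0. L2 u0 \<longrightarrow>
               (\<exists>U. is_C1_flow_solution G u0 U) \<and>
               (\<forall>U V. is_C1_flow_solution G u0 U \<and> is_C1_flow_solution G u0 V \<longrightarrow>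
                   (\<forall>t\<ge>0. L2norm (\<lambda>r. U t r - V t r) = 0))))"
proof -
  obtain L where L: "L-lipschitz_on UNIV F" using F_lip by blast
  define Fb where "Fb x = (\<Sum>i\<in>UNIV. column_action i (column i (F x)))" for x
  obtain DF ga where cp: "control_problem Fb DF (real CARD('n) * L) ga"
    and ga: "\<And>x. (a has_derivative (\<lambda>h. ga x \<bullet> h)) (at x)"
    using control_problem_matrix[OF L F_C2[rule_format] a_C2] unfolding Fb_def[abs_def, symmetric] by metis
  interpret control_problem Fb DF x0 "real CARD('n) * L" ga by (rule cp)
  \<comment> \<open>The definite description is meaningful because a trajectory exists and all
    trajectories of the same control share their endpoint.\<close>
  have endpoint: "endpoint F x0 u = traj u 1" if u: "L2 u" for u
  proof -
    have is_traj: "continuous_on {0..1} x \<and> (\<forall>t\<in>{0..1}. x t = x0 + (LINT s:{0..t}|lborel. F (x s) *v u s)) \<longleftrightarrow> is_traj u x" for x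
      unfolding is_traj_def
      by (intro conj_cong ball_cong refl) (subst set_integral_leb01, auto simp: Fb_def matrix_vector_mult_eq_column_action)
    have "endpoint F x0 u = (THE y. \<exists>x. is_traj u x \<and> x 1 = y)"
      unfolding endpoint_def by (simp add: is_traj[symmetric] conj_assoc)
    also have "\<dots> = traj u 1"
    proof (rule the_equality)
      show "\<exists>x. is_traj u x \<and> x 1 = traj u 1" using traj[OF u] by blast
      fix y assume "\<exists>x. is_traj u x \<and> x 1 = y"
      then obtain x where "is_traj u x" "x 1 = y" by blast
      then show "y = traj u 1" using traj_unique[OF u, of x 1] by simp
    qed
    finally show ?thesis .
  qed
  define \<Phi> where "\<Phi> u = (norm u)\<^sup>2 / 2 + \<beta> * a (traj (rep_l2 u) 1)" for u
  define g where "g u = u + l2_embed (grad_bcontfun \<beta> u)" for u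
  \<comment> \<open>\<open>rep_l2 (abs_l2 u)\<close> need not be \<open>u\<close>, but it is at L2
    distance zero, so \<open>traj_cong\<close> applies.\<close>
  have Fbeta: "Fbeta F x0 a \<beta> u = \<Phi> (abs_l2 u)" if u: "L2 u" for u
  proof -
    have "L2norm (\<lambda>s. rep_l2 (abs_l2 u) s - u s) = 0"
      using norm_abs_l2_diff[OF L2_rep u, of "abs_l2 u"] by simp
    then have "traj (rep_l2 (abs_l2 u)) 1 = traj u 1" by (intro traj_cong u L2_rep) auto
    then show ?thesis by (simp add: Fbeta_def \<Phi>_def L2norm_abs[OF u] endpoint[OF u])
  qed
  have \<Phi>_grad: "(\<Phi> has_derivative (\<lambda>h. g u \<bullet> h)) (at u)" for u
  proof -
    have "((\<lambda>u. u \<bullet> u / 2) has_derivative (\<lambda>h. u \<bullet> h)) (at u)"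
      by (auto intro!: derivative_eq_intros simp: inner_commute)
    moreover have "((\<lambda>u. \<beta> * a (traj (rep_l2 u) 1)) has_derivative (\<lambda>h. \<beta> * (abs_l2 (endpoint_grad (rep_l2 u)) \<bullet> h))) (at u)"
      by (intro has_derivative_mult_right endpoint_cost_has_derivative ga)
    ultimately have "((\<lambda>u. u \<bullet> u / 2 + \<beta> * a (traj (rep_l2 u) 1)) has_derivative
        (\<lambda>h. u \<bullet> h + \<beta> * (abs_l2 (endpoint_grad (rep_l2 u)) \<bullet> h))) (at u)"
      by (rule has_derivative_add)
    then show ?thesis
      unfolding \<Phi>_def[abs_def] g_def l2_embed_grad by (simp add: power2_norm_eq_inner inner_add_left)
  qed
  have \<Phi>_ge: "(norm u)\<^sup>2 / 2 \<le> \<Phi> u" for u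
    using a_nonneg beta_pos by (simp add: \<Phi>_def)
  obtain B where B: "B \<ge> 0" "\<And>b. norm (l2_embed b :: 'k l2) \<le> norm b * B"
    using bounded_linear.nonneg_bounded[OF bounded_linear_l2_embed] by blast
  have g_lip: "\<exists>C. \<forall>u v. norm u \<le> R \<and> norm v \<le> R \<longrightarrow> norm (g u - g v) \<le> C * norm (u - v)" for R
  proof -
    obtain C where C: "\<And>u v. norm u \<le> R \<Longrightarrow> norm v \<le> R \<Longrightarrow> norm (grad_bcontfun \<beta> u - grad_bcontfun \<beta> v) \<le> C * norm (u - v)"
      using grad_bcontfun_lipschitz[of R \<beta>] by blast
    have "norm (g u - g v) \<le> (1 + C * B) * norm (u - v)" if "norm u \<le> R" "norm v \<le> R" for u v
    proof -
      have "g u - g v = (u - v) + l2_embed (grad_bcontfun \<beta> u - grad_bcontfun \<beta> v)"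
        by (simp add: g_def linear_diff[OF bounded_linear.linear[OF bounded_linear_l2_embed]])
      also have "norm \<dots> \<le> norm (u - v) + (C * norm (u - v)) * B"
        by (intro norm_triangle_mono order_refl order_trans[OF B(2)] mult_right_mono C that B)
      finally show ?thesis by (simp add: algebra_simps)
    qed
    then show ?thesis by blast
  qed
  have g_cont: "continuous_on UNIV g"
    unfolding continuous_on_eq_continuous_within
  proof
    fix u :: "'k l2"
    obtain C where C: "\<And>v w. norm v \<le> norm u + 1 \<Longrightarrow> norm w \<le> norm u + 1 \<Longrightarrow> norm (g v - g w) \<le> C * norm (v - w)"
      using g_lip by blast
    have "\<forall>\<^sub>F v in at u. norm (g v - g u) \<le> C * norm (v - u)"
      unfolding eventually_at
    proof (intro exI[of _ 1] conjI ballI impI)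
      fix v assume "v \<noteq> u \<and> dist v u < 1"
      then show "norm (g v - g u) \<le> C * norm (v - u)"
        using norm_triangle_ineq2[of v u] by (intro C) (auto simp: dist_norm)
    qed simp
    moreover have "((\<lambda>v. C * norm (v - u)) \<longlongrightarrow> 0) (at u)"
      by (rule tendsto_eq_intros refl | simp)+
    ultimately have "((\<lambda>v. g v - g u) \<longlongrightarrow> 0) (at u)"
      by (rule Lim_null_comparison)
    then show "continuous (at u within UNIV) g"
      by (simp add: continuous_within LIM_zero_iff)
  qed
  \<comment> \<open>Gradients as functions are exactly the choices of representatives of
    \<open>g\<close>. This yields both a gradient and control over every gradient.\<close>
  have grad_iff: "is_L2_gradient (Fbeta F x0 a \<beta>) G \<longleftrightarrow> (\<forall>u. L2 u \<longrightarrow> L2 (G u) \<and> abs_l2 (G u) = g (abs_l2 u))" for G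
  proof
    assume G: "is_L2_gradient (Fbeta F x0 a \<beta>) G"
    show "\<forall>u. L2 u \<longrightarrow> L2 (G u) \<and> abs_l2 (G u) = g (abs_l2 u)"
    proof (intro allI impI conjI)
      fix u :: "real \<Rightarrow> real^'k" assume u: "L2 u"
      with G show Gu: "L2 (G u)" by (simp add: is_L2_gradient_def)
      have "(\<Phi> has_derivative (\<lambda>h. abs_l2 (G u) \<bullet> h)) (at (abs_l2 u))"
        unfolding has_derivative_at_alt
      proof (intro conjI allI impI bounded_linear_inner_right)
        fix e :: real assume "e > 0"
        then obtain d where d: "d > 0" "\<And>h. L2 h \<Longrightarrow> L2norm h < d \<Longrightarrow>
            \<bar>Fbeta F x0 a \<beta> (\<lambda>t. u t + h t) - Fbeta F x0 a \<beta> u - L2inner (G u) h\<bar> \<le> e * L2norm h"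
          using G u unfolding is_L2_gradient_def by metis
        show "\<exists>d>0. \<forall>y. norm (y - abs_l2 u) < d \<longrightarrow>
            norm (\<Phi> y - \<Phi> (abs_l2 u) - abs_l2 (G u) \<bullet> (y - abs_l2 u)) \<le> e * norm (y - abs_l2 u)"
        proof (intro exI[of _ d] conjI allI impI d)
          fix y assume y: "norm (y - abs_l2 u) < d"
          define h where "h t = rep_l2 y t - u t" for t
          have h: "L2 h" unfolding h_def by (intro L2_diff L2_rep u)
          have ah: "abs_l2 h = y - abs_l2 u" unfolding h_def by (simp add: abs_l2_diff u)
          have uh: "(\<lambda>t. u t + h t) = rep_l2 y" by (simp add: h_def)
          show "norm (\<Phi> y - \<Phi> (abs_l2 u) - abs_l2 (G u) \<bullet> (y - abs_l2 u)) \<le> e * norm (y - abs_l2 u)"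
            using d(2)[OF h] y
            by (simp add: uh Fbeta u L2inner_abs[OF Gu h, symmetric] L2norm_abs[OF h, symmetric] ah)
        qed
      qed
      \<comment> \<open>Two derivatives of the functional at one point agree as linear forms;
        nondegeneracy of the inner product on \<open>l2\<close> turns this into equality of
        classes.\<close>
      from has_derivative_unique[OF this \<Phi>_grad]
      have "abs_l2 (G u) \<bullet> h = g (abs_l2 u) \<bullet> h" for h by (rule fun_cong)
      then show "abs_l2 (G u) = g (abs_l2 u)"
        using vector_eq_rdot by blast
    qed
  next
    assume G: "\<forall>u. L2 u \<longrightarrow> L2 (G u) \<and> abs_l2 (G u) = g (abs_l2 u)"
    show "is_L2_gradient (Fbeta F x0 a \<beta>) G"
      unfolding is_L2_gradient_def
    proof (intro allI impI conjI)
      fix u :: "real \<Rightarrow> real^'k" assume u: "L2 u"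
      with G show Gu: "L2 (G u)" by simp
      fix e :: real assume "e > 0"
      then obtain d where d: "d > 0" "\<And>y. norm (y - abs_l2 u) < d \<Longrightarrow>
          norm (\<Phi> y - \<Phi> (abs_l2 u) - g (abs_l2 u) \<bullet> (y - abs_l2 u)) \<le> e * norm (y - abs_l2 u)"
        using \<Phi>_grad[of "abs_l2 u"] unfolding has_derivative_at_alt by metis
      show "\<exists>d>0. \<forall>h. L2 h \<and> L2norm h < d \<longrightarrow>
          \<bar>Fbeta F x0 a \<beta> (\<lambda>t. u t + h t) - Fbeta F x0 a \<beta> u - L2inner (G u) h\<bar> \<le> e * L2norm h"
      proof (intro exI[of _ d] conjI allI impI d, elim conjE)
        fix h :: "real \<Rightarrow> real^'k" assume h: "L2 h" "L2norm h < d"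
        show "\<bar>Fbeta F x0 a \<beta> (\<lambda>t. u t + h t) - Fbeta F x0 a \<beta> u - L2inner (G u) h\<bar> \<le> e * L2norm h"
          using d(2)[of "abs_l2 u + abs_l2 h"] h G u
          by (simp add: Fbeta L2_add abs_l2_add L2norm_abs flip: L2inner_abs[OF Gu h(1)])
      qed
    qed
  qed
  \<comment> \<open>On classes the solution notion becomes a vector derivative equation. The clause
    on continuity of the velocity is not lost: it follows from continuity of the differentiable
    curve and of \<open>g\<close>.\<close>
  have flow_iff: "is_C1_flow_solution G u0 U \<longleftrightarrow> (\<forall>t\<ge>0. L2 (U t)) \<and> abs_l2 (U 0) = abs_l2 u0 \<and>
      (\<forall>t\<ge>0. ((\<lambda>s. abs_l2 (U s)) has_vector_derivative - g (abs_l2 (U t))) (at t within {0..}))"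
    if G: "is_L2_gradient (Fbeta F x0 a \<beta>) G" and u0: "L2 u0" for G u0 U
  proof (cases "\<forall>t\<ge>0. L2 (U t)")
    case True
    then have U: "L2 (U t)" if "t \<ge> 0" for t using that by simp
    have G': "L2 (G (U t))" "abs_l2 (G (U t)) = g (abs_l2 (U t))" if "t \<ge> 0" for t
      using G[unfolded grad_iff] U[OF that] by auto
    let ?V = "\<lambda>s. abs_l2 (U s)"
    have init: "L2norm (\<lambda>r. U 0 r - u0 r) = 0 \<longleftrightarrow> abs_l2 (U 0) = abs_l2 u0"
      using norm_abs_l2_diff[OF U u0, of 0] by (metis eq_iff_diff_eq_0 norm_eq_zero order_refl)
    have der: "((\<lambda>s. L2norm (\<lambda>r. (U s r - U t r) /\<^sub>R (s - t) + G (U t) r)) \<longlongrightarrow> 0) (at t within {0..}) \<longleftrightarrow>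
        (?V has_vector_derivative - g (?V t)) (at t within {0..})" if t: "t \<ge> 0" for t
      unfolding has_vector_derivative_iff_quotient
    proof (intro filterlim_cong refl)
      show "\<forall>\<^sub>F s in at t within {0..}. L2norm (\<lambda>r. (U s r - U t r) /\<^sub>R (s - t) + G (U t) r)
          = norm ((?V s - ?V t) /\<^sub>R (s - t) - - g (?V t))"
        unfolding eventually_at_filter
      proof (intro always_eventually allI impI)
        fix s :: real assume s: "s \<in> {0..}"
        then have st: "L2 (U s)" "L2 (U t)" "L2 (G (U t))" using U G' t by auto
        show "L2norm (\<lambda>r. (U s r - U t r) /\<^sub>R (s - t) + G (U t) r) = norm ((?V s - ?V t) /\<^sub>R (s - t) - - g (?V t))"
          by (simp add: st L2_add L2_scaleR L2_diff G'(2)[OF t, symmetric] flip: L2norm_abs abs_l2_add abs_l2_diff abs_l2_scaleR)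
      qed
    qed
    have cont: "((\<lambda>s. L2norm (\<lambda>r. G (U s) r - G (U t) r)) \<longlongrightarrow> 0) (at t within {0..})"
      if t: "t \<ge> 0" and V: "(?V has_vector_derivative - g (?V t)) (at t within {0..})" for t
    proof -
      have "(?V \<longlongrightarrow> ?V t) (at t within {0..})"
        using has_vector_derivative_continuous[OF V] by (simp add: continuous_within)
      then have "((\<lambda>s. g (?V s)) \<longlongrightarrow> g (?V t)) (at t within {0..})"
        by (rule continuous_on_tendsto_compose[OF g_cont]) auto
      then have "((\<lambda>s. norm (g (?V s) - g (?V t))) \<longlongrightarrow> 0) (at t within {0..})"
        by (intro tendsto_norm_zero LIM_zero)
      moreover have "\<forall>\<^sub>F s in at t within {0..}. norm (g (?V s) - g (?V t)) = L2norm (\<lambda>r. G (U s) r - G (U t) r)"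
        unfolding eventually_at_filter
        by (intro always_eventually allI impI) (simp add: G'(2)[symmetric] norm_abs_l2_diff G'(1) t)
      ultimately show ?thesis by (rule Lim_transform_eventually)
    qed
    show ?thesis
      unfolding is_C1_flow_solution_def init using True der cont by auto
  next
    case False
    then show ?thesis by (auto simp: is_C1_flow_solution_def)
  qed
  show ?thesis
  proof (intro conjI allI impI)
    show "\<exists>G. is_L2_gradient (Fbeta F x0 a \<beta>) G"
      \<comment> \<open>Any choice of representatives of \<open>g\<close> is a gradient, by
        \<open>grad_iff\<close>.\<close>
      by (intro exI[of _ "\<lambda>u. rep_l2 (g (abs_l2 u))"]) (simp add: grad_iff)
  next
    fix G and u0 :: "real \<Rightarrow> real^'k"
    assume G: "is_L2_gradient (Fbeta F x0 a \<beta>) G" and u0: "L2 u0"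
    obtain V where V: "V 0 = abs_l2 u0" "\<And>t. t \<ge> 0 \<Longrightarrow> (V has_vector_derivative - g (V t)) (at t within {0..})"
      using gradient_flow_exists[where H="grad_bcontfun \<beta>" and ?u0.0="abs_l2 u0",
          OF bounded_linear_l2_embed grad_bcontfun_lipschitz \<Phi>_grad[unfolded g_def] \<Phi>_ge]
      unfolding g_def by metis
    show "\<exists>U. is_C1_flow_solution G u0 U"
      \<comment> \<open>Representatives may be chosen independently at each time, since every
        condition on the curve depends on classes.\<close>
      unfolding flow_iff[OF G u0] by (intro exI[of _ "\<lambda>t. rep_l2 (V t)"]) (simp add: V)
  next
    fix G and u0 :: "real \<Rightarrow> real^'k" and U V and t :: real
    assume G: "is_L2_gradient (Fbeta F x0 a \<beta>) G" and u0: "L2 u0"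
      and sol: "is_C1_flow_solution G u0 U \<and> is_C1_flow_solution G u0 V" and t: "t \<ge> 0"
    have U: "L2 (U t)" "abs_l2 (U 0) = abs_l2 u0" "\<And>t. t \<ge> 0 \<Longrightarrow> ((\<lambda>s. abs_l2 (U s)) has_vector_derivative - g (abs_l2 (U t))) (at t within {0..})"
      and V: "L2 (V t)" "abs_l2 (V 0) = abs_l2 u0" "\<And>t. t \<ge> 0 \<Longrightarrow> ((\<lambda>s. abs_l2 (V s)) has_vector_derivative - g (abs_l2 (V t))) (at t within {0..})"
      using sol t unfolding flow_iff[OF G u0] by auto
    have "abs_l2 (U t) = abs_l2 (V t)"
      by (rule flow_unique[OF g_lip U(3) V(3) _ t]) (simp_all add: U V)
    then show "L2norm (\<lambda>r. U t r - V t r) = 0"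
      using norm_abs_l2_diff[OF U(1) V(1)] by simp
  qed
qed

end
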